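(* Assume that $\|\mathcal F\|_{C^1}$ is finite. Fix $\beta=\beta_0$ and let $\lambda_0=\lambda_0(b,\Omega,d,\mathbf x_0,\beta)$, where $\beta_0$ and $\lambda_0$ are the Carleman constants described in the context. There is a constant $C>0$ depending only on $N$, $b$, $\Omega$, $d$, $\mathbf x_0$, $\beta$ and $\|\mathcal F\|_{C^1}$ (with $T$ and the basis $\{\Psi_n\}$ regarded as fixed) such that the following holds. For each $\lambda>\lambda_0$, let $U_0\in H$ be arbitrary and let $U_k=\Phi_{\lambda,\beta}(U_{k-1})$ for $k\ge 1$. Then for every $k\ge 1$, $$\int_{\Omega} e^{2\lambda r^\beta(\mathbf x)}\big(|U_k-U^*|^2+|\nabla(U_k-U^* )|^2\big)\,d\mathbf x \le \frac{C}{\lambda}\int_{\Omega} e^{2\lambda r^\beta(\mathbf x)}\big(|U_{k-1}-U^*|^2+|\nabla(U_{k-1}-U^* )|^2\big)\,d\mathbf x$$ $$+\Big(2+\frac{C}{\lambda}\Big)\int_{\Omega} e^{2\lambda r^\beta(\mathbf x)}\big(|\mathbf e|^2+|\nabla\mathbf e|^2+|\Delta\mathbf e|^2\big)\,d\mathbf x+\frac{C}{\lambda}\,\varepsilon\big(\|\mathbf e\|^2_{H^s(\Omega)^N}+\|U^*\|^2_{H^s(\Omega)^N}\big),$$ where $U^*$ is the true solution and $\mathbf e$ is the error function described in the context. In particular, if $\lambda>\lambda_0$ is fixed such that $\theta=\frac{C}{\lambda}\in(0,1)$ and $\lambda^3-C>\lambda$, then for every $k\ge1$, $$\int_{\Omega}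 e^{2\lambda r^\beta(\mathbf x)}\big(|U_k-U^*|^2+|\nabla(U_k-U^* )|^2\big)\,d\mathbf x \le \theta^k\int_{\Omega} e^{2\lambda r^\beta(\mathbf x)}\big(|U_0-U^*|^2+|\nabla(U_0-U^* )|^2\big)\,d\mathbf x$$ $$+\frac{3(1-\theta^{k+1})}{1-\theta}\int_{\Omega} e^{2\lambda r^\beta(\mathbf x)}\big(|\mathbf e|^2+|\nabla\mathbf e|^2+|\Delta\mathbf e|^2\big)\,d\mathbf x+\frac{\theta\varepsilon(1-\theta^k)}{1-\theta}\big(\|\mathbf e\|^2_{H^s(\Omega)^N}+\|U^*\|^2_{H^s(\Omega)^N}\big).$$
   Context: Setting. Let $d\ge 2$, $T>0$, and let $\Omega\subset\mathbb R^d$ be a bounded open domain with smooth boundary and outer normal $\nu$. Let $F:\mathbb R^d\times\mathbb R\times\mathbb R\times\mathbb R^d\to\mathbb R$ and $p:\mathbb R^d\to\mathbb R$ be smooth with $F(\mathbf x,p(\mathbf x),0,\nabla p(\mathbf x))\ne 0$ for all $\mathbf x\in\overline\Omega$. Let $\{\Psi_n\}_{n\ge1}$ be an orthonormal basis of $L^2[0,T]$ consisting of functions that are twice continuously differentiable on $[0,T]$, and fix $N\ge 1$. Let $S=(s_{mn})_{m,n=1}^N$ with $s_{mn}=\int_0^T\Psi_n''(t)\Psi_m(t)\,dt$. For a vector-valued function $U=(u_1,\dots,u_N)^{\rm T}$ on $\Omega$, let $\mathcal F(\mathbf x,U,\nabla U)\in\mathbb R^N$ be the vector whose $m$-th component,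 $1\le m\le N$, is $$\int_0^T\frac{\sum_{n=1}^N u_n(\mathbf x)\Psi_n''(0)-\Delta p(\mathbf x)}{F(\mathbf x,p(\mathbf x),0,\nabla p(\mathbf x))}\,F\Big(\mathbf x,\sum_{n=1}^N u_n(\mathbf x)\Psi_n(t),\sum_{n=1}^N u_n(\mathbf x)\Psi_n'(t),\sum_{n=1}^N\nabla u_n(\mathbf x)\Psi_n(t)\Big)\Psi_m(t)\,dt .$$ Thus $\mathcal F$ is a function on $\overline\Omega\times\mathbb R^N\times\mathbb R^{N\times d}$, and $\|\mathcal F\|_{C^1}$ is its $C^1$ norm on this set. Let $s>\lceil d/2\rceil+2$, so that $H^s(\Omega)$ embeds continuously in $C^2(\overline\Omega)$. Data, true solution, noise. Let $f,g$ be (noisy) lateral Cauchy data on $\partial\Omega\times[0,T]$ and $f^*,g^*$ their noiseless versions. Put $\mathbf f(\mathbf x)=\big(\int_0^T f(\mathbf x,t)\Psi_n(t)\,dt\big)_{n=1}^N$, $\mathbf g(\mathbf x)=\big(\int_0^T g(\mathbf x,t)\Psi_n(t)\,dt\big)_{n=1}^N$ for $\mathbf x\in\partial\Omega$, and define $\mathbf f^*,\mathbf g^*$ in the same way from $f^*,g^*$. The set $$H=\{V\in H^s(\Omega)^N:\ V|_{\partial\Omega}=\mathbf f,\ \partial_\nu V|_{\partial\Omega}=\mathbf g\}$$ is assumed nonempty. It is assumed that the problem $\Delta U^*-SU^*+\mathcal F(\mathbf x,U^*,\nabla U^* )=0$ in $\Omega$, $U^*=\mathbf f^*$ and $\partial_\nu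 U^*=\mathbf g^*$ on $\partial\Omega$, has a unique solution $U^*\in H^s(\Omega)^N$ (the true solution). With $\delta>0$ the noise level, it is assumed that $\inf\{\|\mathbf e\|_{H^s(\Omega)^N}:\mathbf e\in H^s(\Omega)^N,\ \mathbf e|_{\partial\Omega}=\mathbf f-\mathbf f^*,\ \partial_\nu\mathbf e|_{\partial\Omega}=\mathbf g-\mathbf g^*\}<\delta$. The error function $\mathbf e\in H^s(\Omega)^N$ is a function satisfying $\mathbf e|_{\partial\Omega}=\mathbf f-\mathbf f^*$, $\partial_\nu\mathbf e|_{\partial\Omega}=\mathbf g-\mathbf g^*$ and $\|\mathbf e\|_{H^s(\Omega)^N}<2\delta$. Weight and map. Let $\mathbf x_0\in\mathbb R^d\setminus\Omega$, $b>\max_{\mathbf x\in\overline\Omega}|\mathbf x-\mathbf x_0|$, $r(\mathbf x)=|\mathbf x-\mathbf x_0|/b$, and $r^\beta(\mathbf x)=(r(\mathbf x))^\beta$. Fix a regularization parameter $\varepsilon>0$. For $\lambda>1$, $\beta>1$, $V\in H$ and $\varphi\in H$, put $$J_{\lambda,\beta}(V)(\varphi)=\int_\Omega e^{2\lambda r^\beta(\mathbf x)}|\Delta\varphi-S\varphi+\mathcal F(\mathbf x,V,\nabla V)|^2\,d\mathbf x+\varepsilon\|\varphi\|^2_{H^s(\Omega)^N},$$ and let $\Phi_{\lambda,\beta}:H\to H$, $\Phi_{\lambda,\beta}(V)=\operatorname{argmin}_{\varphi\in H}J_{\lambda,\beta}(V)(\varphi)$ (the minimizer exists and is unique). Carleman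 constants. A known Carleman estimate provides a constant $\beta_0>0$ depending only on $b,\mathbf x_0,\Omega,d$ and, for each $\beta\ge\beta_0$, constants $\lambda_0=\lambda_0(b,\Omega,d,\mathbf x_0,\beta)>1$ and $C_1=C_1(b,\Omega,d,\mathbf x_0,\beta)>1$ such that for all $\lambda\ge\lambda_0$ and all $h\in C^2(\overline\Omega)$ with $h=\partial_\nu h=0$ on $\partial\Omega$, $$\int_\Omega e^{2\lambda r^\beta(\mathbf x)}|\Delta h|^2\,d\mathbf x\ge C_1\lambda\int_\Omega e^{2\lambda r^\beta(\mathbf x)}|\nabla h|^2\,d\mathbf x+C_1\lambda^3\int_\Omega e^{2\lambda r^\beta(\mathbf x)}|h|^2\,d\mathbf x .$$ The $\beta_0$ and $\lambda_0$ in the claim are these constants. *)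

theory Defs
  imports "HOL-Analysis.Analysis"
begin

text \<open>
  The space R^d is a Euclidean space \<open>'a\<close> with \<open>DIM('a) = d\<close>, and R^N is \<open>real ^ 'N\<close>.
  Functions on \<open>\<Omega>\<close> are total functions on \<open>'a\<close>; the notions for them depend only on
  their values on the open set \<open>\<Omega>\<close>. Integrals are Lebesgue integrals.
\<close>

subsection \<open>Classical derivatives\<close>

primrec iter_deriv :: "('a::euclidean_space \<Rightarrow> real) \<Rightarrow> 'a list \<Rightarrow> 'a \<Rightarrow> real" where
  "iter_deriv f [] = f"
| "iter_deriv f (i # is) = (\<lambda>x. frechet_derivative (iter_deriv f is) (at x) i)"

text \<open>Class C^k on an open set.\<close>

definition Ck_on :: "nat \<Rightarrow> 'a::euclidean_space set \<Rightarrow> ('a \<Rightarrow> real) \<Rightarrow> bool" where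
  "Ck_on k W f \<longleftrightarrow> (\<forall>is. set is \<subseteq> Basis \<longrightarrow>
     (length is < k \<longrightarrow> iter_deriv f is differentiable_on W) \<and>
     (length is \<le> k \<longrightarrow> continuous_on W (iter_deriv f is)))"

definition smooth_on :: "'a::euclidean_space set \<Rightarrow> ('a \<Rightarrow> real) \<Rightarrow> bool" where
  "smooth_on W f \<longleftrightarrow> (\<forall>k. Ck_on k W f)"

definition C2_closure :: "'a::euclidean_space set \<Rightarrow> ('a \<Rightarrow> real) \<Rightarrow> bool" where
  "C2_closure \<Omega> u \<longleftrightarrow> Ck_on 2 \<Omega> u \<and>
     (\<forall>is. set is \<subseteq> Basis \<and> length is \<le> 2 \<longrightarrow>
        (\<exists>g. continuous_on (closure \<Omega>) g \<and> (\<forall>x\<in>\<Omega>. g x = iter_deriv u is x)))"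

definition grad :: "('a::euclidean_space \<Rightarrow> real) \<Rightarrow> 'a \<Rightarrow> 'a" where
  "grad u x = (\<Sum>i\<in>Basis. frechet_derivative u (at x) i *\<^sub>R i)"

definition laplacian :: "('a::euclidean_space \<Rightarrow> real) \<Rightarrow> 'a \<Rightarrow> real" where
  "laplacian u x = (\<Sum>i\<in>Basis. iter_deriv u [i, i] x)"

definition vgrad :: "('a::euclidean_space \<Rightarrow> real ^ 'N) \<Rightarrow> 'a \<Rightarrow> 'a ^ 'N" where
  "vgrad U x = (\<chi> n. grad (\<lambda>y. U y $ n) x)"

definition vlaplacian :: "('a::euclidean_space \<Rightarrow> real ^ 'N) \<Rightarrow> 'a \<Rightarrow> real ^ 'N" where
  "vlaplacian U x = (\<chi> n. laplacian (\<lambda>y. U y $ n) x)"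

subsection \<open>Smooth domains, outer normal, boundary values\<close>

text \<open>\<open>\<rho>\<close> is a smooth local defining function: near \<open>x\<close>, the domain is \<open>{\<rho> < 0}\<close>.\<close>

definition local_defining ::
  "'a::euclidean_space set \<Rightarrow> 'a \<Rightarrow> 'a set \<Rightarrow> ('a \<Rightarrow> real) \<Rightarrow> bool" where
  "local_defining \<Omega> x W \<rho> \<longleftrightarrow> open W \<and> x \<in> W \<and> smooth_on W \<rho> \<and>
     (\<forall>y\<in>W. grad \<rho> y \<noteq> 0) \<and> (\<forall>y\<in>W. y \<in> \<Omega> \<longleftrightarrow> \<rho> y < 0)"

definition smooth_domain :: "'a::euclidean_space set \<Rightarrow> bool" where
  "smooth_domain \<Omega> \<longleftrightarrow> open \<Omega> \<and> connected \<Omega> \<and> \<Omega> \<noteq> {} \<and> bounded \<Omega> \<and>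
     (\<forall>x\<in>frontier \<Omega>. \<exists>W \<rho>. local_defining \<Omega> x W \<rho>)"

definition outer_normal :: "'a::euclidean_space set \<Rightarrow> ('a \<Rightarrow> 'a) \<Rightarrow> bool" where
  "outer_normal \<Omega> \<nu> \<longleftrightarrow> (\<forall>x\<in>frontier \<Omega>. \<exists>W \<rho>. local_defining \<Omega> x W \<rho> \<and>
     \<nu> x = grad \<rho> x /\<^sub>R norm (grad \<rho> x))"

text \<open>
  Boundary values and normal derivatives of functions of class C^2 up to the boundary,
  obtained from the continuous extensions of \<open>u\<close> and of its gradient.
\<close>

definition bdry_value ::
  "'a::euclidean_space set \<Rightarrow> ('a \<Rightarrow> 'b::t2_space) \<Rightarrow> 'a \<Rightarrow> 'b" where
  "bdry_value \<Omega> u x = Lim (at x within \<Omega>) u"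

definition normal_deriv ::
  "'a::euclidean_space set \<Rightarrow> ('a \<Rightarrow> 'a) \<Rightarrow> ('a \<Rightarrow> real) \<Rightarrow> 'a \<Rightarrow> real" where
  "normal_deriv \<Omega> \<nu> u x = bdry_value \<Omega> (grad u) x \<bullet> \<nu> x"

definition vnormal_deriv ::
  "'a::euclidean_space set \<Rightarrow> ('a \<Rightarrow> 'a) \<Rightarrow> ('a \<Rightarrow> real ^ 'N) \<Rightarrow> 'a \<Rightarrow> real ^ 'N" where
  "vnormal_deriv \<Omega> \<nu> U x = (\<chi> n. normal_deriv \<Omega> \<nu> (\<lambda>y. U y $ n) x)"

subsection \<open>Sobolev spaces\<close>

definition L2_on :: "'a::euclidean_space set \<Rightarrow> ('a \<Rightarrow> real) \<Rightarrow> bool" where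
  "L2_on A u \<longleftrightarrow> set_borel_measurable lebesgue A u \<and> set_integrable lebesgue A (\<lambda>x. (u x)\<^sup>2)"

definition multi_index :: "('a::euclidean_space \<Rightarrow> nat) \<Rightarrow> bool" where
  "multi_index \<alpha> \<longleftrightarrow> (\<forall>i. i \<notin> Basis \<longrightarrow> \<alpha> i = 0)"

definition order_of :: "('a::euclidean_space \<Rightarrow> nat) \<Rightarrow> nat" where
  "order_of \<alpha> = sum \<alpha> Basis"

text \<open>
  For \<open>\<phi>\<close> smooth the order of differentiation is irrelevant, so any list of directions in which
  every \<open>i\<close> occurs \<open>\<alpha> i\<close> times gives the partial derivative with multi-index \<open>\<alpha>\<close>.
\<close>

definition multi_deriv :: "('a::euclidean_space \<Rightarrow> nat) \<Rightarrow> ('a \<Rightarrow> real) \<Rightarrow> 'a \<Rightarrow> real" where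
  "multi_deriv \<alpha> \<phi> = iter_deriv \<phi> (SOME is. count_list is = \<alpha>)"

definition test_fun :: "'a::euclidean_space set \<Rightarrow> ('a \<Rightarrow> real) \<Rightarrow> bool" where
  "test_fun \<Omega> \<phi> \<longleftrightarrow> smooth_on UNIV \<phi> \<and>
     compact (closure {x. \<phi> x \<noteq> 0}) \<and> closure {x. \<phi> x \<noteq> 0} \<subseteq> \<Omega>"

definition L2_weak_deriv ::
  "'a::euclidean_space set \<Rightarrow> ('a \<Rightarrow> nat) \<Rightarrow> ('a \<Rightarrow> real) \<Rightarrow> ('a \<Rightarrow> real) \<Rightarrow> bool" where
  "L2_weak_deriv \<Omega> \<alpha> u v \<longleftrightarrow> L2_on \<Omega> v \<and> (\<forall>\<phi>. test_fun \<Omega> \<phi> \<longrightarrow>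
     (LINT x:\<Omega>|lebesgue. u x * multi_deriv \<alpha> \<phi> x) =
       (- 1) ^ order_of \<alpha> * (LINT x:\<Omega>|lebesgue. v x * \<phi> x))"

text \<open>The weak derivative; it is determined up to a null set.\<close>

definition wderiv ::
  "'a::euclidean_space set \<Rightarrow> ('a \<Rightarrow> nat) \<Rightarrow> ('a \<Rightarrow> real) \<Rightarrow> 'a \<Rightarrow> real" where
  "wderiv \<Omega> \<alpha> u = (SOME v. L2_weak_deriv \<Omega> \<alpha> u v)"

definition slobodeckij_quot ::
  "real \<Rightarrow> ('a::euclidean_space \<Rightarrow> real) \<Rightarrow> 'a \<times> 'a \<Rightarrow> real" where
  "slobodeckij_quot \<sigma> v = (\<lambda>(x, y). (v x - v y)\<^sup>2 / norm (x - y) powr (real DIM('a) + 2 * \<sigma>))"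

text \<open>
  The space \<open>H\<^sup>s(\<Omega>)\<close> for real \<open>s \<ge> 0\<close>: the space of functions with weak derivatives up to
  order \<open>s\<close> in \<open>L\<^sup>2(\<Omega>)\<close> for integral \<open>s\<close>, and the Sobolev-Slobodeckij space otherwise.
\<close>

definition sobolev :: "real \<Rightarrow> 'a::euclidean_space set \<Rightarrow> ('a \<Rightarrow> real) \<Rightarrow> bool" where
  "sobolev s \<Omega> u \<longleftrightarrow> L2_on \<Omega> u \<and>
     (\<forall>\<alpha>. multi_index \<alpha> \<and> order_of \<alpha> \<le> nat \<lfloor>s\<rfloor> \<longrightarrow> (\<exists>v. L2_weak_deriv \<Omega> \<alpha> u v)) \<and>
     (frac s \<noteq> 0 \<longrightarrow> (\<forall>\<alpha>. multi_index \<alpha> \<and> order_of \<alpha> = nat \<lfloor>s\<rfloor> \<longrightarrow>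
        set_integrable lebesgue (\<Omega> \<times> \<Omega>) (slobodeckij_quot (frac s) (wderiv \<Omega> \<alpha> u))))"

definition sobolev_sqnorm :: "real \<Rightarrow> 'a::euclidean_space set \<Rightarrow> ('a \<Rightarrow> real) \<Rightarrow> real" where
  "sobolev_sqnorm s \<Omega> u =
     (\<Sum>\<alpha> | multi_index \<alpha> \<and> order_of \<alpha> \<le> nat \<lfloor>s\<rfloor>. LINT x:\<Omega>|lebesgue. (wderiv \<Omega> \<alpha> u x)\<^sup>2) +
     (if frac s = 0 then 0 else
       (\<Sum>\<alpha> | multi_index \<alpha> \<and> order_of \<alpha> = nat \<lfloor>s\<rfloor>.
          LINT z:\<Omega> \<times> \<Omega>|lebesgue. slobodeckij_quot (frac s) (wderiv \<Omega> \<alpha> u) z))"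

text \<open>
  \<open>H\<^sup>s(\<Omega>)\<^sup>N\<close> for \<open>s > \<lceil>d/2\<rceil> + 2\<close>. By the Sobolev embedding every class modulo null sets contains
  exactly one function on \<open>\<Omega>\<close> that is of class C^2 up to the boundary, and a class is
  represented by that function. This makes boundary values, gradients and Laplacians classical.
\<close>

definition Hs :: "real \<Rightarrow> 'a::euclidean_space set \<Rightarrow> ('a \<Rightarrow> real ^ 'N) set" where
  "Hs s \<Omega> = {U. \<forall>n. sobolev s \<Omega> (\<lambda>x. U x $ n) \<and> C2_closure \<Omega> (\<lambda>x. U x $ n)}"

definition Hs_norm :: "real \<Rightarrow> 'a::euclidean_space set \<Rightarrow> ('a \<Rightarrow> real ^ 'N) \<Rightarrow> real" where
  "Hs_norm s \<Omega> U = sqrt (\<Sum>n\<in>UNIV. sobolev_sqnorm s \<Omega> (\<lambda>x. U x $ n))"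

text \<open>\<open>{V \<in> H\<^sup>s(\<Omega>)\<^sup>N. V = \<phi> and \<partial>\<^sub>\<nu> V = \<gamma> on the boundary}\<close>\<close>

definition Hs_cauchy ::
  "real \<Rightarrow> 'a::euclidean_space set \<Rightarrow> ('a \<Rightarrow> 'a) \<Rightarrow> ('a \<Rightarrow> real ^ 'N) \<Rightarrow> ('a \<Rightarrow> real ^ 'N) \<Rightarrow>
    ('a \<Rightarrow> real ^ 'N) set" where
  "Hs_cauchy s \<Omega> \<nu> \<phi> \<gamma> = {V \<in> Hs s \<Omega>. \<forall>x\<in>frontier \<Omega>.
     bdry_value \<Omega> V x = \<phi> x \<and> vnormal_deriv \<Omega> \<nu> V x = \<gamma> x}"

subsection \<open>The time basis and the reduced system\<close>

text \<open>Derivative on \<open>[0,T]\<close>, one-sided at the end points.\<close>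

definition tderiv :: "real \<Rightarrow> (real \<Rightarrow> real) \<Rightarrow> real \<Rightarrow> real" where
  "tderiv T f t = vector_derivative f (at t within {0..T})"

definition C2_time :: "real \<Rightarrow> (real \<Rightarrow> real) \<Rightarrow> bool" where
  "C2_time T f \<longleftrightarrow> f differentiable_on {0..T} \<and> tderiv T f differentiable_on {0..T} \<and>
     continuous_on {0..T} (tderiv T (tderiv T f))"

definition L2_inner :: "real \<Rightarrow> (real \<Rightarrow> real) \<Rightarrow> (real \<Rightarrow> real) \<Rightarrow> real" where
  "L2_inner T f g = (LINT t:{0..T}|lebesgue. f t * g t)"

text \<open>The family is indexed by \<open>n \<ge> 1\<close>; the value at \<open>0\<close> is irrelevant.\<close>

definition orthonormal_basis_L2 :: "real \<Rightarrow> (nat \<Rightarrow> real \<Rightarrow> real) \<Rightarrow> bool" where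
  "orthonormal_basis_L2 T \<Psi> \<longleftrightarrow> (\<forall>n\<ge>1. L2_on {0..T} (\<Psi> n)) \<and>
     (\<forall>m\<ge>1. \<forall>n\<ge>1. L2_inner T (\<Psi> m) (\<Psi> n) = (if m = n then 1 else 0)) \<and>
     (\<forall>g. L2_on {0..T} g \<longrightarrow>
        (\<lambda>M. LINT t:{0..T}|lebesgue. (g t - (\<Sum>n=1..M. L2_inner T g (\<Psi> n) * \<Psi> n t))\<^sup>2)
          \<longlonglongrightarrow> 0)"

text \<open>
  In the following \<open>\<psi>\<close> is the family \<open>\<Psi>\<^sub>1, \<dots>, \<Psi>\<^sub>N\<close>, indexed by the finite type \<open>'N\<close>.
\<close>

definition time_coeffs ::
  "real \<Rightarrow> ('N::finite \<Rightarrow> real \<Rightarrow> real) \<Rightarrow> ('a \<Rightarrow> real \<Rightarrow> real) \<Rightarrow> 'a \<Rightarrow> real ^ 'N" where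
  "time_coeffs T \<psi> f x = (\<chi> n. LINT t:{0..T}|lebesgue. f x t * \<psi> n t)"

definition Smat :: "real \<Rightarrow> ('N::finite \<Rightarrow> real \<Rightarrow> real) \<Rightarrow> real ^ 'N ^ 'N" where
  "Smat T \<psi> = (\<chi> m n. LINT t:{0..T}|lebesgue. tderiv T (tderiv T (\<psi> n)) t * \<psi> m t)"

definition calF ::
  "real \<Rightarrow> ('N::finite \<Rightarrow> real \<Rightarrow> real) \<Rightarrow> ('a::euclidean_space \<times> real \<times> real \<times> 'a \<Rightarrow> real) \<Rightarrow>
    ('a \<Rightarrow> real) \<Rightarrow> 'a \<times> (real ^ 'N) \<times> ('a ^ 'N) \<Rightarrow> real ^ 'N" where
  "calF T \<psi> F p = (\<lambda>(x, u, P). \<chi> m. LINT t:{0..T}|lebesgue.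
     ((\<Sum>n\<in>UNIV. u $ n * tderiv T (tderiv T (\<psi> n)) 0) - laplacian p x) / F (x, p x, 0, grad p x) *
     F (x, \<Sum>n\<in>UNIV. u $ n * \<psi> n t, \<Sum>n\<in>UNIV. u $ n * tderiv T (\<psi> n) t,
        \<Sum>n\<in>UNIV. \<psi> n t *\<^sub>R P $ n) * \<psi> m t)"

text \<open>
  The C^1 norm on a set, with values in \<open>[0,\<infinity>]\<close>. It is applied to \<open>calF T \<psi> F p\<close>, which under
  the standing assumptions is differentiable on a neighbourhood of \<open>closure \<Omega> \<times> UNIV \<times> UNIV\<close>.
\<close>

definition C1_norm ::
  "'b::euclidean_space set \<Rightarrow> ('b \<Rightarrow> 'c::euclidean_space) \<Rightarrow> ennreal" where
  "C1_norm D G = (SUP z\<in>D. ennreal (norm (G z))) +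
     (SUP z\<in>D. ennreal (onorm (frechet_derivative G (at z))))"

definition reduced_solution ::
  "real \<Rightarrow> 'a::euclidean_space set \<Rightarrow> ('a \<Rightarrow> 'a) \<Rightarrow> real \<Rightarrow> ('N::finite \<Rightarrow> real \<Rightarrow> real) \<Rightarrow>
    ('a \<times> real \<times> real \<times> 'a \<Rightarrow> real) \<Rightarrow> ('a \<Rightarrow> real) \<Rightarrow>
    ('a \<Rightarrow> real ^ 'N) \<Rightarrow> ('a \<Rightarrow> real ^ 'N) \<Rightarrow> ('a \<Rightarrow> real ^ 'N) \<Rightarrow> bool" where
  "reduced_solution s \<Omega> \<nu> T \<psi> F p \<phi> \<gamma> U \<longleftrightarrow> U \<in> Hs_cauchy s \<Omega> \<nu> \<phi> \<gamma> \<and>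
     (\<forall>x\<in>\<Omega>. vlaplacian U x - Smat T \<psi> *v U x + calF T \<psi> F p (x, U x, vgrad U x) = 0)"

subsection \<open>Carleman weight, Carleman estimate, Carleman contraction map\<close>

definition carleman_weight :: "'a::euclidean_space \<Rightarrow> real \<Rightarrow> real \<Rightarrow> real \<Rightarrow> 'a \<Rightarrow> real" where
  "carleman_weight x0 b lam \<beta> x = exp (2 * lam * (norm (x - x0) / b) powr \<beta>)"

definition wint ::
  "'a::euclidean_space set \<Rightarrow> 'a \<Rightarrow> real \<Rightarrow> real \<Rightarrow> real \<Rightarrow> ('a \<Rightarrow> real) \<Rightarrow> real" where
  "wint \<Omega> x0 b lam \<beta> q = (LINT x:\<Omega>|lebesgue. carleman_weight x0 b lam \<beta> x * q x)"

definition carleman_constants ::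
  "'a::euclidean_space set \<Rightarrow> ('a \<Rightarrow> 'a) \<Rightarrow> 'a \<Rightarrow> real \<Rightarrow>
    real \<Rightarrow> (real \<Rightarrow> real) \<Rightarrow> (real \<Rightarrow> real) \<Rightarrow> bool" where
  "carleman_constants \<Omega> \<nu> x0 b \<beta>0 lam0 C1 \<longleftrightarrow> \<beta>0 > 0 \<and>
     (\<forall>\<beta>\<ge>\<beta>0. lam0 \<beta> > 1 \<and> C1 \<beta> > 1 \<and>
       (\<forall>lam\<ge>lam0 \<beta>. \<forall>h. C2_closure \<Omega> h \<and>
          (\<forall>x\<in>frontier \<Omega>. bdry_value \<Omega> h x = 0 \<and> normal_deriv \<Omega> \<nu> h x = 0) \<longrightarrow>
          wint \<Omega> x0 b lam \<beta> (\<lambda>x. (laplacian h x)\<^sup>2) \<ge>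
            C1 \<beta> * lam * wint \<Omega> x0 b lam \<beta> (\<lambda>x. (norm (grad h x))\<^sup>2) +
            C1 \<beta> * lam ^ 3 * wint \<Omega> x0 b lam \<beta> (\<lambda>x. (h x)\<^sup>2)))"

definition carleman_functional ::
  "real \<Rightarrow> 'a::euclidean_space set \<Rightarrow> real \<Rightarrow> ('N::finite \<Rightarrow> real \<Rightarrow> real) \<Rightarrow>
    ('a \<times> real \<times> real \<times> 'a \<Rightarrow> real) \<Rightarrow> ('a \<Rightarrow> real) \<Rightarrow>
    'a \<Rightarrow> real \<Rightarrow> real \<Rightarrow> real \<Rightarrow> real \<Rightarrow> ('a \<Rightarrow> real ^ 'N) \<Rightarrow> ('a \<Rightarrow> real ^ 'N) \<Rightarrow> real" where
  "carleman_functional s \<Omega> T \<psi> F p x0 b \<epsilon> lam \<beta> V \<phi> =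
     wint \<Omega> x0 b lam \<beta> (\<lambda>x. (norm (vlaplacian \<phi> x - Smat T \<psi> *v \<phi> x
        + calF T \<psi> F p (x, V x, vgrad V x)))\<^sup>2) + \<epsilon> * (Hs_norm s \<Omega> \<phi>)\<^sup>2"

text \<open>
  The map \<open>V \<mapsto> argmin\<close> as a set-valued map: its value is the set of minimizers over \<open>H\<close>.
  Since the minimizer is unique as an element of \<open>H\<^sup>s(\<Omega>)\<^sup>N\<close>, the members of this set differ only
  in their irrelevant values outside \<open>\<Omega>\<close>.
\<close>

definition carleman_map ::
  "real \<Rightarrow> 'a::euclidean_space set \<Rightarrow> real \<Rightarrow> ('N::finite \<Rightarrow> real \<Rightarrow> real) \<Rightarrow>
    ('a \<times> real \<times> real \<times> 'a \<Rightarrow> real) \<Rightarrow> ('a \<Rightarrow> real) \<Rightarrow>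
    'a \<Rightarrow> real \<Rightarrow> real \<Rightarrow> real \<Rightarrow> real \<Rightarrow> ('a \<Rightarrow> real ^ 'N) set \<Rightarrow>
    ('a \<Rightarrow> real ^ 'N) \<Rightarrow> ('a \<Rightarrow> real ^ 'N) set" where
  "carleman_map s \<Omega> T \<psi> F p x0 b \<epsilon> lam \<beta> H V =
     {\<phi>. is_arg_min (carleman_functional s \<Omega> T \<psi> F p x0 b \<epsilon> lam \<beta> V) (\<lambda>\<phi>. \<phi> \<in> H) \<phi>}"

text \<open>The weighted integrals in the estimates: of \<open>|W|\<^sup>2 + |\<nabla>W|\<^sup>2\<close>, and with \<open>|\<Delta>W|\<^sup>2\<close> added.\<close>

definition wH1 ::
  "'a::euclidean_space set \<Rightarrow> 'a \<Rightarrow> real \<Rightarrow> real \<Rightarrow> real \<Rightarrow> ('a \<Rightarrow> real ^ 'N) \<Rightarrow> real" where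
  "wH1 \<Omega> x0 b lam \<beta> W = wint \<Omega> x0 b lam \<beta> (\<lambda>x. (norm (W x))\<^sup>2 + (norm (vgrad W x))\<^sup>2)"

definition wH2 ::
  "'a::euclidean_space set \<Rightarrow> 'a \<Rightarrow> real \<Rightarrow> real \<Rightarrow> real \<Rightarrow> ('a \<Rightarrow> real ^ 'N) \<Rightarrow> real" where
  "wH2 \<Omega> x0 b lam \<beta> W = wint \<Omega> x0 b lam \<beta>
     (\<lambda>x. (norm (W x))\<^sup>2 + (norm (vgrad W x))\<^sup>2 + (norm (vlaplacian W x))\<^sup>2)"

end

theory Submission
  imports Defs
begin

text \<open>
  Put \<open>w = U\<^sup>* + e\<close>, which lies in \<open>H\<close>, and \<open>h = U\<^sub>k - w\<close>, which has zero Cauchy data. Comparing the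
  minimizer \<open>U\<^sub>k\<close> with \<open>w\<close> and dropping \<open>\<epsilon> \<parallel>U\<^sub>k\<parallel>\<^sup>2\<close> bounds the weighted norm of
  \<open>L h = \<Delta> h - S h\<close> by that of \<open>L w + \<F>(U\<^sub>k\<^sub>-\<^sub>1) = L e + \<F>(U\<^sub>k\<^sub>-\<^sub>1) - \<F>(U\<^sup>*)\<close> and \<open>\<epsilon> \<parallel>w\<parallel>\<^sup>2\<close>;
  no Euler-Lagrange equation is needed. The difference of the nonlinear terms is controlled by the
  Lipschitz constant \<open>\<parallel>\<F>\<parallel>\<close> in \<open>C\<^sup>1\<close>, and the Carleman estimate turns the bound on \<open>L h\<close> into one on
  \<open>h\<close> and its gradient with the factor \<open>1 / \<lambda>\<close>.

  Since the Sobolev norm is defined by a chosen weak derivative, even the parallelogram bound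
  \<open>\<parallel>U\<^sup>* + e\<parallel>\<^sup>2 \<le> 2 \<parallel>U\<^sup>*\<parallel>\<^sup>2 + 2 \<parallel>e\<parallel>\<^sup>2\<close> needs uniqueness of weak derivatives, that is, the fundamental
  lemma of the calculus of variations.
\<close>

subsection \<open>Calculus of iterated derivatives\<close>

text \<open>The difference \<open>U k - U'\<close> has the Cauchy data of \<open>e\<close>, so the
  Carleman estimate does not apply to it directly. Returning from h through
  \<open>U k - U' = h + e\<close> costs a factor 2 on each squared part. This is the 2 in 2 + C /
  \<lambda>: the only contribution that bypasses the Carleman estimate and so carries no 1 /
  \<lambda>. Two quantifier orders shape the constant. \<open>C\<close> is fixed before F, p, s, the
  data, \<epsilon> and \<lambda>, so it may use only S, the C^1 norm and the Carleman data. It must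
  also serve every \<lambda> above \<open>lam0 \<beta>0\<close>, while S h can be absorbed only for
  large \<lambda>; the gap is a bounded range of \<lambda>, closed by comparing weights. A Bochner
  integral of a non-integrable function is 0, so splitting or comparing integrals must be backed by
  integrability. For the weighted integrals it comes from continuity and boundedness of the
  integrands on \<Omega>.\<close>

lemma iter_deriv_append: "iter_deriv f (is @ js) = iter_deriv (iter_deriv f js) is"
  by (induction "is") auto

text \<open>\<open>frechet_derivative\<close> is a choice among all derivatives. Functions that
  agree near x have the same derivatives there, so the choices coincide even where neither function
  is differentiable.\<close>

lemma frechet_derivative_cong_open:
  assumes "open W" "x \<in> W" "\<And>y. y \<in> W \<Longrightarrow> f y = g y"
  shows "frechet_derivative f (at x) = frechet_derivative g (at x)"
proof -
  have "(f has_derivative D) (at x) \<longleftrightarrow> (g has_derivative D) (at x)" for D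
    using has_derivative_transform_within_open[OF _ assms(1,2), of f D UNIV g]
      has_derivative_transform_within_open[OF _ assms(1,2), of g D UNIV f] assms(3) by auto
  then show ?thesis by (simp add: frechet_derivative_def)
qed

lemma differentiable_on_cong:
  fixes f g :: "'a::real_normed_vector \<Rightarrow> 'b::real_normed_vector"
  assumes "\<And>x. x \<in> W \<Longrightarrow> f x = g x"
  shows "f differentiable_on W \<longleftrightarrow> g differentiable_on W"
proof -
  have "g differentiable_on W" if "f differentiable_on W" "\<And>x. x \<in> W \<Longrightarrow> g x = f x" for f g :: "'a \<Rightarrow> 'b"
    using that unfolding differentiable_on_def differentiable_def
    by (blast intro: has_derivative_transform)
  then show ?thesis using assms by auto
qed

lemma differentiable_on_openD:
  "f differentiable_on W \<Longrightarrow> open W \<Longrightarrow> x \<in> W \<Longrightarrow> f differentiable (at x)"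
  by (simp add: differentiable_on_eq_differentiable_at)

lemma iter_deriv_cong_open:
  assumes "open W" "\<And>y. y \<in> W \<Longrightarrow> f y = g y" "x \<in> W"
  shows "iter_deriv f is x = iter_deriv g is x"
  using assms(3)
proof (induction "is" arbitrary: x)
  case (Cons i js)
  then show ?case
    using frechet_derivative_cong_open[OF assms(1), of x "iter_deriv f js" "iter_deriv g js"] by simp
qed (use assms in auto)

lemma Ck_on_cong_open:
  assumes "open W" "\<And>y. y \<in> W \<Longrightarrow> f y = g y"
  shows "Ck_on k W f \<longleftrightarrow> Ck_on k W g"
proof -
  have eq: "iter_deriv f is x = iter_deriv g is x" if "x \<in> W" for x "is"
    by (rule iter_deriv_cong_open[OF assms that])
  have "iter_deriv f is differentiable_on W \<longleftrightarrow> iter_deriv g is differentiable_on W"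
    "continuous_on W (iter_deriv f is) \<longleftrightarrow> continuous_on W (iter_deriv g is)" for "is"
    by (rule differentiable_on_cong continuous_on_cong; simp add: eq)+
  then show ?thesis by (simp add: Ck_on_def)
qed

lemma Ck_on_0 [simp]: "Ck_on 0 W f \<longleftrightarrow> continuous_on W f"
  by (auto simp: Ck_on_def)

text \<open>In \<open>iter_deriv\<close> the last list entry is differentiated first. Splitting off
  that entry gives a recursion in k, on which the inductions for constants, products and
  \<open>flat_exp\<close> run.\<close>

lemma Ck_on_Suc:
  "Ck_on (Suc k) W f \<longleftrightarrow>
     f differentiable_on W \<and> (\<forall>i\<in>Basis. Ck_on k W (\<lambda>x. frechet_derivative f (at x) i))"
  (is "?L \<longleftrightarrow> ?R")
proof
  assume L: ?L
  have "Ck_on k W (iter_deriv f [i])" if "i \<in> Basis" for i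
    unfolding Ck_on_def
  proof (intro allI impI)
    fix js :: "'a list" assume js: "set js \<subseteq> Basis"
    then show "(length js < k \<longrightarrow> iter_deriv (iter_deriv f [i]) js differentiable_on W) \<and>
       (length js \<le> k \<longrightarrow> continuous_on W (iter_deriv (iter_deriv f [i]) js))"
      using L[unfolded Ck_on_def, rule_format, of "js @ [i]"] that
      by (simp add: iter_deriv_append)
  qed
  moreover have "f differentiable_on W"
    using L[unfolded Ck_on_def, rule_format, of "[]"] by simp
  ultimately show ?R by simp
next
  assume R: ?R
  show ?L
    unfolding Ck_on_def
  proof (intro allI impI)
    fix js :: "'a list" assume js: "set js \<subseteq> Basis"
    show "(length js < Suc k \<longrightarrow> iter_deriv f js differentiable_on W) \<and>
       (length js \<le> Suc k \<longrightarrow> continuous_on W (iter_deriv f js))"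
    proof (cases js rule: rev_cases)
      case Nil
      then show ?thesis using R differentiable_imp_continuous_on by auto
    next
      case (snoc ks i)
      then have "Ck_on k W (iter_deriv f [i])" using R js by simp
      from this[unfolded Ck_on_def, rule_format, of ks] show ?thesis
        using snoc js by (simp add: iter_deriv_append)
    qed
  qed
qed

lemma Ck_on_mono: "Ck_on k W f \<Longrightarrow> j \<le> k \<Longrightarrow> Ck_on j W f"
  unfolding Ck_on_def by force

text \<open>One free scalar serves sums (c = 1) and differences (c = -1). The induction hypothesis
  is an identity on W only; since W is open, it still determines the next derivative at points of
  W.\<close>

lemma iter_deriv_lincomb:
  assumes W: "open W" and f: "Ck_on k W f" and g: "Ck_on k W g"
    and "set is \<subseteq> Basis" "length is \<le> k" "x \<in> W"
  shows "iter_deriv (\<lambda>y. f y + c * g y) is x = iter_deriv f is x + c * iter_deriv g is x"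
  using assms(4-6)
proof (induction "is" arbitrary: x)
  case (Cons i js)
  then have js: "set js \<subseteq> Basis" "length js < k" by auto
  have d: "iter_deriv f js differentiable (at x)" "iter_deriv g js differentiable (at x)"
    using f g js W Cons.prems by (auto simp: Ck_on_def intro: differentiable_on_openD)
  have "((\<lambda>y. iter_deriv f js y + c * iter_deriv g js y) has_derivative
     (\<lambda>h. frechet_derivative (iter_deriv f js) (at x) h + c * frechet_derivative (iter_deriv g js) (at x) h)) (at x)"
    using d by (intro derivative_intros) (auto simp: frechet_derivative_works)
  moreover have "frechet_derivative (iter_deriv (\<lambda>y. f y + c * g y) js) (at x) =
      frechet_derivative (\<lambda>y. iter_deriv f js y + c * iter_deriv g js y) (at x)"
    using Cons js by (intro frechet_derivative_cong_open[OF W]) auto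
  ultimately show ?case
    using frechet_derivative_at[symmetric] by fastforce
qed auto

lemma Ck_on_lincomb:
  assumes W: "open W" and f: "Ck_on k W f" and g: "Ck_on k W g"
  shows "Ck_on k W (\<lambda>y. f y + c * g y)"
  unfolding Ck_on_def
proof (intro allI impI)
  fix js :: "'a list" assume js: "set js \<subseteq> Basis"
  have eq: "iter_deriv (\<lambda>y. f y + c * g y) js x = iter_deriv f js x + c * iter_deriv g js x"
    if "length js \<le> k" "x \<in> W" for x
    using iter_deriv_lincomb[OF W f g js that] .
  show "(length js < k \<longrightarrow> iter_deriv (\<lambda>y. f y + c * g y) js differentiable_on W) \<and>
    (length js \<le> k \<longrightarrow> continuous_on W (iter_deriv (\<lambda>y. f y + c * g y) js))"
  proof (intro conjI impI)
    assume l: "length js < k"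
    have "(\<lambda>x. iter_deriv f js x + c * iter_deriv g js x) differentiable_on W"
      using f g js l by (auto simp: Ck_on_def intro!: differentiable_on_add differentiable_on_mult)
    then show "iter_deriv (\<lambda>y. f y + c * g y) js differentiable_on W"
      using l by (subst differentiable_on_cong[OF eq]) auto
  next
    assume l: "length js \<le> k"
    have "continuous_on W (\<lambda>x. iter_deriv f js x + c * iter_deriv g js x)"
      using f g js l by (auto simp: Ck_on_def intro!: continuous_intros)
    then show "continuous_on W (iter_deriv (\<lambda>y. f y + c * g y) js)"
      using l by (subst continuous_on_cong[OF refl eq]) auto
  qed
qed

lemma Ck_on_const: "Ck_on k W (\<lambda>x. c)"
proof (induction k arbitrary: c)
  case (Suc k)
  then show ?case by (simp add: Ck_on_Suc)
qed simp

lemma Ck_on_mult: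
  assumes W: "open W"
  shows "Ck_on k W f \<Longrightarrow> Ck_on k W g \<Longrightarrow> Ck_on k W (\<lambda>x. f x * g x)"
proof (induction k arbitrary: f g)
  case 0
  then show ?case by (auto intro: continuous_intros)
next
  case (Suc k)
  then have d: "f differentiable_on W" "g differentiable_on W"
    and D: "\<And>i. i \<in> Basis \<Longrightarrow> Ck_on k W (\<lambda>x. frechet_derivative f (at x) i)"
      "\<And>i. i \<in> Basis \<Longrightarrow> Ck_on k W (\<lambda>x. frechet_derivative g (at x) i)"
    by (auto simp: Ck_on_Suc)
  have fg: "Ck_on k W f" "Ck_on k W g" using Suc.prems Ck_on_mono le_Suc_eq by blast+
  \<comment> \<open>The factor 1 puts the product rule into the form f + c * g of
    \<open>Ck_on_lincomb\<close>. Both products have only C^k factors, so the induction hypothesis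
    covers them.\<close>
  have eq: "frechet_derivative (\<lambda>x. f x * g x) (at x) i =
      f x * frechet_derivative g (at x) i + 1 * (frechet_derivative f (at x) i * g x)" if "x \<in> W" for x i
  proof -
    have "((\<lambda>x. f x * g x) has_derivative
       (\<lambda>h. f x * frechet_derivative g (at x) h + frechet_derivative f (at x) h * g x)) (at x)"
      using d W that
      by (intro has_derivative_mult) (auto intro: differentiable_on_openD simp: frechet_derivative_works[symmetric])
    from frechet_derivative_at[OF this, symmetric] show ?thesis by simp
  qed
  have "Ck_on k W (\<lambda>x. frechet_derivative (\<lambda>x. f x * g x) (at x) i)" if "i \<in> Basis" for i
    by (subst Ck_on_cong_open[OF W eq], assumption)
      (intro Ck_on_lincomb[OF W] Suc.IH fg D that)
  then show ?case
    using d by (auto simp: Ck_on_Suc intro: differentiable_on_mult)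
qed

lemma Ck_on_prod:
  assumes "open W" "\<And>i. i \<in> I \<Longrightarrow> Ck_on k W (f i)"
  shows "Ck_on k W (\<lambda>x. \<Prod>i\<in>I. f i x)"
  using assms(2)
proof (induction I rule: infinite_finite_induct)
  case (insert i I)
  then show ?case by (auto intro!: Ck_on_mult[OF assms(1)])
qed (auto simp: Ck_on_const)

subsection \<open>Test functions supported in boxes\<close>

text \<open>The derivative of \<open>exp (- 1 / y) / y ^ k\<close> is a combination of the same functions with larger \<open>k\<close>,
  so smoothness of the whole family follows by one induction.\<close>

definition flat_exp :: "nat \<Rightarrow> real \<Rightarrow> real" where
  "flat_exp k y = (if y > 0 then exp (- (1 / y)) / y ^ k else 0)"

text \<open>From the right, z = 1 / y turns the claim into the decay of z^k / exp z at infinity;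
  from the left the function is 0.\<close>

lemma flat_exp_tendsto_0: "(flat_exp k \<longlongrightarrow> 0) (at 0)"
proof -
  have "((\<lambda>y. inverse y ^ k / exp (inverse y)) \<longlongrightarrow> (0::real)) (at_right 0)"
    by (rule filterlim_compose[OF tendsto_power_div_exp_0 filterlim_inverse_at_top_right])
  then have "(flat_exp k \<longlongrightarrow> 0) (at_right 0)"
    by (rule Lim_transform_eventually)
      (auto simp: eventually_at_right_field flat_exp_def exp_minus field_simps intro!: exI[of _ 1])
  moreover have "(flat_exp k \<longlongrightarrow> 0) (at_left 0)"
    by (rule Lim_transform_eventually[OF tendsto_const])
      (auto simp: eventually_at_left_field flat_exp_def intro!: exI[of _ "-1"])
  ultimately show ?thesis by (simp add: filterlim_at_split)
qed

lemma flat_exp_deriv: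
  "(flat_exp k has_real_derivative flat_exp (k + 2) y - real k * flat_exp (k + 1) y) (at y)"
proof -
  consider "y < 0" | "y = 0" | "y > 0" by linarith
  then show ?thesis
  proof cases
    case 1
    have "((\<lambda>_. 0) has_real_derivative 0) (at y)" by simp
    then have "(flat_exp k has_real_derivative 0) (at y)"
      by (rule has_field_derivative_transform_within_open[where S="{..<0}"])
        (use 1 in \<open>auto simp: flat_exp_def\<close>)
    then show ?thesis using 1 by (simp add: flat_exp_def)
  next
    case 2
    \<comment> \<open>Away from 0 the difference quotient at 0 is \<open>flat_exp (Suc k)\<close>,
      so the limit is already known one exponent higher.\<close>
    have "((\<lambda>h. flat_exp k h / h) \<longlongrightarrow> 0) (at 0)"
      by (rule Lim_transform_eventually[OF flat_exp_tendsto_0[of "Suc k"]])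
        (auto simp: flat_exp_def eventually_at_filter)
    then show ?thesis using 2 by (simp add: DERIV_def flat_exp_def)
  next
    case 3
    have "((\<lambda>y. exp (- (1 / y)) / y ^ k) has_real_derivative
        (exp (- (1 / y)) * (1 / y\<^sup>2) * y ^ k - exp (- (1 / y)) * (real k * y ^ (k - 1))) / (y ^ k * y ^ k)) (at y)"
      using 3 by (auto intro!: derivative_eq_intros simp: power2_eq_square)
    also have "(exp (- (1 / y)) * (1 / y\<^sup>2) * y ^ k - exp (- (1 / y)) * (real k * y ^ (k - 1))) / (y ^ k * y ^ k)
        = flat_exp (k + 2) y - real k * flat_exp (k + 1) y"
      using 3 by (cases k) (auto simp: flat_exp_def field_simps power2_eq_square)
    finally show ?thesis
      by (rule has_field_derivative_transform_within_open[where S="{0<..}"])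
        (use 3 in \<open>auto simp: flat_exp_def\<close>)
  qed
qed

text \<open>A directional derivative multiplies by v \<bullet> i and stays in the span of the family
  with the same affine argument, so the induction on m runs for all k at once. Affine arguments
  cover the scaled signed distances to the faces of a box.\<close>

lemma Ck_on_flat_exp:
  fixes v :: "'a::euclidean_space"
  shows "Ck_on m UNIV (\<lambda>x. flat_exp k (v \<bullet> x + c))"
proof (induction m arbitrary: k)
  case 0
  have "continuous_on UNIV (flat_exp k)"
    by (rule DERIV_continuous_on[OF flat_exp_deriv])
  then have "continuous_on UNIV (flat_exp k \<circ> (\<lambda>x. v \<bullet> x + c))"
    by (intro continuous_on_compose) (auto intro!: continuous_intros elim: continuous_on_subset)
  then show ?case by (simp add: o_def)
next
  case (Suc m)
  have D: "((\<lambda>x. flat_exp k (v \<bullet> x + c)) has_derivative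
      (\<lambda>h. (v \<bullet> h) * (flat_exp (k + 2) (v \<bullet> x + c) - real k * flat_exp (k + 1) (v \<bullet> x + c)))) (at x)" for x
  proof -
    have "((\<lambda>x. v \<bullet> x + c) has_derivative (\<lambda>h. v \<bullet> h)) (at x)"
      by (auto intro!: derivative_eq_intros)
    from DERIV_compose_FDERIV[OF flat_exp_deriv this] show ?thesis .
  qed
  have eq: "frechet_derivative (\<lambda>x. flat_exp k (v \<bullet> x + c)) (at x) i =
     (v \<bullet> i) * (flat_exp (k + 2) (v \<bullet> x + c) + (- real k) * flat_exp (k + 1) (v \<bullet> x + c))" for x i
    using frechet_derivative_at[OF D, symmetric] by simp
  have "(\<lambda>x. flat_exp k (v \<bullet> x + c)) differentiable_on UNIV"
    using D by (auto simp: differentiable_on_def differentiable_def)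
  then show ?case
    unfolding Ck_on_Suc eq
    by (intro conjI ballI Ck_on_mult[OF _ Ck_on_const Ck_on_lincomb[OF _ Suc.IH Suc.IH]] open_UNIV)
qed

text \<open>The factor \<open>n + 1\<close> amounts to taking the \<open>(n + 1)\<close>-th root of each factor, so these functions
  converge to the indicator of the open box while their support stays the same.\<close>

definition box_bump :: "'a::euclidean_space \<Rightarrow> 'a \<Rightarrow> nat \<Rightarrow> 'a \<Rightarrow> real" where
  "box_bump a b n x = (\<Prod>i\<in>Basis. flat_exp 0 (real (Suc n) * (x \<bullet> i - a \<bullet> i)) *
     flat_exp 0 (real (Suc n) * (b \<bullet> i - x \<bullet> i)))"

lemma smooth_box_bump: "smooth_on UNIV (box_bump a b n)"
proof -
  have 1: "(\<lambda>x::'a. flat_exp 0 (real (Suc n) * (x \<bullet> i - a \<bullet> i))) =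
      (\<lambda>x. flat_exp 0 ((real (Suc n) *\<^sub>R i) \<bullet> x + (- real (Suc n) * (a \<bullet> i))))" for i
    by (simp add: algebra_simps inner_commute)
  have 2: "(\<lambda>x::'a. flat_exp 0 (real (Suc n) * (b \<bullet> i - x \<bullet> i))) =
      (\<lambda>x. flat_exp 0 ((- real (Suc n) *\<^sub>R i) \<bullet> x + (real (Suc n) * (b \<bullet> i))))" for i
    by (simp add: algebra_simps inner_commute)
  show ?thesis
    unfolding smooth_on_def box_bump_def[abs_def]
    by (intro allI Ck_on_prod Ck_on_mult open_UNIV; simp only: 1 2 Ck_on_flat_exp)
qed

lemma flat_exp_pos_iff: "flat_exp 0 y \<noteq> 0 \<longleftrightarrow> y > 0"
  by (simp add: flat_exp_def)

lemma flat_exp_bounds: "0 \<le> flat_exp 0 y" "flat_exp 0 y \<le> 1"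
  by (simp_all add: flat_exp_def)

lemma box_bump_support: "{x. box_bump a b n x \<noteq> 0} = box a b"
  by (auto simp: box_bump_def flat_exp_pos_iff zero_less_mult_iff mem_box)

lemma box_bump_bounds: "0 \<le> box_bump a b n x" "box_bump a b n x \<le> 1"
  unfolding box_bump_def by (auto intro!: prod_nonneg prod_le_1 mult_le_one simp: flat_exp_bounds)

lemma test_fun_box_bump:
  assumes "cbox a b \<subseteq> \<Omega>"
  shows "test_fun \<Omega> (box_bump a b n)"
proof -
  have "closure (box a b) \<subseteq> cbox a b"
    by (rule closure_minimal[OF box_subset_cbox closed_cbox])
  then show ?thesis
    unfolding test_fun_def box_bump_support
    using assms smooth_box_bump bounded_box compact_closure by blast
qed

lemma flat_exp_0_tendsto:
  "(\<lambda>n. flat_exp 0 (real (Suc n) * y)) \<longlonglongrightarrow> (if y > 0 then 1 else 0)"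
proof (cases "y > 0")
  case True
  have "(\<lambda>n. exp (- ((1 / y) * inverse (real (Suc n))))) \<longlonglongrightarrow> exp (- ((1 / y) * 0))"
    by (intro tendsto_intros LIMSEQ_inverse_real_of_nat)
  moreover have "flat_exp 0 (real (Suc n) * y) = exp (- ((1 / y) * inverse (real (Suc n))))" for n
    using True by (simp add: flat_exp_def divide_simps mult.commute)
  ultimately show ?thesis using True by simp
next
  case False
  then have "flat_exp 0 (real (Suc n) * y) = 0" for n
    by (auto simp: flat_exp_def zero_less_mult_iff)
  then show ?thesis using False by simp
qed

lemma box_bump_tendsto: "(\<lambda>n. box_bump a b n x) \<longlonglongrightarrow> indicator (box a b) x"
proof -
  have "(\<lambda>n. box_bump a b n x) \<longlonglongrightarrow>
     (\<Prod>i\<in>Basis. (if x \<bullet> i - a \<bullet> i > 0 then 1 else 0) * (if b \<bullet> i - x \<bullet> i > 0 then 1 else 0))"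
    unfolding box_bump_def by (intro tendsto_prod tendsto_mult flat_exp_0_tendsto)
  also have "(\<Prod>i\<in>Basis. (if x \<bullet> i - a \<bullet> i > 0 then 1 else 0) * (if b \<bullet> i - x \<bullet> i > 0 then 1 else 0)) =
      (indicator (box a b) x :: real)"
    by (auto simp: indicator_def mem_box intro: prod.neutral)
  finally show ?thesis .
qed

subsection \<open>The fundamental lemma of the calculus of variations\<close>

text \<open>Bridges two kinds of boxes: an open set is a countable union of closed boxes, while the
  bump functions detect only open ones. The boundary of a box is a null set.\<close>

lemma AE_cbox_imp_box: "AE x in lebesgue. x \<in> cbox a b \<longrightarrow> x \<in> box a b"
proof -
  have "cbox a b - box a b \<in> null_sets lebesgue"
    using negligible_frontier_interval negligible_iff_null_sets by blast
  from AE_not_in[OF this] show ?thesis by eventually_elim auto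
qed

lemma set_integral_empty: "set_lebesgue_integral M {} f = 0"
proof -
  have "(\<lambda>x. indicator {} x *\<^sub>R f x) = (\<lambda>x. 0)" by simp
  then show ?thesis unfolding set_lebesgue_integral_def by (simp only: integral_zero)
qed

text \<open>The bumps are admissible test functions, stay between 0 and 1 and tend pointwise to the
  indicator of the open box. Dominated convergence with majorant |v| on \<Omega> carries the
  vanishing over to the box.\<close>

lemma set_integral_box_eq_0:
  fixes v :: "'a::euclidean_space \<Rightarrow> real"
  assumes int: "set_integrable lebesgue \<Omega> v"
    and test: "\<And>\<phi>. test_fun \<Omega> \<phi> \<Longrightarrow> (LINT x:\<Omega>|lebesgue. v x * \<phi> x) = 0"
    and sub: "cbox a b \<subseteq> \<Omega>"
  shows "(LINT x:box a b|lebesgue. v x) = 0"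
proof -
  have meas: "box_bump a b n \<in> borel_measurable lebesgue" for n
  proof -
    have "continuous_on UNIV (box_bump a b n)"
      using smooth_box_bump[of a b n] unfolding smooth_on_def by (metis Ck_on_0)
    then show ?thesis by (simp add: borel_measurable_continuous_onI measurable_completion)
  qed
  have "(\<lambda>n. LINT x|lebesgue. (indicator \<Omega> x *\<^sub>R v x) * box_bump a b n x) \<longlonglongrightarrow>
      (LINT x|lebesgue. (indicator \<Omega> x *\<^sub>R v x) * indicator (box a b) x)"
  proof (rule integral_dominated_convergence[where w = "\<lambda>x. norm (indicator \<Omega> x *\<^sub>R v x)"])
    show "AE x in lebesgue. (\<lambda>n. (indicator \<Omega> x *\<^sub>R v x) * box_bump a b n x)
        \<longlonglongrightarrow> (indicator \<Omega> x *\<^sub>R v x) * indicator (box a b) x"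
      by (intro always_eventually allI tendsto_mult tendsto_const box_bump_tendsto)
    show "AE x in lebesgue. norm ((indicator \<Omega> x *\<^sub>R v x) * box_bump a b n x)
        \<le> norm (indicator \<Omega> x *\<^sub>R v x)" for n
      by (intro always_eventually allI)
        (auto simp: abs_mult box_bump_bounds intro!: mult_left_le)
    have m: "(\<lambda>x. indicator \<Omega> x *\<^sub>R v x) \<in> borel_measurable lebesgue"
      using int by (auto simp only: set_integrable_def borel_measurable_integrable)
    show "(\<lambda>x. (indicator \<Omega> x *\<^sub>R v x) * box_bump a b n x) \<in> borel_measurable lebesgue" for n
      by (rule borel_measurable_times[OF m meas])
    show "(\<lambda>x. (indicator \<Omega> x *\<^sub>R v x) * indicator (box a b) x) \<in> borel_measurable lebesgue"
      by (intro borel_measurable_times[OF m] borel_measurable_indicator) simp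
    show "integrable lebesgue (\<lambda>x. norm (indicator \<Omega> x *\<^sub>R v x))"
      using int by (intro integrable_norm) (simp only: set_integrable_def)
  qed
  moreover have "(LINT x|lebesgue. (indicator \<Omega> x *\<^sub>R v x) * box_bump a b n x) = 0" for n
    using test[OF test_fun_box_bump[OF sub, of n]] by (simp add: set_lebesgue_integral_def mult.assoc)
  ultimately have "(LINT x|lebesgue. (indicator \<Omega> x *\<^sub>R v x) * indicator (box a b) x) = 0"
    by (simp add: LIMSEQ_const_iff)
  moreover have "(\<lambda>x. (indicator \<Omega> x *\<^sub>R v x) * indicator (box a b) x) = (\<lambda>x. indicator (box a b) x *\<^sub>R v x)"
    using sub box_subset_cbox[of a b] by (intro ext) (auto simp: indicator_def)
  ultimately show ?thesis by (simp only: set_lebesgue_integral_def)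
qed

text \<open>A Dynkin class argument: the sets with vanishing integral are closed under complements
  and disjoint countable unions, and they contain the open boxes, an intersection-stable generator
  of the Borel sets. The complement step needs the vanishing total integral.\<close>

lemma AE_zero_if_box_integrals_zero:
  fixes g :: "'a::euclidean_space \<Rightarrow> real"
  assumes int: "integrable lebesgue g"
    and total: "(LINT x|lebesgue. g x) = 0"
    and box: "\<And>c d. (LINT x:box c d|lebesgue. g x) = 0"
  shows "AE x in lebesgue. g x = 0"
proof (rule sigma_finite_measure.density_zero[OF _ int])
  show "sigma_finite_measure (lebesgue :: 'a measure)"
  proof (intro sigma_finite_measure.intro exI[of _ "range (\<lambda>n. ball 0 (real n))"] conjI)
    show "\<Union> (range (\<lambda>n. ball 0 (real n))) = space (lebesgue :: 'a measure)"
      using real_arch_simple by (fastforce simp: reals_Archimedean2)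
    show "\<forall>a\<in>range (\<lambda>n. ball 0 (real n)). emeasure (lebesgue :: 'a measure) a \<noteq> \<infinity>"
      using emeasure_lborel_ball_finite[of "0::'a"] by (auto simp: less_top)
  qed auto
  have si: "set_integrable lebesgue A g" if "A \<in> sets lebesgue" for A
    using int that integrable_mult_indicator unfolding set_integrable_def by blast
  have borel_eq: "sets (borel :: 'a measure) = sigma_sets UNIV (range (\<lambda>(a, b). box a b))"
    by (subst borel_eq_box) simp
  have leb: "A \<in> sets lebesgue" if "A \<in> sigma_sets UNIV (range (\<lambda>(a, b). box a b))" for A :: "'a set"
    using that unfolding borel_eq[symmetric] by (intro sets_completionI_sets) simp
  have borel: "(LINT x:A|lebesgue. g x) = 0" if "A \<in> sets borel" for A
  proof -
    have "Int_stable (range (\<lambda>(a, b). box a b :: 'a set))"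
      by (auto simp: Int_stable_def box_Int_box)
    moreover have "range (\<lambda>(a, b). box a b :: 'a set) \<subseteq> Pow UNIV" by simp
    moreover have "A \<in> sigma_sets UNIV (range (\<lambda>(a, b). box a b))"
      using that by (simp add: borel_eq)
    ultimately show ?thesis
    proof (induction rule: sigma_sets_induct_disjoint)
      case (compl A)
      then have A: "A \<in> sets lebesgue"
        by (simp add: leb)
      have "(LINT x:UNIV - A|lebesgue. g x) + (LINT x:A|lebesgue. g x) = (LINT x:UNIV|lebesgue. g x)"
        using A by (subst set_integral_Un[symmetric]) (auto intro!: si)
      then show ?case using compl total by (simp add: set_lebesgue_integral_def)
    next
      case (union A)
      then have A: "A i \<in> sets lebesgue" for i
        by (intro leb) auto
      have "(LINT x:(\<Union>i. A i)|lebesgue. g x) = (\<Sum>i. (LINT x:(A i)|lebesgue. g x))"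
        using union(1) A
        by (intro lebesgue_integral_countable_add si) (auto simp: disjoint_family_on_def)
      then show ?case using union by simp
    next
      case empty
      show ?case by (rule set_integral_empty)
    qed (auto simp: box)
  qed
  \<comment> \<open>A Lebesgue set is a Borel set up to a null set, so the Borel case
    decides.\<close>
  fix A :: "'a set" assume "A \<in> sets lebesgue"
  then obtain S N N' where A: "A = S \<union> N" "N \<subseteq> N'" "N' \<in> null_sets lborel" "S \<in> sets lborel"
    by (rule sets_completionE)
  have "N' \<in> null_sets lebesgue"
    using A null_sets_completionI by blast
  then have "AE x in lebesgue. x \<in> S \<longleftrightarrow> x \<in> A"
    using AE_not_in A by (auto elim!: eventually_mono dest!: AE_not_in)
  then have "(LINT x:A|lebesgue. g x) = (LINT x:S|lebesgue. g x)"
    using borel_measurable_integrable[OF si[unfolded set_integrable_def]] \<open>A \<in> sets lebesgue\<close> A(4)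
    by (intro set_integral_cong_set) (simp_all only: set_borel_measurable_def sets_completionI_sets)
  then show "(LINT x:A|lebesgue. g x) = 0" using borel A by simp
qed

text \<open>Cutting v off to an open box inside \<Omega> gives a function integrable on the whole
  space, whose integral over any box is that of v over an intersection, again a box. The local
  results are glued along a countable cover by closed boxes.\<close>

lemma AE_zero_if_test_integrals_zero:
  fixes v :: "'a::euclidean_space \<Rightarrow> real"
  assumes "open \<Omega>" and int: "set_integrable lebesgue \<Omega> v"
    and test: "\<And>\<phi>. test_fun \<Omega> \<phi> \<Longrightarrow> (LINT x:\<Omega>|lebesgue. v x * \<phi> x) = 0"
  shows "AE x in lebesgue. x \<in> \<Omega> \<longrightarrow> v x = 0"
proof -
  have local: "AE x in lebesgue. x \<in> cbox a b \<longrightarrow> v x = 0" if sub: "cbox a b \<subseteq> \<Omega>" for a b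
  proof -
    \<comment> \<open>Nonemptiness matters: an empty \<open>box c d\<close> may have a degenerate
      nonempty \<open>cbox c d\<close> lying outside \<Omega>. For a nonempty intersection
      \<open>cbox c d\<close> is its closure.\<close>
    have sub': "cbox c d \<subseteq> \<Omega>" if "box a b \<inter> box c' d' = box c d" "box c d \<noteq> {}" for c d c' d'
    proof -
      have "closure (box c d) \<subseteq> cbox a b"
        using that(1) box_subset_cbox[of a b] by (intro closure_minimal) auto
      then show ?thesis using sub closure_box[OF that(2)] by auto
    qed
    define g where "g x = indicator (box a b) x *\<^sub>R v x" for x
    have "set_integrable lebesgue (box a b) v"
      by (rule set_integrable_subset[OF int]) (use sub box_subset_cbox[of a b] in auto)
    then have "integrable lebesgue g"
      by (simp add: g_def[abs_def] set_integrable_def)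
    moreover have "(LINT x|lebesgue. g x) = 0"
      using set_integral_box_eq_0[OF int test sub] by (simp add: g_def set_lebesgue_integral_def)
    moreover have "(LINT x:box c d|lebesgue. g x) = 0" for c d
    proof -
      obtain c' d' where cd: "box a b \<inter> box c d = box c' d'"
        using box_Int_box by blast
      have "(LINT x:box c d|lebesgue. g x) = (LINT x:box c' d'|lebesgue. v x)"
        unfolding set_lebesgue_integral_def g_def cd[symmetric]
        by (intro Bochner_Integration.integral_cong) (auto simp: indicator_def)
      also have "\<dots> = 0"
      proof (cases "box c' d' = {}")
        case True
        show ?thesis unfolding True by (rule set_integral_empty)
      next
        case False
        show ?thesis using set_integral_box_eq_0[OF int test sub'[OF cd False]] .
      qed
      finally show ?thesis .
    qed
    ultimately have "AE x in lebesgue. g x = 0"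
      by (rule AE_zero_if_box_integrals_zero)
    then show ?thesis
      using AE_cbox_imp_box[of a b] by eventually_elim (auto simp: g_def indicator_def)
  qed
  obtain D where D: "countable D" "D \<subseteq> Pow \<Omega>" "\<And>X. X \<in> D \<Longrightarrow> \<exists>a b. X = cbox a b" "\<Union>D = \<Omega>"
    using open_countable_Union_open_cbox[OF \<open>open \<Omega>\<close>] by blast
  have "AE x in lebesgue. \<forall>X\<in>D. x \<in> X \<longrightarrow> v x = 0"
  proof (subst AE_ball_countable[OF D(1)], intro ballI)
    fix X assume "X \<in> D"
    then show "AE x in lebesgue. x \<in> X \<longrightarrow> v x = 0"
      using D(2,3) local by blast
  qed
  then show ?thesis
    by eventually_elim (use D(4) in auto)
qed

subsection \<open>Sums in Sobolev spaces\<close>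

lemma continuous_on_set_borel_measurable_lebesgue:
  fixes q :: "'a::euclidean_space \<Rightarrow> 'b::euclidean_space"
  assumes "open \<Omega>" "continuous_on \<Omega> q"
  shows "set_borel_measurable lebesgue \<Omega> q"
  using borel_measurable_continuous_on_indicator[OF _ assms(2)] assms(1)
  by (simp add: set_borel_measurable_def measurable_completion)

lemma set_borel_measurable_times:
  fixes f g :: "'a \<Rightarrow> real"
  assumes "set_borel_measurable M A f" "set_borel_measurable M A g"
  shows "set_borel_measurable M A (\<lambda>x. f x * g x)"
proof -
  have "(\<lambda>x. (indicator A x *\<^sub>R f x) * (indicator A x *\<^sub>R g x)) \<in> borel_measurable M"
    using assms by (intro borel_measurable_times) (auto simp: set_borel_measurable_def)
  moreover have "(\<lambda>x. (indicator A x *\<^sub>R f x) * (indicator A x *\<^sub>R g x)) = (\<lambda>x. indicator A x *\<^sub>R (f x * g x))"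
    by (auto simp: indicator_def)
  ultimately show ?thesis by (simp add: set_borel_measurable_def)
qed

lemma set_borel_measurable_add:
  fixes f g :: "'a \<Rightarrow> real"
  assumes "set_borel_measurable M A f" "set_borel_measurable M A g"
  shows "set_borel_measurable M A (\<lambda>x. f x + g x)"
  using borel_measurable_add[OF assms[unfolded set_borel_measurable_def]]
  by (simp add: set_borel_measurable_def scaleR_add_right distrib_left)

lemma sum_sq_le: "(x + y)\<^sup>2 \<le> 2 * x\<^sup>2 + 2 * (y::real)\<^sup>2"
  using sum_squares_bound[of x y] by (simp add: power2_sum)

lemma set_integrable_const_bounded:
  assumes "open \<Omega>" "bounded \<Omega>"
  shows "set_integrable lebesgue \<Omega> (\<lambda>x::'a::euclidean_space. c::real)"
proof -
  have "\<Omega> \<in> lmeasurable" using assms by (simp add: lmeasurable_open)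
  then have "integrable lebesgue (indicator \<Omega> :: 'a \<Rightarrow> real)"
    by (rule lmeasurable_iff_integrable[THEN iffD1])
  then show ?thesis
    unfolding set_integrable_def by (intro integrable_scaleR_left)
qed

lemma L2_on_add:
  assumes "L2_on A u" "L2_on A v"
  shows "L2_on A (\<lambda>x. u x + v x)"
  unfolding L2_on_def
proof
  show m: "set_borel_measurable lebesgue A (\<lambda>x. u x + v x)"
    using assms by (auto simp: L2_on_def intro: set_borel_measurable_add)
  have "set_integrable lebesgue A (\<lambda>x. 2 * (u x)\<^sup>2 + 2 * (v x)\<^sup>2)"
    using assms by (auto simp: L2_on_def)
  then show "set_integrable lebesgue A (\<lambda>x. (u x + v x)\<^sup>2)"
    by (rule set_integrable_bound)
      (use set_borel_measurable_times[OF m m] sum_sq_le in \<open>auto simp: power2_eq_square\<close>)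
qed

text \<open>On the bounded \<Omega> some B bounds |q|, and |u q| \<le> u^2 + B^2 has an integrable
  right side because \<Omega> has finite measure. With q = 1 this also gives integrability of L^2
  functions on \<Omega>.\<close>

lemma L2_on_times_bounded:
  assumes "open \<Omega>" "bounded \<Omega>" "L2_on \<Omega> u" "continuous_on UNIV q"
  shows "set_integrable lebesgue \<Omega> (\<lambda>x. u x * q x)"
proof -
  have "compact (q ` closure \<Omega>)"
    using assms by (intro compact_continuous_image) (auto intro: continuous_on_subset)
  then obtain B where B: "\<And>x. x \<in> \<Omega> \<Longrightarrow> \<bar>q x\<bar> \<le> B"
    using closure_subset by (force dest!: compact_imp_bounded simp: bounded_iff)
  have int: "set_integrable lebesgue \<Omega> (\<lambda>x. (u x)\<^sup>2 + B\<^sup>2)"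
    using assms set_integrable_const_bounded[OF assms(1,2)] by (intro set_integral_add) (auto simp: L2_on_def)
  have "\<bar>u x * q x\<bar> \<le> (u x)\<^sup>2 + B\<^sup>2" if "x \<in> \<Omega>" for x
  proof -
    have "2 * \<bar>u x\<bar> * \<bar>q x\<bar> \<le> \<bar>u x\<bar>\<^sup>2 + \<bar>q x\<bar>\<^sup>2" by (rule sum_squares_bound)
    moreover have "\<bar>q x\<bar>\<^sup>2 \<le> B\<^sup>2" using B[OF that] by (intro power_mono) auto
    moreover have "0 \<le> \<bar>u x\<bar> * \<bar>q x\<bar>" by simp
    ultimately show ?thesis unfolding abs_mult power2_abs by linarith
  qed
  then show ?thesis
    using assms
    by (intro set_integrable_bound[OF int] set_borel_measurable_times[OF _
        continuous_on_set_borel_measurable_lebesgue[OF _ continuous_on_subset[OF assms(4)]]])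
      (auto simp: L2_on_def)
qed

lemma continuous_on_multi_deriv:
  fixes \<alpha> :: "'a::euclidean_space \<Rightarrow> nat"
  assumes "multi_index \<alpha>" "test_fun \<Omega> \<phi>"
  shows "continuous_on UNIV (multi_deriv \<alpha> \<phi>)"
proof -
  obtain bs :: "'a list" where bs: "set bs = Basis" "distinct bs"
    using finite_distinct_list[OF finite_Basis] by blast
  \<comment> \<open>\<open>multi_deriv\<close> picks its list of directions by choice, so a list
    with the required counts must be exhibited: each basis vector i repeated \<alpha> i times. The
    chosen list then uses only basis vectors, because \<alpha> vanishes elsewhere.\<close>
  have "count_list (concat (map (\<lambda>i. replicate (\<alpha> i) i) bs)) j = (if j \<in> set bs then \<alpha> j else 0)"
    if "distinct bs" for bs j
    using that
  proof (induction bs)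
    case (Cons b bs)
    have "count_list (replicate n x) j = (if x = j then n else 0)" for n and x :: 'a
      by (induction n) auto
    then show ?case using Cons by (auto simp: count_list_append)
  qed simp
  then have "count_list (concat (map (\<lambda>i. replicate (\<alpha> i) i) bs)) = \<alpha>"
    using assms(1) bs by (auto simp: multi_index_def)
  then have some: "count_list (SOME is. count_list is = \<alpha>) = \<alpha>"
    by (rule someI)
  have "set (SOME is. count_list is = \<alpha>) \<subseteq> Basis"
  proof
    fix x assume x: "x \<in> set (SOME is. count_list is = \<alpha>)"
    then have "count_list (SOME is. count_list is = \<alpha>) x \<noteq> 0" by (simp add: count_list_0_iff)
    then have "\<alpha> x \<noteq> 0" unfolding some .
    then show "x \<in> Basis" using assms(1) by (auto simp: multi_index_def)
  qed
  then show ?thesis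
    using assms(2) by (auto simp: multi_deriv_def test_fun_def smooth_on_def Ck_on_def)
qed

lemma L2_weak_deriv_add:
  assumes "open \<Omega>" "bounded \<Omega>" "multi_index \<alpha>" "L2_on \<Omega> u" "L2_on \<Omega> u'"
    and d: "L2_weak_deriv \<Omega> \<alpha> u v" "L2_weak_deriv \<Omega> \<alpha> u' v'"
  shows "L2_weak_deriv \<Omega> \<alpha> (\<lambda>x. u x + u' x) (\<lambda>x. v x + v' x)"
  unfolding L2_weak_deriv_def
proof (intro conjI allI impI)
  show "L2_on \<Omega> (\<lambda>x. v x + v' x)"
    using d by (auto simp: L2_weak_deriv_def intro: L2_on_add)
  fix \<phi> assume t: "test_fun \<Omega> \<phi>"
  have "continuous_on UNIV \<phi>"
    using t unfolding test_fun_def smooth_on_def by (metis Ck_on_0)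
  note int = L2_on_times_bounded[OF assms(1,2)]
  have 1: "set_integrable lebesgue \<Omega> (\<lambda>x. u x * multi_deriv \<alpha> \<phi> x)"
    "set_integrable lebesgue \<Omega> (\<lambda>x. u' x * multi_deriv \<alpha> \<phi> x)"
    "set_integrable lebesgue \<Omega> (\<lambda>x. v x * \<phi> x)" "set_integrable lebesgue \<Omega> (\<lambda>x. v' x * \<phi> x)"
    using assms(4,5) d continuous_on_multi_deriv[OF assms(3) t] \<open>continuous_on UNIV \<phi>\<close>
    by (auto simp: L2_weak_deriv_def intro: int)
  have "(LINT x:\<Omega>|lebesgue. u x * multi_deriv \<alpha> \<phi> x) = (- 1) ^ order_of \<alpha> * (LINT x:\<Omega>|lebesgue. v x * \<phi> x)"
    "(LINT x:\<Omega>|lebesgue. u' x * multi_deriv \<alpha> \<phi> x) = (- 1) ^ order_of \<alpha> * (LINT x:\<Omega>|lebesgue. v' x * \<phi> x)"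
    using d t by (auto simp: L2_weak_deriv_def)
  then show "(LINT x:\<Omega>|lebesgue. (u x + u' x) * multi_deriv \<alpha> \<phi> x) =
      (- 1) ^ order_of \<alpha> * (LINT x:\<Omega>|lebesgue. (v x + v' x) * \<phi> x)"
    using 1 by (simp add: distrib_right ring_distribs)
qed

text \<open>Both candidates have the same integrals against all test functions, so their difference
  falls under the fundamental lemma.\<close>

lemma L2_weak_deriv_unique:
  assumes "open \<Omega>" "bounded \<Omega>" and d: "L2_weak_deriv \<Omega> \<alpha> u v" "L2_weak_deriv \<Omega> \<alpha> u v'"
  shows "AE x in lebesgue. x \<in> \<Omega> \<longrightarrow> v x = v' x"
proof -
  note int = L2_on_times_bounded[OF assms(1,2)]
  have int_v: "set_integrable lebesgue \<Omega> v" "set_integrable lebesgue \<Omega> v'"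
    using int[of v "\<lambda>_. 1"] int[of v' "\<lambda>_. 1"] d by (auto simp: L2_weak_deriv_def)
  have "AE x in lebesgue. x \<in> \<Omega> \<longrightarrow> v x - v' x = 0"
  proof (rule AE_zero_if_test_integrals_zero[OF assms(1)])
    show "set_integrable lebesgue \<Omega> (\<lambda>x. v x - v' x)" using int_v by simp
    fix \<phi> assume t: "test_fun \<Omega> \<phi>"
    have "continuous_on UNIV \<phi>"
      using t unfolding test_fun_def smooth_on_def by (metis Ck_on_0)
    then have "set_integrable lebesgue \<Omega> (\<lambda>x. v x * \<phi> x)" "set_integrable lebesgue \<Omega> (\<lambda>x. v' x * \<phi> x)"
      using d by (auto simp: L2_weak_deriv_def intro: int)
    moreover have "(LINT x:\<Omega>|lebesgue. v x * \<phi> x) = (LINT x:\<Omega>|lebesgue. v' x * \<phi> x)"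
      using d t by (auto simp: L2_weak_deriv_def)
    ultimately show "(LINT x:\<Omega>|lebesgue. (v x - v' x) * \<phi> x) = 0"
      by (simp add: left_diff_distrib)
  qed
  then show ?thesis by simp
qed

lemma wderiv_works: "\<exists>v. L2_weak_deriv \<Omega> \<alpha> u v \<Longrightarrow> L2_weak_deriv \<Omega> \<alpha> u (wderiv \<Omega> \<alpha> u)"
  unfolding wderiv_def by (rule someI_ex[of "L2_weak_deriv \<Omega> \<alpha> u"])

text \<open>\<open>wderiv\<close> is chosen separately for each function, so the representative of
  the sum need not be the sum of the representatives. Uniqueness makes them agree almost everywhere,
  which is all that integrals see.\<close>

lemma wderiv_add_AE:
  assumes \<Omega>: "open \<Omega>" "bounded \<Omega>" and "sobolev s \<Omega> u" "sobolev s \<Omega> v"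
    and \<alpha>: "multi_index \<alpha>" "order_of \<alpha> \<le> nat \<lfloor>s\<rfloor>"
  shows "L2_weak_deriv \<Omega> \<alpha> (\<lambda>x. u x + v x) (wderiv \<Omega> \<alpha> (\<lambda>x. u x + v x))"
    and "AE x in lebesgue. x \<in> \<Omega> \<longrightarrow>
      wderiv \<Omega> \<alpha> (\<lambda>x. u x + v x) x = wderiv \<Omega> \<alpha> u x + wderiv \<Omega> \<alpha> v x"
proof -
  have "L2_weak_deriv \<Omega> \<alpha> u (wderiv \<Omega> \<alpha> u)" "L2_weak_deriv \<Omega> \<alpha> v (wderiv \<Omega> \<alpha> v)"
    using assms by (auto simp: sobolev_def intro: wderiv_works)
  then have *: "L2_weak_deriv \<Omega> \<alpha> (\<lambda>x. u x + v x) (\<lambda>x. wderiv \<Omega> \<alpha> u x + wderiv \<Omega> \<alpha> v x)"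
    using assms by (intro L2_weak_deriv_add) (auto simp: sobolev_def)
  then show **: "L2_weak_deriv \<Omega> \<alpha> (\<lambda>x. u x + v x) (wderiv \<Omega> \<alpha> (\<lambda>x. u x + v x))"
    by (blast intro: wderiv_works)
  show "AE x in lebesgue. x \<in> \<Omega> \<longrightarrow>
      wderiv \<Omega> \<alpha> (\<lambda>x. u x + v x) x = wderiv \<Omega> \<alpha> u x + wderiv \<Omega> \<alpha> v x"
    by (rule L2_weak_deriv_unique[OF \<Omega> ** *])
qed

section \<open>Slobodeckij quotients on the product domain\<close>

lemma borel_representative:
  assumes "set_borel_measurable lebesgue \<Omega> (u :: 'a::euclidean_space \<Rightarrow> real)"
  shows "\<exists>g\<in>borel_measurable borel. AE x in lborel. x \<in> \<Omega> \<longrightarrow> u x = g x"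
proof -
  obtain g where "g \<in> borel_measurable lborel" "AE x in lborel. indicator \<Omega> x *\<^sub>R u x = g x"
    using assms completion_ex_borel_measurable_real unfolding set_borel_measurable_def by blast
  then show ?thesis
    by (intro bexI[of _ g]) (auto elim!: eventually_mono simp: indicator_def)
qed

text \<open>The exceptional pairs lie in the two strips over a null Borel set N, and a strip has
  product measure 0 times infinity, that is 0.\<close>

lemma AE_lebesgue_pair:
  fixes P :: "'a::euclidean_space \<Rightarrow> bool"
  assumes "AE x in lebesgue. P x"
  shows "AE z in (lebesgue :: ('a \<times> 'a) measure). P (fst z) \<and> P (snd z)"
proof -
  obtain N where N: "{x. \<not> P x} \<subseteq> N" "N \<in> null_sets lborel"
    using assms unfolding AE_completion_iff by (auto simp: eventually_ae_filter)
  have "N \<times> UNIV \<in> null_sets lborel" "UNIV \<times> N \<in> null_sets lborel"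
    using N(2) unfolding lborel_prod[symmetric]
    by (auto simp: null_sets_def lborel.emeasure_pair_measure_Times lborel_pair.emeasure_pair_measure_Times)
  then have "AE z in (lborel :: ('a \<times> 'a) measure). z \<notin> N \<times> UNIV \<and> z \<notin> UNIV \<times> N"
    by (auto dest!: AE_not_in)
  then have "AE z in (lborel :: ('a \<times> 'a) measure). P (fst z) \<and> P (snd z)"
    by eventually_elim (use N(1) in auto)
  then show ?thesis by (rule AE_completion)
qed

text \<open>Lebesgue measurability does not pass directly through the two projections, since the
  Lebesgue sets of the product are the completion of its Borel sets. A Borel representative of v has
  a Borel quotient, and the two quotients agree almost everywhere on \<Omega> \<times>
  \<Omega>.\<close>

lemma slobodeckij_quot_measurable:
  fixes v :: "'a::euclidean_space \<Rightarrow> real"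
  assumes \<Omega>: "open \<Omega>" and v: "set_borel_measurable lebesgue \<Omega> v"
  shows "set_borel_measurable lebesgue (\<Omega> \<times> \<Omega>) (slobodeckij_quot \<sigma> v)"
proof -
  obtain g where g: "g \<in> borel_measurable borel" "AE x in lborel. x \<in> \<Omega> \<longrightarrow> v x = g x"
    using borel_representative[OF v] by blast
  have [measurable]: "g \<in> borel_measurable borel" "\<Omega> \<in> sets borel"
    using g \<Omega> by auto
  have "slobodeckij_quot \<sigma> g \<in> borel_measurable (borel \<Otimes>\<^sub>M borel)"
    unfolding slobodeckij_quot_def by measurable
  then have m: "slobodeckij_quot \<sigma> g \<in> borel_measurable borel"
    by (simp add: borel_prod)
  have "(\<lambda>z. indicator (\<Omega> \<times> \<Omega>) z *\<^sub>R slobodeckij_quot \<sigma> g z) \<in> borel_measurable borel"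
    using \<Omega> by (intro borel_measurable_scaleR borel_measurable_indicator m) (simp add: open_Times)
  then have 1: "(\<lambda>z. indicator (\<Omega> \<times> \<Omega>) z *\<^sub>R slobodeckij_quot \<sigma> g z) \<in> borel_measurable lebesgue"
    by (simp add: measurable_completion)
  have "AE z in (lebesgue :: ('a \<times> 'a) measure).
      (fst z \<in> \<Omega> \<longrightarrow> v (fst z) = g (fst z)) \<and> (snd z \<in> \<Omega> \<longrightarrow> v (snd z) = g (snd z))"
    using AE_completion[OF g(2)] by (rule AE_lebesgue_pair)
  then have 2: "AE z in lebesgue. indicator (\<Omega> \<times> \<Omega>) z *\<^sub>R slobodeckij_quot \<sigma> g z =
      indicator (\<Omega> \<times> \<Omega>) z *\<^sub>R slobodeckij_quot \<sigma> v z"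
    by eventually_elim (auto simp: slobodeckij_quot_def indicator_def)
  show ?thesis
    unfolding set_borel_measurable_def
    by (rule borel_measurable_AE[OF 1 2])
qed

text \<open>The bound (x + y)^2 \<le> 2 x^2 + 2 y^2 is applied pointwise, to the derivatives and to
  their differences at two points, in place of a Minkowski inequality. The middle claim makes the
  fractional seminorm of the sum a genuine integral and gives closure of the space under
  addition.\<close>

lemma sobolev_add_seminorms:
  assumes \<Omega>: "open \<Omega>" "bounded \<Omega>" and uv: "sobolev s \<Omega> u" "sobolev s \<Omega> v"
    and \<alpha>: "multi_index \<alpha>" "order_of \<alpha> \<le> nat \<lfloor>s\<rfloor>"
  shows "(LINT x:\<Omega>|lebesgue. (wderiv \<Omega> \<alpha> (\<lambda>x. u x + v x) x)\<^sup>2) \<le>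
      2 * (LINT x:\<Omega>|lebesgue. (wderiv \<Omega> \<alpha> u x)\<^sup>2) + 2 * (LINT x:\<Omega>|lebesgue. (wderiv \<Omega> \<alpha> v x)\<^sup>2)"
    and "frac s \<noteq> 0 \<Longrightarrow> order_of \<alpha> = nat \<lfloor>s\<rfloor> \<Longrightarrow>
      set_integrable lebesgue (\<Omega> \<times> \<Omega>) (slobodeckij_quot (frac s) (wderiv \<Omega> \<alpha> (\<lambda>x. u x + v x)))"
    and "frac s \<noteq> 0 \<Longrightarrow> order_of \<alpha> = nat \<lfloor>s\<rfloor> \<Longrightarrow>
      (LINT z:\<Omega> \<times> \<Omega>|lebesgue. slobodeckij_quot (frac s) (wderiv \<Omega> \<alpha> (\<lambda>x. u x + v x)) z) \<le>
      2 * (LINT z:\<Omega> \<times> \<Omega>|lebesgue. slobodeckij_quot (frac s) (wderiv \<Omega> \<alpha> u) z) +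
      2 * (LINT z:\<Omega> \<times> \<Omega>|lebesgue. slobodeckij_quot (frac s) (wderiv \<Omega> \<alpha> v) z)"
proof -
  let ?W = "wderiv \<Omega> \<alpha> (\<lambda>x. u x + v x)" and ?U = "wderiv \<Omega> \<alpha> u" and ?V = "wderiv \<Omega> \<alpha> v"
  have L2: "L2_on \<Omega> ?W" "L2_on \<Omega> ?U" "L2_on \<Omega> ?V"
  proof -
    have "L2_weak_deriv \<Omega> \<alpha> u ?U" "L2_weak_deriv \<Omega> \<alpha> v ?V"
      using uv \<alpha> by (auto simp: sobolev_def intro: wderiv_works)
    then show "L2_on \<Omega> ?W" "L2_on \<Omega> ?U" "L2_on \<Omega> ?V"
      using wderiv_add_AE(1)[OF \<Omega> uv \<alpha>] by (simp_all only: L2_weak_deriv_def)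
  qed
  note ae = wderiv_add_AE(2)[OF \<Omega> uv \<alpha>]
  have "(LINT x:\<Omega>|lebesgue. (?W x)\<^sup>2) \<le> (LINT x:\<Omega>|lebesgue. 2 * (?U x)\<^sup>2 + 2 * (?V x)\<^sup>2)"
  proof (rule set_integral_mono_AE)
    show "AE x\<in>\<Omega> in lebesgue. (?W x)\<^sup>2 \<le> 2 * (?U x)\<^sup>2 + 2 * (?V x)\<^sup>2"
      using ae by eventually_elim (auto simp: sum_sq_le)
  qed (use L2 in \<open>auto simp: L2_on_def\<close>)
  also have "\<dots> = 2 * (LINT x:\<Omega>|lebesgue. (?U x)\<^sup>2) + 2 * (LINT x:\<Omega>|lebesgue. (?V x)\<^sup>2)"
    using L2 by (subst set_integral_add) (auto simp: L2_on_def)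
  finally show "(LINT x:\<Omega>|lebesgue. (?W x)\<^sup>2) \<le>
      2 * (LINT x:\<Omega>|lebesgue. (?U x)\<^sup>2) + 2 * (LINT x:\<Omega>|lebesgue. (?V x)\<^sup>2)" .
  assume fr: "frac s \<noteq> 0" "order_of \<alpha> = nat \<lfloor>s\<rfloor>"
  let ?Q = "slobodeckij_quot (frac s)"
  have int: "set_integrable lebesgue (\<Omega> \<times> \<Omega>) (?Q ?U)" "set_integrable lebesgue (\<Omega> \<times> \<Omega>) (?Q ?V)"
    using uv \<alpha> fr by (auto simp: sobolev_def)
  then have int2: "set_integrable lebesgue (\<Omega> \<times> \<Omega>) (\<lambda>z. 2 * ?Q ?U z + 2 * ?Q ?V z)"
    by auto
  have le: "?Q ?W z \<le> 2 * ?Q ?U z + 2 * ?Q ?V z"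
    if "?W (fst z) = ?U (fst z) + ?V (fst z)" "?W (snd z) = ?U (snd z) + ?V (snd z)" for z
  proof -
    obtain x y where z: "z = (x, y)" by (cases z)
    have "(?W x - ?W y)\<^sup>2 \<le> 2 * (?U x - ?U y)\<^sup>2 + 2 * (?V x - ?V y)\<^sup>2"
      using sum_sq_le[of "?U x - ?U y" "?V x - ?V y"] that z by (simp add: algebra_simps)
    then have "(?W x - ?W y)\<^sup>2 / norm (x - y) powr (real DIM('a) + 2 * frac s) \<le>
        (2 * (?U x - ?U y)\<^sup>2 + 2 * (?V x - ?V y)\<^sup>2) / norm (x - y) powr (real DIM('a) + 2 * frac s)"
      by (rule divide_right_mono) simp
    then show ?thesis by (simp add: z slobodeckij_quot_def add_divide_distrib)
  qed
  have nonneg: "0 \<le> ?Q w z" for w z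
    by (cases z) (simp add: slobodeckij_quot_def)
  have AE: "AE z in lebesgue. z \<in> \<Omega> \<times> \<Omega> \<longrightarrow> ?Q ?W z \<le> 2 * ?Q ?U z + 2 * ?Q ?V z"
    using AE_lebesgue_pair[OF ae] by eventually_elim (auto intro: le)
  show intW: "set_integrable lebesgue (\<Omega> \<times> \<Omega>) (?Q ?W)"
  proof (rule set_integrable_bound[OF int2])
    show "set_borel_measurable lebesgue (\<Omega> \<times> \<Omega>) (?Q ?W)"
      using L2 by (intro slobodeckij_quot_measurable \<Omega>) (auto simp: L2_on_def)
    show "AE z in lebesgue. z \<in> \<Omega> \<times> \<Omega> \<longrightarrow> norm (?Q ?W z) \<le> norm (2 * ?Q ?U z + 2 * ?Q ?V z)"
      using AE by eventually_elim (auto simp: nonneg)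
  qed
  have "(LINT z:\<Omega> \<times> \<Omega>|lebesgue. ?Q ?W z) \<le> (LINT z:\<Omega> \<times> \<Omega>|lebesgue. 2 * ?Q ?U z + 2 * ?Q ?V z)"
    by (rule set_integral_mono_AE[OF intW int2 AE])
  also have "\<dots> = 2 * (LINT z:\<Omega> \<times> \<Omega>|lebesgue. ?Q ?U z) + 2 * (LINT z:\<Omega> \<times> \<Omega>|lebesgue. ?Q ?V z)"
    using int by (subst set_integral_add) auto
  finally show "(LINT z:\<Omega> \<times> \<Omega>|lebesgue. ?Q ?W z) \<le>
      2 * (LINT z:\<Omega> \<times> \<Omega>|lebesgue. ?Q ?U z) + 2 * (LINT z:\<Omega> \<times> \<Omega>|lebesgue. ?Q ?V z)" .
qed

lemma sobolev_add:
  assumes \<Omega>: "open \<Omega>" "bounded \<Omega>" and uv: "sobolev s \<Omega> u" "sobolev s \<Omega> v"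
  shows "sobolev s \<Omega> (\<lambda>x. u x + v x)"
  unfolding sobolev_def
proof (intro conjI allI impI)
  show "L2_on \<Omega> (\<lambda>x. u x + v x)"
    using uv by (auto simp: sobolev_def intro: L2_on_add)
  show "\<exists>w. L2_weak_deriv \<Omega> \<alpha> (\<lambda>x. u x + v x) w" if "multi_index \<alpha> \<and> order_of \<alpha> \<le> nat \<lfloor>s\<rfloor>" for \<alpha>
    using wderiv_add_AE(1)[OF \<Omega> uv] that by blast
  show "set_integrable lebesgue (\<Omega> \<times> \<Omega>) (slobodeckij_quot (frac s) (wderiv \<Omega> \<alpha> (\<lambda>x. u x + v x)))"
    if "frac s \<noteq> 0" "multi_index \<alpha> \<and> order_of \<alpha> = nat \<lfloor>s\<rfloor>" for \<alpha>
    using sobolev_add_seminorms(2)[OF \<Omega> uv] that by auto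
qed

lemma sobolev_sqnorm_add_le:
  assumes \<Omega>: "open \<Omega>" "bounded \<Omega>" and uv: "sobolev s \<Omega> u" "sobolev s \<Omega> v"
  shows "sobolev_sqnorm s \<Omega> (\<lambda>x. u x + v x) \<le> 2 * sobolev_sqnorm s \<Omega> u + 2 * sobolev_sqnorm s \<Omega> v"
proof -
  have "(\<Sum>\<alpha> | multi_index \<alpha> \<and> order_of \<alpha> \<le> nat \<lfloor>s\<rfloor>. LINT x:\<Omega>|lebesgue. (wderiv \<Omega> \<alpha> (\<lambda>x. u x + v x) x)\<^sup>2) \<le>
    (\<Sum>\<alpha> | multi_index \<alpha> \<and> order_of \<alpha> \<le> nat \<lfloor>s\<rfloor>.
      2 * (LINT x:\<Omega>|lebesgue. (wderiv \<Omega> \<alpha> u x)\<^sup>2) + 2 * (LINT x:\<Omega>|lebesgue. (wderiv \<Omega> \<alpha> v x)\<^sup>2))"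
    by (intro sum_mono sobolev_add_seminorms(1)[OF \<Omega> uv]) auto
  moreover have "(\<Sum>\<alpha> | multi_index \<alpha> \<and> order_of \<alpha> = nat \<lfloor>s\<rfloor>.
      LINT z:\<Omega> \<times> \<Omega>|lebesgue. slobodeckij_quot (frac s) (wderiv \<Omega> \<alpha> (\<lambda>x. u x + v x)) z) \<le>
    (\<Sum>\<alpha> | multi_index \<alpha> \<and> order_of \<alpha> = nat \<lfloor>s\<rfloor>.
      2 * (LINT z:\<Omega> \<times> \<Omega>|lebesgue. slobodeckij_quot (frac s) (wderiv \<Omega> \<alpha> u) z) +
      2 * (LINT z:\<Omega> \<times> \<Omega>|lebesgue. slobodeckij_quot (frac s) (wderiv \<Omega> \<alpha> v) z))" if "frac s \<noteq> 0"
    using that by (intro sum_mono sobolev_add_seminorms(3)[OF \<Omega> uv]) auto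
  ultimately show ?thesis
    by (auto simp: sobolev_sqnorm_def sum.distrib sum_distrib_left[symmetric])
qed

lemma sobolev_sqnorm_nonneg: "0 \<le> sobolev_sqnorm s \<Omega> u"
  unfolding sobolev_sqnorm_def set_lebesgue_integral_def
  by (auto intro!: add_nonneg_nonneg sum_nonneg Bochner_Integration.integral_nonneg simp: slobodeckij_quot_def split: prod.split)

lemma Hs_norm_sq: "(Hs_norm s \<Omega> U)\<^sup>2 = (\<Sum>n\<in>UNIV. sobolev_sqnorm s \<Omega> (\<lambda>x. U x $ n))"
  unfolding Hs_norm_def by (intro real_sqrt_pow2 sum_nonneg sobolev_sqnorm_nonneg)

lemma Hs_norm_add_sq_le:
  assumes "open \<Omega>" "bounded \<Omega>" "U \<in> Hs s \<Omega>" "V \<in> Hs s \<Omega>"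
  shows "(Hs_norm s \<Omega> (\<lambda>x. U x + V x))\<^sup>2 \<le> 2 * (Hs_norm s \<Omega> U)\<^sup>2 + 2 * (Hs_norm s \<Omega> V)\<^sup>2"
proof -
  have "(\<Sum>n\<in>UNIV. sobolev_sqnorm s \<Omega> (\<lambda>x. (U x + V x) $ n)) \<le>
     (\<Sum>n\<in>UNIV. 2 * sobolev_sqnorm s \<Omega> (\<lambda>x. U x $ n) + 2 * sobolev_sqnorm s \<Omega> (\<lambda>x. V x $ n))"
    unfolding vector_add_component
    using assms by (intro sum_mono sobolev_sqnorm_add_le) (auto simp: Hs_def)
  then show ?thesis
    by (simp add: Hs_norm_sq sum.distrib sum_distrib_left)
qed

subsection \<open>Differentiability of the nonlinear term\<close>

lemma smooth_on_UNIV_differentiable: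
  fixes f :: "'a::euclidean_space \<Rightarrow> real"
  assumes "smooth_on UNIV f" "set is \<subseteq> Basis"
  shows "iter_deriv f is differentiable (at x)" "continuous_on UNIV (iter_deriv f is)"
proof -
  have "Ck_on (Suc (length is)) UNIV f" using assms(1) by (simp add: smooth_on_def)
  then have "iter_deriv f is differentiable_on UNIV"
    using assms(2) unfolding Ck_on_def by blast
  then show "iter_deriv f is differentiable (at x)" "continuous_on UNIV (iter_deriv f is)"
    by (auto intro: differentiable_on_openD differentiable_imp_continuous_on)
qed

text \<open>Differentiation under the integral sign needs the derivative as a bounded linear map
  depending continuously on (z, t). Continuity is checked on basis vectors, where it reduces to
  continuity of the partial derivatives of F.\<close>

lemma differentiable_parametric_integral:
  fixes F :: "'b::euclidean_space \<Rightarrow> real" and L :: "real \<Rightarrow> 'z::euclidean_space \<Rightarrow> 'b"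
  assumes F: "smooth_on UNIV F"
    and lin: "\<And>t. t \<in> {a..b} \<Longrightarrow> linear (L t)"
    and cont: "continuous_on (UNIV \<times> {a..b}) (\<lambda>(z, t). L t z)"
    and w: "continuous_on {a..b} w"
  shows "(\<lambda>z. integral {a..b} (\<lambda>t. F (L t z) * w t)) differentiable (at z)"
proof -
  define F' where "F' y v = (\<Sum>i\<in>Basis. (v \<bullet> i) * iter_deriv F [i] y)" for y v
  have contF: "continuous_on UNIV F"
    using smooth_on_UNIV_differentiable(2)[OF F, of "[]"] by simp
  have dF: "(F has_derivative F' y) (at y)" for y
  proof -
    have D: "(F has_derivative frechet_derivative F (at y)) (at y)"
      using smooth_on_UNIV_differentiable(1)[OF F, of "[]"] by (simp add: frechet_derivative_works)
    have l: "linear (frechet_derivative F (at y))"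
      using D has_derivative_linear by blast
    have "frechet_derivative F (at y) v = F' y v" for v
    proof -
      have "frechet_derivative F (at y) (\<Sum>i\<in>Basis. (v \<bullet> i) *\<^sub>R i) = F' y v"
        unfolding F'_def by (simp add: linear_sum[OF l] linear_scale[OF l])
      then show ?thesis by (simp add: euclidean_representation)
    qed
    then have "frechet_derivative F (at y) = F' y" by (rule ext)
    with D show ?thesis by simp
  qed
  have contt: "continuous_on {a..b} (\<lambda>t. L t z)" for z
  proof -
    have "continuous_on {a..b} (\<lambda>t. (z, t))" by (intro continuous_intros)
    from continuous_on_compose2[OF cont this] show ?thesis by auto
  qed
  \<comment> \<open>\<open>Blinfun\<close> is known to represent this map only when the map is
    bounded linear, hence the restriction to t in [a, b] in the next fact.\<close>
  define fx where "fx z t = Blinfun (\<lambda>h. F' (L t z) (L t h) * w t)" for z t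
  have fx: "blinfun_apply (fx z t) = (\<lambda>h. F' (L t z) (L t h) * w t)" if "t \<in> {a..b}" for z t
  proof -
    have "linear (\<lambda>h. F' (L t z) (L t h) * w t)"
      by (rule linearI) (auto simp: F'_def linear_add[OF lin[OF that]] linear_scale[OF lin[OF that]]
          inner_add_left distrib_right distrib_left sum.distrib sum_distrib_left sum_distrib_right mult.assoc)
    then show ?thesis
      unfolding fx_def by (intro bounded_linear_Blinfun_apply) (simp add: linear_conv_bounded_linear)
  qed
  have "((\<lambda>z. integral (cbox a b) (\<lambda>t. F (L t z) * w t)) has_derivative
      blinfun_apply (integral (cbox a b) (fx z))) (at z within UNIV)"
  proof (rule leibniz_rule)
    fix z t assume t: "t \<in> cbox a b"
    have "(L t has_derivative L t) (at z)"
      using lin t by (intro linear_imp_has_derivative) simp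
    then have "((\<lambda>z. F (L t z)) has_derivative (\<lambda>h. F' (L t z) (L t h))) (at z)"
      using dF by (rule has_derivative_compose)
    then have "((\<lambda>z. F (L t z) * w t) has_derivative (\<lambda>h. F' (L t z) (L t h) * w t)) (at z)"
      by (rule has_derivative_mult_left)
    then show "((\<lambda>z. F (L t z) * w t) has_derivative blinfun_apply (fx z t)) (at z within UNIV)"
      using fx t by simp
  next
    fix z
    have "continuous_on (cbox a b) (\<lambda>t. F (L t z) * w t)"
      using continuous_on_compose2[OF contF contt[of z]] w by (auto intro!: continuous_intros)
    then show "(\<lambda>t. F (L t z) * w t) integrable_on cbox a b"
      by (rule integrable_continuous)
  next
    have c1: "continuous_on (UNIV \<times> {a..b}) (\<lambda>(z :: 'z, t). L t h)" for h :: 'z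
    proof -
      have "continuous_on (UNIV \<times> {a..b}) (snd :: 'z \<times> real \<Rightarrow> real)" by (intro continuous_intros)
      from continuous_on_compose2[OF contt[of h] this] show ?thesis by (auto simp: case_prod_unfold)
    qed
    have c2: "continuous_on (UNIV \<times> {a..b}) (\<lambda>(z, t). iter_deriv F [i] (L t z))" if "i \<in> Basis" for i
      using continuous_on_compose2[OF smooth_on_UNIV_differentiable(2)[OF F, of "[i]"] cont] that
      by (auto simp: case_prod_unfold)
    have c3: "continuous_on (UNIV \<times> {a..b}) (\<lambda>zt. w (snd zt))"
      by (rule continuous_on_compose2[OF w]) (auto intro!: continuous_intros)
    have "continuous_on (UNIV \<times> cbox a b) (\<lambda>zt. fx (fst zt) (snd zt))"
    proof (rule continuous_on_blinfun_componentwise)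
      fix h :: 'z assume "h \<in> Basis"
      have "continuous_on (UNIV \<times> {a..b}) (\<lambda>zt. F' (L (snd zt) (fst zt)) (L (snd zt) h) * w (snd zt))"
        unfolding F'_def
        by (intro continuous_intros c1[of h, unfolded case_prod_unfold] c2[unfolded case_prod_unfold] c3)
      moreover have "blinfun_apply (fx (fst zt) (snd zt)) h = F' (L (snd zt) (fst zt)) (L (snd zt) h) * w (snd zt)"
        if "zt \<in> UNIV \<times> {a..b}" for zt
        using that fx by auto
      ultimately show "continuous_on (UNIV \<times> cbox a b) (\<lambda>zt. blinfun_apply (fx (fst zt) (snd zt)) h)"
        by (subst continuous_on_cong) auto
    qed
    then show "continuous_on (UNIV \<times> cbox a b) (\<lambda>(z, t). fx z t)"
      by (simp add: case_prod_unfold)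
  qed auto
  then show ?thesis by (auto simp: differentiable_def)
qed

lemma differentiable_vec_componentwise:
  fixes f :: "'z::euclidean_space \<Rightarrow> real ^ 'N::finite"
  assumes "\<And>m. (\<lambda>z. f z $ m) differentiable (at z)"
  shows "f differentiable (at z)"
  using assms
  by (subst differentiable_componentwise_within) (auto simp: Basis_vec_def inner_axis)

lemma grad_differentiable:
  assumes "smooth_on UNIV p"
  shows "grad p differentiable (at x)"
proof -
  have "(\<lambda>x. \<Sum>i\<in>Basis. iter_deriv p [i] x *\<^sub>R i) differentiable (at x)"
    by (intro differentiable_sum finite_Basis ballI differentiable_scaleR
        smooth_on_UNIV_differentiable assms) auto
  then show ?thesis by (simp add: grad_def[abs_def])
qed

lemma laplacian_differentiable:
  assumes "smooth_on UNIV p"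
  shows "laplacian p differentiable (at x)"
  unfolding laplacian_def[abs_def]
  by (intro differentiable_sum finite_Basis ballI smooth_on_UNIV_differentiable assms) auto

lemma differentiable_comp_fst:
  "f differentiable (at (fst z)) \<Longrightarrow> (\<lambda>z. f (fst z)) differentiable (at z)"
  by (rule differentiable_compose[of f fst]) (auto intro: bounded_linear_imp_differentiable bounded_linear_fst)

text \<open>The C^1 norm is formed with \<open>frechet_derivative\<close>, which carries information
  only at points of differentiability; this lemma licenses its use. Each component is a factor
  independent of t times an integral of F along a map that is linear in (x, u, P).\<close>

lemma calF_differentiable:
  fixes F :: "'a::euclidean_space \<times> real \<times> real \<times> 'a \<Rightarrow> real" and \<psi> :: "'N::finite \<Rightarrow> real \<Rightarrow> real"
  assumes F: "smooth_on UNIV F" and p: "smooth_on UNIV p" and \<psi>: "\<And>n. C2_time T (\<psi> n)"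
    and nz: "F (x, p x, 0, grad p x) \<noteq> 0"
  shows "calF T \<psi> F p differentiable (at (x, u, P))"
proof (rule differentiable_vec_componentwise)
  fix m
  have cont: "continuous_on {0..T} (\<psi> n)" "continuous_on {0..T} (tderiv T (\<psi> n))" for n
    using \<psi>[of n] by (auto simp: C2_time_def intro: differentiable_imp_continuous_on)
  \<comment> \<open>Collects the four arguments of F. They are jointly linear in (x, u, P) for fixed
    t, and continuous in t because only \<psi> and its first derivative occur.\<close>
  define L where "L t z = (fst z, \<Sum>n\<in>UNIV. fst (snd z) $ n * \<psi> n t,
      \<Sum>n\<in>UNIV. fst (snd z) $ n * tderiv T (\<psi> n) t, \<Sum>n\<in>UNIV. \<psi> n t *\<^sub>R snd (snd z) $ n)"
    for t and z :: "'a \<times> (real ^ 'N) \<times> ('a ^ 'N)"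
  have lin: "linear (L t)" for t
    by (rule linearI)
      (auto simp: L_def distrib_right sum.distrib sum_distrib_left scaleR_add_right scaleR_sum_right
        mult.assoc intro!: sum.cong)
  have cont_snd: "continuous_on (UNIV \<times> {0..T}) (\<lambda>x :: ('a \<times> (real ^ 'N) \<times> ('a ^ 'N)) \<times> real. g (snd x))"
    if "continuous_on {0..T} g" for g :: "real \<Rightarrow> real"
    by (rule continuous_on_compose2[OF that]) (auto intro!: continuous_intros)
  have contL: "continuous_on (UNIV \<times> {0..T}) (\<lambda>(z, t). L t z)"
    unfolding L_def case_prod_unfold
    by (intro continuous_intros cont_snd cont)
  have contF: "continuous_on UNIV F"
    using smooth_on_UNIV_differentiable(2)[OF F, of "[]"] by simp
  have dF: "F differentiable (at y)" for y
    using smooth_on_UNIV_differentiable(1)[OF F, of "[]"] by simp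
  have dp: "p differentiable (at y)" for y
    using smooth_on_UNIV_differentiable(1)[OF p, of "[]"] by simp
  have d0: "(\<lambda>x. F (x, p x, 0, grad p x)) differentiable (at x)" for x
    by (rule differentiable_compose[of F, OF dF]) (intro differentiable_Pair differentiable_ident differentiable_const dp grad_differentiable p)
  let ?z = "(x, u, P)"
  define c where "c z = ((\<Sum>n\<in>UNIV. fst (snd z) $ n * tderiv T (tderiv T (\<psi> n)) 0) - laplacian p (fst z)) /
      F (fst z, p (fst z), 0, grad p (fst z))" for z :: "'a \<times> (real ^ 'N) \<times> ('a ^ 'N)"
  have "linear (\<lambda>z :: 'a \<times> (real ^ 'N) \<times> ('a ^ 'N). \<Sum>n\<in>UNIV. fst (snd z) $ n * tderiv T (tderiv T (\<psi> n)) 0)"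
    by (rule linearI) (auto simp: distrib_right sum.distrib sum_distrib_left mult.assoc)
  then have dlin: "(\<lambda>z :: 'a \<times> (real ^ 'N) \<times> ('a ^ 'N). \<Sum>n\<in>UNIV. fst (snd z) $ n * tderiv T (tderiv T (\<psi> n)) 0) differentiable (at ?z)"
    by (rule linear_imp_differentiable)
  have dc: "c differentiable (at ?z)"
    unfolding c_def[abs_def]
    by (intro differentiable_divide differentiable_diff dlin differentiable_comp_fst laplacian_differentiable p)
      (use nz in \<open>auto intro: differentiable_comp_fst[where f = "\<lambda>x. F (x, p x, 0, grad p x)"] d0\<close>)
  have dG: "(\<lambda>z. integral {0..T} (\<lambda>t. F (L t z) * \<psi> m t)) differentiable (at ?z)"
    by (rule differentiable_parametric_integral[OF F lin contL cont(1)])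
  have "calF T \<psi> F p z $ m = c z * integral {0..T} (\<lambda>t. F (L t z) * \<psi> m t)" for z
  proof -
    have "continuous_on {0..T} (\<lambda>t. L t z)"
    proof -
      have "continuous_on {0..T} (\<lambda>t. (z, t))" by (intro continuous_intros)
      from continuous_on_compose2[OF contL this] show ?thesis by auto
    qed
    then have "continuous_on {0..T} (\<lambda>t. F (L t z) * \<psi> m t)"
      by (intro continuous_intros cont continuous_on_compose2[OF contF]) auto
    \<comment> \<open>\<open>calF\<close> uses the Lebesgue integral, the parametric lemma the gauge
      integral; for a continuous integrand on [0, T] the two coincide.\<close>
    then have i: "(LINT t:{0..T}|lebesgue. F (L t z) * \<psi> m t) = integral {0..T} (\<lambda>t. F (L t z) * \<psi> m t)"
      by (intro set_lebesgue_integral_eq_integral absolutely_integrable_continuous_real)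
    have "calF T \<psi> F p z $ m = (LINT t:{0..T}|lebesgue. c z * (F (L t z) * \<psi> m t))"
      by (simp add: calF_def case_prod_unfold c_def L_def mult.assoc)
    then show ?thesis using i by simp
  qed
  then have "(\<lambda>z. calF T \<psi> F p z $ m) = (\<lambda>z. c z * integral {0..T} (\<lambda>t. F (L t z) * \<psi> m t))"
    by (rule ext)
  then show "(\<lambda>z. calF T \<psi> F p z $ m) differentiable (at ?z)"
    using differentiable_mult[OF dc dG] by (simp only:)
qed

lemma C1_norm_boundD:
  assumes "C1_norm D G = M" "M < \<infinity>" "z \<in> D"
  shows "norm (G z) \<le> enn2real M" "onorm (frechet_derivative G (at z)) \<le> enn2real M"
proof -
  have M: "M = ennreal (enn2real M)" using assms(2) by simp
  have "ennreal (norm (G z)) \<le> (SUP z\<in>D. ennreal (norm (G z)))"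
    by (rule SUP_upper[OF assms(3)])
  also have "\<dots> \<le> M" unfolding assms(1)[symmetric] C1_norm_def by simp
  finally show "norm (G z) \<le> enn2real M"
    by (subst (asm) M) (simp add: ennreal_le_iff)
  have "ennreal (onorm (frechet_derivative G (at z))) \<le> (SUP z\<in>D. ennreal (onorm (frechet_derivative G (at z))))"
    by (rule SUP_upper[OF assms(3)])
  also have "\<dots> \<le> M" unfolding assms(1)[symmetric] C1_norm_def by simp
  finally show "onorm (frechet_derivative G (at z)) \<le> enn2real M"
    by (subst (asm) M) (simp add: ennreal_le_iff)
qed

text \<open>Both arguments share the point x, so the mean value inequality is used on the fibre over
  x, which is convex even when K is not. The Euclidean norm of the product then yields the sum of
  squares.\<close>

lemma C1_norm_Lipschitz:
  fixes G :: "'a::euclidean_space \<times> 'b::euclidean_space \<times> 'c::euclidean_space \<Rightarrow> 'd::euclidean_space"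
  assumes diff: "\<And>u P. G differentiable (at (x, u, P))"
    and M: "C1_norm (K \<times> UNIV \<times> UNIV) G = M" "M < \<infinity>" and "x \<in> K"
  shows "(norm (G (x, u, P) - G (x, v, Q)))\<^sup>2 \<le> (enn2real M)\<^sup>2 * ((norm (u - v))\<^sup>2 + (norm (P - Q))\<^sup>2)"
proof -
  let ?S = "{x} \<times> (UNIV :: 'b set) \<times> (UNIV :: 'c set)"
  have "norm (G (x, u, P) - G (x, v, Q)) \<le> enn2real M * norm ((x, u, P) - (x, v, Q))"
  proof (rule differentiable_bound[of ?S G "\<lambda>z. frechet_derivative G (at z)"])
    show "convex ?S" by (intro convex_Times) auto
    show "(G has_derivative frechet_derivative G (at z)) (at z within ?S)" if "z \<in> ?S" for z
      using diff that by (auto simp: frechet_derivative_works intro: has_derivative_at_withinI)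
    show "onorm (frechet_derivative G (at z)) \<le> enn2real M" if "z \<in> ?S" for z
      using that \<open>x \<in> K\<close> by (intro C1_norm_boundD[OF M]) auto
  qed auto
  then have "(norm (G (x, u, P) - G (x, v, Q)))\<^sup>2 \<le> (enn2real M * norm ((x, u, P) - (x, v, Q)))\<^sup>2"
    by (intro power_mono) auto
  also have "\<dots> = (enn2real M)\<^sup>2 * ((norm (u - v))\<^sup>2 + (norm (P - Q))\<^sup>2)"
    by (simp add: power_mult_distrib norm_Pair)
  finally show ?thesis .
qed

subsection \<open>Functions of class C^2 up to the boundary\<close>

text \<open>The regularity half of \<open>Hs\<close>, kept apart from the Sobolev half: the
  identities for gradients, Laplacians, boundary values and weighted integrals rest on it
  alone.\<close>

definition C2v :: "'a::euclidean_space set \<Rightarrow> ('a \<Rightarrow> real ^ 'N) \<Rightarrow> bool" where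
  "C2v \<Omega> U \<longleftrightarrow> (\<forall>n. C2_closure \<Omega> (\<lambda>x. U x $ n))"

lemma C2_closure_lincomb:
  assumes \<Omega>: "open \<Omega>" and u: "C2_closure \<Omega> u" and v: "C2_closure \<Omega> v"
  shows "C2_closure \<Omega> (\<lambda>x. u x + c * v x)"
  unfolding C2_closure_def
proof (intro conjI allI impI)
  have uv: "Ck_on 2 \<Omega> u" "Ck_on 2 \<Omega> v" using u v by (auto simp: C2_closure_def)
  then show "Ck_on 2 \<Omega> (\<lambda>x. u x + c * v x)" by (rule Ck_on_lincomb[OF \<Omega>])
  fix js :: "'a list" assume js: "set js \<subseteq> Basis \<and> length js \<le> 2"
  then obtain g g' where "continuous_on (closure \<Omega>) g" "\<forall>x\<in>\<Omega>. g x = iter_deriv u js x"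
    "continuous_on (closure \<Omega>) g'" "\<forall>x\<in>\<Omega>. g' x = iter_deriv v js x"
    using u v unfolding C2_closure_def by metis
  then show "\<exists>g. continuous_on (closure \<Omega>) g \<and> (\<forall>x\<in>\<Omega>. g x = iter_deriv (\<lambda>x. u x + c * v x) js x)"
    using iter_deriv_lincomb[OF \<Omega> uv, of js] js
    by (intro exI[of _ "\<lambda>x. g x + c * g' x"]) (auto intro!: continuous_intros)
qed

lemma grad_lincomb:
  assumes \<Omega>: "open \<Omega>" and "C2_closure \<Omega> u" "C2_closure \<Omega> v" "x \<in> \<Omega>"
  shows "grad (\<lambda>x. u x + c * v x) x = grad u x + c *\<^sub>R grad v x"
proof -
  have "frechet_derivative (\<lambda>x. u x + c * v x) (at x) i =
      frechet_derivative u (at x) i + c * frechet_derivative v (at x) i" if "i \<in> Basis" for i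
    using iter_deriv_lincomb[OF \<Omega>, of 2 u v "[i]" x c] assms that by (simp add: C2_closure_def)
  then show ?thesis
    by (simp add: grad_def scaleR_add_left sum.distrib scaleR_sum_right)
qed

lemma laplacian_lincomb:
  assumes \<Omega>: "open \<Omega>" and "C2_closure \<Omega> u" "C2_closure \<Omega> v" "x \<in> \<Omega>"
  shows "laplacian (\<lambda>x. u x + c * v x) x = laplacian u x + c * laplacian v x"
proof -
  have "iter_deriv (\<lambda>x. u x + c * v x) [i, i] x = iter_deriv u [i, i] x + c * iter_deriv v [i, i] x"
    if "i \<in> Basis" for i
    using assms that by (intro iter_deriv_lincomb[OF \<Omega>, of 2]) (auto simp: C2_closure_def)
  then show ?thesis
    unfolding laplacian_def by (simp add: sum.distrib sum_distrib_left del: iter_deriv.simps)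
qed

lemma C2v_add:
  assumes \<Omega>: "open \<Omega>" and UV: "C2v \<Omega> U" "C2v \<Omega> V"
  shows "C2v \<Omega> (\<lambda>x. U x + V x)"
    and "x \<in> \<Omega> \<Longrightarrow> vgrad (\<lambda>x. U x + V x) x = vgrad U x + vgrad V x"
    and "x \<in> \<Omega> \<Longrightarrow> vlaplacian (\<lambda>x. U x + V x) x = vlaplacian U x + vlaplacian V x"
proof -
  note C = UV[unfolded C2v_def, rule_format]
  show "C2v \<Omega> (\<lambda>x. U x + V x)"
    unfolding C2v_def using C2_closure_lincomb[OF \<Omega> C, where c = 1] by simp
  show "vgrad (\<lambda>x. U x + V x) x = vgrad U x + vgrad V x" if "x \<in> \<Omega>"
    using grad_lincomb[OF \<Omega> C that, where c = 1] by (simp add: vgrad_def vec_eq_iff)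
  show "vlaplacian (\<lambda>x. U x + V x) x = vlaplacian U x + vlaplacian V x" if "x \<in> \<Omega>"
    using laplacian_lincomb[OF \<Omega> C that, where c = 1] by (simp add: vlaplacian_def vec_eq_iff)
qed

lemma C2v_diff:
  assumes \<Omega>: "open \<Omega>" and UV: "C2v \<Omega> U" "C2v \<Omega> V"
  shows "C2v \<Omega> (\<lambda>x. U x - V x)"
    and "x \<in> \<Omega> \<Longrightarrow> vgrad (\<lambda>x. U x - V x) x = vgrad U x - vgrad V x"
    and "x \<in> \<Omega> \<Longrightarrow> vlaplacian (\<lambda>x. U x - V x) x = vlaplacian U x - vlaplacian V x"
proof -
  note C = UV[unfolded C2v_def, rule_format]
  show "C2v \<Omega> (\<lambda>x. U x - V x)"
    unfolding C2v_def using C2_closure_lincomb[OF \<Omega> C, where c = "-1"] by simp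
  show "vgrad (\<lambda>x. U x - V x) x = vgrad U x - vgrad V x" if "x \<in> \<Omega>"
    using grad_lincomb[OF \<Omega> C that, where c = "-1"] by (simp add: vgrad_def vec_eq_iff)
  show "vlaplacian (\<lambda>x. U x - V x) x = vlaplacian U x - vlaplacian V x" if "x \<in> \<Omega>"
    using laplacian_lincomb[OF \<Omega> C that, where c = "-1"] by (simp add: vlaplacian_def vec_eq_iff)
qed

lemma Hs_C2v: "U \<in> Hs s \<Omega> \<Longrightarrow> C2v \<Omega> U"
  by (auto simp: Hs_def C2v_def)

lemma Hs_add:
  assumes "open \<Omega>" "bounded \<Omega>" "U \<in> Hs s \<Omega>" "V \<in> Hs s \<Omega>"
  shows "(\<lambda>x. U x + V x) \<in> Hs s \<Omega>"
  using assms C2v_add(1)[OF assms(1) Hs_C2v Hs_C2v, of U s V s]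
  by (auto simp: Hs_def C2v_def intro: sobolev_add)

section \<open>Boundary values and Cauchy data as limits from inside the domain\<close>

lemma at_within_frontier_neq_bot:
  assumes "open \<Omega>" "x \<in> frontier \<Omega>"
  shows "at x within \<Omega> \<noteq> bot"
proof -
  have "x \<in> closure \<Omega>" "x \<notin> \<Omega>" using assms by (auto simp: frontier_def interior_open)
  then show ?thesis by (simp add: trivial_limit_within closure_def)
qed

lemma bdry_value_eqI:
  assumes "open \<Omega>" "x \<in> frontier \<Omega>" "(u \<longlongrightarrow> l) (at x within \<Omega>)"
  shows "bdry_value \<Omega> u x = l"
  unfolding bdry_value_def by (rule tendsto_Lim[OF at_within_frontier_neq_bot[OF assms(1,2)] assms(3)])

lemma tendsto_cong_within:
  assumes "\<And>y. y \<in> \<Omega> \<Longrightarrow> u y = v y"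
  shows "(u \<longlongrightarrow> l) (at x within \<Omega>) \<longleftrightarrow> (v \<longlongrightarrow> l) (at x within \<Omega>)"
  by (rule tendsto_cong) (use assms in \<open>auto simp: eventually_at_filter\<close>)

lemma tendsto_extension:
  assumes "x \<in> frontier \<Omega>" "continuous_on (closure \<Omega>) g" "\<forall>y\<in>\<Omega>. g y = u y"
  shows "(u \<longlongrightarrow> g x) (at x within \<Omega>)"
proof -
  have "(g \<longlongrightarrow> g x) (at x within closure \<Omega>)"
    using assms by (auto simp: continuous_on_def frontier_def)
  then have "(g \<longlongrightarrow> g x) (at x within \<Omega>)"
    using tendsto_within_subset closure_subset by blast
  then show ?thesis using tendsto_cong_within[of \<Omega> g u] assms(3) by auto
qed

text \<open>\<open>bdry_value\<close> is a \<open>Lim\<close>, meaningful only if a limit exists and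
  is unique. Existence comes from the continuous extensions in \<open>C2_closure\<close>, uniqueness
  from the fact that \<Omega> accumulates at its frontier.\<close>

lemma C2_closure_tendsto:
  assumes \<Omega>: "open \<Omega>" "x \<in> frontier \<Omega>" and u: "C2_closure \<Omega> u"
  shows "(u \<longlongrightarrow> bdry_value \<Omega> u x) (at x within \<Omega>)"
    and "(grad u \<longlongrightarrow> bdry_value \<Omega> (grad u) x) (at x within \<Omega>)"
proof -
  have lim: "\<exists>l. (iter_deriv u js \<longlongrightarrow> l) (at x within \<Omega>)" if "set js \<subseteq> Basis" "length js \<le> 2" for js
    using u that tendsto_extension[OF \<Omega>(2)] unfolding C2_closure_def by metis
  obtain l where l: "(u \<longlongrightarrow> l) (at x within \<Omega>)"
    using lim[of "[]"] by auto
  then show "(u \<longlongrightarrow> bdry_value \<Omega> u x) (at x within \<Omega>)"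
    using bdry_value_eqI[OF \<Omega> l] by simp
  have "\<forall>i\<in>Basis. \<exists>l. (iter_deriv u [i] \<longlongrightarrow> l) (at x within \<Omega>)"
    by (intro ballI lim) auto
  then obtain k where "\<And>i. i \<in> Basis \<Longrightarrow> (iter_deriv u [i] \<longlongrightarrow> k i) (at x within \<Omega>)"
    by metis
  then have "((\<lambda>y. \<Sum>i\<in>Basis. iter_deriv u [i] y *\<^sub>R i) \<longlongrightarrow> (\<Sum>i\<in>Basis. k i *\<^sub>R i)) (at x within \<Omega>)"
    by (intro tendsto_intros) auto
  then have g: "(grad u \<longlongrightarrow> (\<Sum>i\<in>Basis. k i *\<^sub>R i)) (at x within \<Omega>)"
    by (simp add: grad_def[abs_def])
  then show "(grad u \<longlongrightarrow> bdry_value \<Omega> (grad u) x) (at x within \<Omega>)"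
    using bdry_value_eqI[OF \<Omega> g] by simp
qed

lemma bdry_value_lincomb:
  assumes \<Omega>: "open \<Omega>" "x \<in> frontier \<Omega>" and u: "C2_closure \<Omega> u" and v: "C2_closure \<Omega> v"
  shows "bdry_value \<Omega> (\<lambda>x. u x + c * v x) x = bdry_value \<Omega> u x + c * bdry_value \<Omega> v x"
    and "normal_deriv \<Omega> \<nu> (\<lambda>x. u x + c * v x) x = normal_deriv \<Omega> \<nu> u x + c * normal_deriv \<Omega> \<nu> v x"
proof -
  show "bdry_value \<Omega> (\<lambda>x. u x + c * v x) x = bdry_value \<Omega> u x + c * bdry_value \<Omega> v x"
    by (rule bdry_value_eqI[OF \<Omega>]) (intro tendsto_intros C2_closure_tendsto \<Omega> u v)
  \<comment> \<open>Linearity of the gradient is known at points of \<Omega>; the limit is taken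
    within \<Omega>, so this suffices.\<close>
  have "(grad (\<lambda>x. u x + c * v x) \<longlongrightarrow> bdry_value \<Omega> (grad u) x + c *\<^sub>R bdry_value \<Omega> (grad v) x) (at x within \<Omega>)"
    by (subst tendsto_cong_within[OF grad_lincomb[OF \<Omega>(1) u v]], assumption, intro tendsto_intros C2_closure_tendsto \<Omega> u v)
  from bdry_value_eqI[OF \<Omega> this]
  show "normal_deriv \<Omega> \<nu> (\<lambda>x. u x + c * v x) x = normal_deriv \<Omega> \<nu> u x + c * normal_deriv \<Omega> \<nu> v x"
    by (simp add: normal_deriv_def inner_add_left)
qed

text \<open>\<open>Hs_cauchy\<close> prescribes a limit of vectors, while the Carleman estimate
  speaks of scalar functions; this passes between the two.\<close>

lemma bdry_value_component:
  fixes U :: "'a::euclidean_space \<Rightarrow> real ^ 'N::finite"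
  assumes \<Omega>: "open \<Omega>" "x \<in> frontier \<Omega>" and U: "C2v \<Omega> U"
  shows "bdry_value \<Omega> U x $ n = bdry_value \<Omega> (\<lambda>x. U x $ n) x"
proof -
  have "(U \<longlongrightarrow> (\<chi> n. bdry_value \<Omega> (\<lambda>x. U x $ n) x)) (at x within \<Omega>)"
    by (rule vec_tendstoI) (use C2_closure_tendsto(1)[OF \<Omega>] U in \<open>auto simp: C2v_def\<close>)
  from bdry_value_eqI[OF \<Omega> this] show ?thesis by simp
qed

lemma Hs_cauchy_add:
  fixes U V :: "'a::euclidean_space \<Rightarrow> real ^ 'N::finite"
  assumes \<Omega>: "open \<Omega>" "bounded \<Omega>"
    and UV: "U \<in> Hs_cauchy s \<Omega> \<nu> \<phi> \<gamma>" "V \<in> Hs_cauchy s \<Omega> \<nu> \<phi>' \<gamma>'"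
  shows "(\<lambda>x. U x + V x) \<in> Hs_cauchy s \<Omega> \<nu> (\<lambda>x. \<phi> x + \<phi>' x) (\<lambda>x. \<gamma> x + \<gamma>' x)"
proof -
  have H: "U \<in> Hs s \<Omega>" "V \<in> Hs s \<Omega>" using UV by (auto simp: Hs_cauchy_def)
  note C = Hs_C2v[OF H(1)] Hs_C2v[OF H(2)]
  note c = C[unfolded C2v_def, rule_format]
  have "bdry_value \<Omega> (\<lambda>x. U x + V x) x = \<phi> x + \<phi>' x \<and>
    vnormal_deriv \<Omega> \<nu> (\<lambda>x. U x + V x) x = \<gamma> x + \<gamma>' x" if x: "x \<in> frontier \<Omega>" for x
  proof -
    have "bdry_value \<Omega> (\<lambda>x. U x + V x) x $ n = (bdry_value \<Omega> U x + bdry_value \<Omega> V x) $ n" for n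
      using bdry_value_lincomb(1)[OF \<Omega>(1) x c, where c = 1]
      by (simp add: bdry_value_component[OF \<Omega>(1) x] C C2v_add(1)[OF \<Omega>(1) C])
    moreover have "vnormal_deriv \<Omega> \<nu> (\<lambda>x. U x + V x) x $ n =
        (vnormal_deriv \<Omega> \<nu> U x + vnormal_deriv \<Omega> \<nu> V x) $ n" for n
      using bdry_value_lincomb(2)[OF \<Omega>(1) x c, where c = 1] by (simp add: vnormal_deriv_def)
    ultimately show ?thesis
      using UV x by (auto simp: Hs_cauchy_def vec_eq_iff)
  qed
  then show ?thesis
    using Hs_add[OF \<Omega> H] by (auto simp: Hs_cauchy_def)
qed

text \<open>Stated component by component, so that each component meets the hypothesis of the scalar
  Carleman estimate.\<close>

definition zero_cauchy :: "'a::euclidean_space set \<Rightarrow> ('a \<Rightarrow> 'a) \<Rightarrow> ('a \<Rightarrow> real ^ 'N) \<Rightarrow> bool" where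
  "zero_cauchy \<Omega> \<nu> h \<longleftrightarrow> C2v \<Omega> h \<and> (\<forall>n. \<forall>x\<in>frontier \<Omega>.
     bdry_value \<Omega> (\<lambda>x. h x $ n) x = 0 \<and> normal_deriv \<Omega> \<nu> (\<lambda>x. h x $ n) x = 0)"

lemma zero_cauchy_diff:
  fixes U V :: "'a::euclidean_space \<Rightarrow> real ^ 'N::finite"
  assumes \<Omega>: "open \<Omega>" and UV: "U \<in> Hs_cauchy s \<Omega> \<nu> \<phi> \<gamma>" "V \<in> Hs_cauchy s \<Omega> \<nu> \<phi> \<gamma>"
  shows "zero_cauchy \<Omega> \<nu> (\<lambda>x. U x - V x)"
proof -
  have C: "C2v \<Omega> U" "C2v \<Omega> V" using UV Hs_C2v by (auto simp: Hs_cauchy_def)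
  note c = C[unfolded C2v_def, rule_format]
  have "bdry_value \<Omega> (\<lambda>x. (U x - V x) $ n) x = 0 \<and> normal_deriv \<Omega> \<nu> (\<lambda>x. (U x - V x) $ n) x = 0"
    if x: "x \<in> frontier \<Omega>" for x n
  proof -
    have "bdry_value \<Omega> U x $ n = bdry_value \<Omega> V x $ n" "vnormal_deriv \<Omega> \<nu> U x $ n = vnormal_deriv \<Omega> \<nu> V x $ n"
      using UV x by (auto simp: Hs_cauchy_def)
    then show ?thesis
      using bdry_value_lincomb[OF \<Omega> x c, where c = "-1"]
      by (simp add: bdry_value_component[OF \<Omega> x] C vnormal_deriv_def)
  qed
  then show ?thesis using C2v_diff(1)[OF \<Omega> C] by (auto simp: zero_cauchy_def)
qed

subsection \<open>Weighted integrals\<close>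

text \<open>The working class of integrands: on a bounded open set, with a continuous bounded
  weight, their weighted products are integrable, which makes \<open>wint\<close> additive and
  monotone on them.\<close>

definition bcont_on :: "'a::euclidean_space set \<Rightarrow> ('a \<Rightarrow> 'b::real_normed_vector) \<Rightarrow> bool" where
  "bcont_on \<Omega> q \<longleftrightarrow> continuous_on \<Omega> q \<and> bounded (q ` \<Omega>)"

lemma bcont_on_add: "bcont_on \<Omega> f \<Longrightarrow> bcont_on \<Omega> g \<Longrightarrow> bcont_on \<Omega> (\<lambda>x. f x + g x)"
  by (auto simp: bcont_on_def intro: continuous_intros bounded_plus_comp)

lemma bcont_on_diff: "bcont_on \<Omega> f \<Longrightarrow> bcont_on \<Omega> g \<Longrightarrow> bcont_on \<Omega> (\<lambda>x. f x - g x)"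
  by (auto simp: bcont_on_def intro: continuous_intros bounded_minus_comp)

lemma bcont_on_bounded_linear:
  assumes "bounded_linear T" "bcont_on \<Omega> f"
  shows "bcont_on \<Omega> (\<lambda>x. T (f x))"
  using assms bounded_linear_image[OF _ assms(1), of "f ` \<Omega>"]
  by (auto simp: bcont_on_def image_image intro: bounded_linear.continuous_on)

lemma bcont_on_norm_sq:
  assumes "bcont_on \<Omega> f"
  shows "bcont_on \<Omega> (\<lambda>x. (norm (f x))\<^sup>2)"
proof -
  obtain B where "\<And>x. x \<in> \<Omega> \<Longrightarrow> norm (f x) \<le> B"
    using assms by (auto simp: bcont_on_def bounded_iff)
  then have "bounded ((\<lambda>x. (norm (f x))\<^sup>2) ` \<Omega>)"
    by (auto simp: bounded_iff intro!: exI[of _ "B\<^sup>2"] power_mono)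
  then show ?thesis using assms by (auto simp: bcont_on_def intro: continuous_intros)
qed

lemma bcont_on_cmult: "bcont_on \<Omega> f \<Longrightarrow> bcont_on \<Omega> (\<lambda>x. c * f x :: real)"
  by (rule bcont_on_bounded_linear[OF bounded_linear_mult_right])

lemma bcont_on_sum:
  "(\<And>i. i \<in> I \<Longrightarrow> bcont_on \<Omega> (f i)) \<Longrightarrow> bcont_on \<Omega> (\<lambda>x. \<Sum>i\<in>I. f i x)"
proof (induction I rule: infinite_finite_induct)
  case (insert i I)
  then show ?case by (auto intro: bcont_on_add)
qed (auto simp: bcont_on_def bounded_iff)

lemma bcont_on_vec:
  fixes f :: "'a::euclidean_space \<Rightarrow> 'b::euclidean_space ^ 'N::finite"
  assumes "\<And>n. bcont_on \<Omega> (\<lambda>x. f x $ n)"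
  shows "bcont_on \<Omega> f"
proof -
  have "\<exists>B. \<forall>x\<in>\<Omega>. norm (f x $ n) \<le> B" for n
    using assms[of n] by (auto simp: bcont_on_def bounded_iff)
  then obtain B where B: "\<And>n x. x \<in> \<Omega> \<Longrightarrow> norm (f x $ n) \<le> B n" by metis
  have "norm (f x) \<le> (\<Sum>n\<in>UNIV. B n)" if "x \<in> \<Omega>" for x
  proof -
    have "norm (f x) \<le> (\<Sum>n\<in>UNIV. norm (f x $ n))"
      unfolding norm_vec_def by (rule L2_set_le_sum) simp
    also have "\<dots> \<le> (\<Sum>n\<in>UNIV. B n)" by (intro sum_mono B that)
    finally show ?thesis .
  qed
  then have "bounded (f ` \<Omega>)" by (auto simp: bounded_iff)
  moreover have "continuous_on \<Omega> (\<lambda>x. \<chi> n. f x $ n)"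
    using assms by (intro continuous_on_vec_lambda) (auto simp: bcont_on_def)
  ultimately show ?thesis by (simp add: bcont_on_def)
qed

lemma bcont_on_extension:
  fixes u :: "'a::euclidean_space \<Rightarrow> real"
  assumes "bounded \<Omega>" "continuous_on (closure \<Omega>) g" "\<forall>x\<in>\<Omega>. g x = u x"
  shows "bcont_on \<Omega> u"
proof -
  have "bounded (g ` closure \<Omega>)"
    using assms by (intro compact_imp_bounded compact_continuous_image) auto
  then have "bounded (g ` \<Omega>)" using closure_subset by (rule bounded_subset[OF _ image_mono])
  moreover have "g ` \<Omega> = u ` \<Omega>" using assms(3) by (intro image_cong) auto
  moreover have "continuous_on \<Omega> g" using assms(2) closure_subset continuous_on_subset by blast
  ultimately show ?thesis using assms(3) by (auto simp: bcont_on_def cong: continuous_on_cong)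
qed

lemma C2_closure_bcont:
  assumes "bounded \<Omega>" "C2_closure \<Omega> u"
  shows "bcont_on \<Omega> u" "bcont_on \<Omega> (grad u)" "bcont_on \<Omega> (laplacian u)"
proof -
  have *: "bcont_on \<Omega> (iter_deriv u js)" if "set js \<subseteq> Basis" "length js \<le> 2" for js
    using assms(2) that bcont_on_extension[OF assms(1)] unfolding C2_closure_def by metis
  show "bcont_on \<Omega> u" using *[of "[]"] by simp
  have "bcont_on \<Omega> (\<lambda>x. \<Sum>i\<in>Basis. iter_deriv u [i] x *\<^sub>R i)"
    by (intro bcont_on_sum bcont_on_bounded_linear[OF bounded_linear_scaleR_left] *) auto
  then show "bcont_on \<Omega> (grad u)" by (simp add: grad_def[abs_def])
  show "bcont_on \<Omega> (laplacian u)"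
    unfolding laplacian_def[abs_def] by (intro bcont_on_sum *) auto
qed

lemma C2v_bcont:
  fixes U :: "'a::euclidean_space \<Rightarrow> real ^ 'N::finite"
  assumes "bounded \<Omega>" "C2v \<Omega> U"
  shows "bcont_on \<Omega> U" "bcont_on \<Omega> (vgrad U)" "bcont_on \<Omega> (vlaplacian U)"
  using assms C2_closure_bcont[OF assms(1)]
  by (auto simp: vgrad_def vlaplacian_def C2v_def intro!: bcont_on_vec)

lemma norm_vec_sq: "(norm (v :: 'b::real_normed_vector ^ 'N::finite))\<^sup>2 = (\<Sum>n\<in>UNIV. (norm (v $ n))\<^sup>2)"
  by (simp add: norm_vec_def L2_set_def sum_nonneg)

lemma norm_add_sq_le: "(norm (x + y))\<^sup>2 \<le> 2 * (norm x)\<^sup>2 + 2 * (norm (y :: 'b::real_normed_vector))\<^sup>2"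
proof -
  have "(norm (x + y))\<^sup>2 \<le> (norm x + norm y)\<^sup>2"
    by (intro power_mono norm_triangle_ineq) simp
  also have "\<dots> \<le> 2 * (norm x)\<^sup>2 + 2 * (norm y)\<^sup>2" by (rule sum_sq_le)
  finally show ?thesis .
qed

lemma norm_diff_sq_le: "(norm (x - y))\<^sup>2 \<le> 2 * (norm x)\<^sup>2 + 2 * (norm (y :: 'b::real_normed_vector))\<^sup>2"
  using norm_add_sq_le[of x "- y"] by simp

text \<open>On \<Omega> the ratio r stays below 1, so for \<lambda> \<ge> 0 the weight lies there
  between 1 and exp (2 \<lambda>). These two bounds give integrability and make the weights for
  different \<lambda> comparable.\<close>

locale weighted_domain =
  fixes \<Omega> :: "'a::euclidean_space set" and x0 :: 'a and b \<beta> :: real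
  assumes open_domain: "open \<Omega>" and bounded_domain: "bounded \<Omega>"
    and in_ball: "\<And>x. x \<in> \<Omega> \<Longrightarrow> norm (x - x0) < b"
    and b_pos: "b > 0" and \<beta>_pos: "\<beta> > 0"
begin

lemma weight_pos: "0 < carleman_weight x0 b lam \<beta> x"
  by (simp add: carleman_weight_def)

lemma powr_le_1: "x \<in> \<Omega> \<Longrightarrow> (norm (x - x0) / b) powr \<beta> \<le> 1"
  using in_ball[of x] b_pos \<beta>_pos by (intro powr_le1) auto

lemma weight_mono:
  assumes "x \<in> \<Omega>" "lam \<le> lam'"
  shows "carleman_weight x0 b lam \<beta> x \<le> carleman_weight x0 b lam' \<beta> x"
  using assms by (auto simp: carleman_weight_def intro: mult_right_mono)

lemma weight_le:
  assumes "x \<in> \<Omega>" "0 \<le> lam"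
  shows "carleman_weight x0 b lam \<beta> x \<le> exp (2 * lam)"
  using mult_left_mono[OF powr_le_1[OF assms(1)], of "2 * lam"] assms(2)
  by (simp add: carleman_weight_def)

lemma weight_ge_1: "0 \<le> lam \<Longrightarrow> 1 \<le> carleman_weight x0 b lam \<beta> x"
  by (simp add: carleman_weight_def)

lemma continuous_on_weight: "continuous_on \<Omega> (carleman_weight x0 b lam \<beta>)"
  unfolding carleman_weight_def[abs_def]
  using \<beta>_pos b_pos by (intro continuous_intros continuous_on_powr') auto

lemma wint_integrable:
  assumes "bcont_on \<Omega> q" "0 \<le> lam"
  shows "set_integrable lebesgue \<Omega> (\<lambda>x. carleman_weight x0 b lam \<beta> x * q x)"
proof -
  obtain B where B: "\<And>x. x \<in> \<Omega> \<Longrightarrow> norm (q x) \<le> B"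
    using assms by (auto simp: bcont_on_def bounded_iff)
  have "\<bar>carleman_weight x0 b lam \<beta> x * q x\<bar> \<le> \<bar>exp (2 * lam) * B\<bar>" if "x \<in> \<Omega>" for x
  proof -
    have "\<bar>carleman_weight x0 b lam \<beta> x * q x\<bar> \<le> exp (2 * lam) * B"
      unfolding abs_mult using weight_le[OF that assms(2)] weight_pos[of lam x] B[OF that]
      by (intro mult_mono) auto
    then show ?thesis by linarith
  qed
  moreover have "set_borel_measurable lebesgue \<Omega> (\<lambda>x. carleman_weight x0 b lam \<beta> x * q x)"
    using assms by (intro continuous_on_set_borel_measurable_lebesgue open_domain continuous_on_mult
        continuous_on_weight) (auto simp: bcont_on_def)
  ultimately show ?thesis
    by (intro set_integrable_bound[OF set_integrable_const_bounded[OF open_domain bounded_domain,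
            of "exp (2 * lam) * B"]]) auto
qed

lemma wint_add:
  assumes "bcont_on \<Omega> q" "bcont_on \<Omega> q'" "0 \<le> lam"
  shows "wint \<Omega> x0 b lam \<beta> (\<lambda>x. q x + q' x) = wint \<Omega> x0 b lam \<beta> q + wint \<Omega> x0 b lam \<beta> q'"
  unfolding wint_def distrib_left using assms by (intro set_integral_add wint_integrable)

lemma wint_cmult: "wint \<Omega> x0 b lam \<beta> (\<lambda>x. c * q x) = c * wint \<Omega> x0 b lam \<beta> q"
  unfolding wint_def by (simp add: mult.left_commute)

lemma wint_mono:
  assumes "bcont_on \<Omega> q" "bcont_on \<Omega> q'" "0 \<le> lam" "\<And>x. x \<in> \<Omega> \<Longrightarrow> q x \<le> q' x"
  shows "wint \<Omega> x0 b lam \<beta> q \<le> wint \<Omega> x0 b lam \<beta> q'"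
  unfolding wint_def
  using assms weight_pos by (intro set_integral_mono wint_integrable) (auto intro: mult_left_mono less_imp_le)

lemma wint_nonneg:
  assumes "\<And>x. x \<in> \<Omega> \<Longrightarrow> 0 \<le> q x"
  shows "0 \<le> wint \<Omega> x0 b lam \<beta> q"
  unfolding wint_def set_lebesgue_integral_def
  using assms weight_pos[THEN less_imp_le]
  by (intro Bochner_Integration.integral_nonneg) (auto simp: indicator_def)

lemma wint_sum:
  assumes "\<And>i. i \<in> I \<Longrightarrow> bcont_on \<Omega> (q i)" "0 \<le> lam"
  shows "wint \<Omega> x0 b lam \<beta> (\<lambda>x. \<Sum>i\<in>I. q i x) = (\<Sum>i\<in>I. wint \<Omega> x0 b lam \<beta> (q i))"
  using assms(1)
proof (induction I rule: infinite_finite_induct)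
  case (insert i I)
  then show ?case using wint_add[of "q i" "\<lambda>x. \<Sum>i\<in>I. q i x" lam] assms(2) by (simp add: bcont_on_sum)
qed (auto simp: wint_def)

text \<open>For the second bound, the weight at \<open>lam'\<close> is at most exp (2
  \<open>lam'\<close>), and the weight at \<open>lam\<close> is at least 1, so inserting it as a
  further factor only increases the right side.\<close>

lemma wint_weight_mono:
  assumes q: "bcont_on \<Omega> q" and nonneg: "\<And>x. x \<in> \<Omega> \<Longrightarrow> 0 \<le> q x" and lam: "0 \<le> lam" "lam \<le> lam'"
  shows "wint \<Omega> x0 b lam \<beta> q \<le> wint \<Omega> x0 b lam' \<beta> q"
    and "wint \<Omega> x0 b lam' \<beta> q \<le> exp (2 * lam') * wint \<Omega> x0 b lam \<beta> q"
proof -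
  show "wint \<Omega> x0 b lam \<beta> q \<le> wint \<Omega> x0 b lam' \<beta> q"
    unfolding wint_def using q lam nonneg
    by (intro set_integral_mono wint_integrable) (auto intro: mult_right_mono weight_mono)
  have le: "carleman_weight x0 b lam' \<beta> x * q x \<le> carleman_weight x0 b lam \<beta> x * (exp (2 * lam') * q x)"
    if "x \<in> \<Omega>" for x
  proof -
    have "carleman_weight x0 b lam' \<beta> x * q x \<le> 1 * (exp (2 * lam') * q x)"
      using weight_le[OF that, of lam'] lam nonneg[OF that] by (auto intro: mult_right_mono)
    also have "\<dots> \<le> carleman_weight x0 b lam \<beta> x * (exp (2 * lam') * q x)"
      using weight_ge_1[of lam x] lam nonneg[OF that] by (intro mult_right_mono) auto
    finally show ?thesis .
  qed
  have "wint \<Omega> x0 b lam' \<beta> q \<le> wint \<Omega> x0 b lam \<beta> (\<lambda>x. exp (2 * lam') * q x)"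
    unfolding wint_def using q lam le
    by (intro set_integral_mono wint_integrable bcont_on_cmult) auto
  then show "wint \<Omega> x0 b lam' \<beta> q \<le> exp (2 * lam') * wint \<Omega> x0 b lam \<beta> q"
    by (simp add: wint_cmult)
qed

end

subsection \<open>The contraction estimate\<close>

context weighted_domain
begin

lemma wH1_eq:
  fixes W :: "'a \<Rightarrow> real ^ 'N::finite"
  assumes "C2v \<Omega> W" "0 \<le> lam"
  shows "wH1 \<Omega> x0 b lam \<beta> W =
    wint \<Omega> x0 b lam \<beta> (\<lambda>x. (norm (W x))\<^sup>2) + wint \<Omega> x0 b lam \<beta> (\<lambda>x. (norm (vgrad W x))\<^sup>2)"
  unfolding wH1_def
  using assms by (intro wint_add bcont_on_norm_sq C2v_bcont bounded_domain)

lemma bcont_on_wH1_integrand: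
  fixes W :: "'a \<Rightarrow> real ^ 'N::finite"
  assumes "C2v \<Omega> W"
  shows "bcont_on \<Omega> (\<lambda>x. (norm (W x))\<^sup>2 + (norm (vgrad W x))\<^sup>2)"
    and "bcont_on \<Omega> (\<lambda>x. (norm (W x))\<^sup>2 + (norm (vgrad W x))\<^sup>2 + (norm (vlaplacian W x))\<^sup>2)"
proof -
  show 1: "bcont_on \<Omega> (\<lambda>x. (norm (W x))\<^sup>2 + (norm (vgrad W x))\<^sup>2)"
    using assms by (intro bcont_on_add bcont_on_norm_sq C2v_bcont bounded_domain)
  show "bcont_on \<Omega> (\<lambda>x. (norm (W x))\<^sup>2 + (norm (vgrad W x))\<^sup>2 + (norm (vlaplacian W x))\<^sup>2)"
    using assms by (intro bcont_on_add[OF 1] bcont_on_norm_sq C2v_bcont bounded_domain)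
qed

text \<open>The scalar estimate is summed over the components. Since the integrals it multiplies are
  nonnegative, c may be lowered to 1.\<close>

lemma carleman_vector:
  fixes h :: "'a \<Rightarrow> real ^ 'N::finite"
  assumes carl: "\<And>h. C2_closure \<Omega> h \<Longrightarrow>
      (\<forall>x\<in>frontier \<Omega>. bdry_value \<Omega> h x = 0 \<and> normal_deriv \<Omega> \<nu> h x = 0) \<Longrightarrow>
      c * lam * wint \<Omega> x0 b lam \<beta> (\<lambda>x. (norm (grad h x))\<^sup>2) + c * lam ^ 3 * wint \<Omega> x0 b lam \<beta> (\<lambda>x. (h x)\<^sup>2)
      \<le> wint \<Omega> x0 b lam \<beta> (\<lambda>x. (laplacian h x)\<^sup>2)"
    and c: "1 \<le> c" and lam: "0 \<le> lam" and h: "zero_cauchy \<Omega> \<nu> h"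
  shows "lam * wint \<Omega> x0 b lam \<beta> (\<lambda>x. (norm (vgrad h x))\<^sup>2) + lam ^ 3 * wint \<Omega> x0 b lam \<beta> (\<lambda>x. (norm (h x))\<^sup>2)
      \<le> wint \<Omega> x0 b lam \<beta> (\<lambda>x. (norm (vlaplacian h x))\<^sup>2)"
proof -
  have C: "C2_closure \<Omega> (\<lambda>x. h x $ n)" for n using h by (auto simp: zero_cauchy_def C2v_def)
  note bc = C2_closure_bcont[OF bounded_domain C]
  have bc_sq: "bcont_on \<Omega> (\<lambda>x. (h x $ n)\<^sup>2)" "bcont_on \<Omega> (\<lambda>x. (norm (grad (\<lambda>x. h x $ n) x))\<^sup>2)"
    "bcont_on \<Omega> (\<lambda>x. (laplacian (\<lambda>x. h x $ n) x)\<^sup>2)" for n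
    using bcont_on_norm_sq[OF bc(1)] bcont_on_norm_sq[OF bc(2)] bcont_on_norm_sq[OF bc(3)] by simp_all
  let ?w = "wint \<Omega> x0 b lam \<beta>"
  have "lam * ?w (\<lambda>x. (norm (grad (\<lambda>x. h x $ n) x))\<^sup>2) + lam ^ 3 * ?w (\<lambda>x. (h x $ n)\<^sup>2)
      \<le> ?w (\<lambda>x. (laplacian (\<lambda>x. h x $ n) x)\<^sup>2)" for n
  proof -
    have "1 * (lam * ?w (\<lambda>x. (norm (grad (\<lambda>x. h x $ n) x))\<^sup>2)) + 1 * (lam ^ 3 * ?w (\<lambda>x. (h x $ n)\<^sup>2)) \<le>
        c * (lam * ?w (\<lambda>x. (norm (grad (\<lambda>x. h x $ n) x))\<^sup>2)) + c * (lam ^ 3 * ?w (\<lambda>x. (h x $ n)\<^sup>2))"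
      using c lam by (intro add_mono mult_right_mono mult_nonneg_nonneg wint_nonneg) auto
    also have "\<dots> \<le> ?w (\<lambda>x. (laplacian (\<lambda>x. h x $ n) x)\<^sup>2)"
      using carl[OF C] h by (auto simp: zero_cauchy_def mult.assoc)
    finally show ?thesis by simp
  qed
  then have "(\<Sum>n\<in>UNIV. lam * ?w (\<lambda>x. (norm (grad (\<lambda>x. h x $ n) x))\<^sup>2) + lam ^ 3 * ?w (\<lambda>x. (h x $ n)\<^sup>2))
      \<le> (\<Sum>n\<in>UNIV. ?w (\<lambda>x. (laplacian (\<lambda>x. h x $ n) x)\<^sup>2))"
    by (intro sum_mono)
  then show ?thesis
    using bc_sq lam by (simp add: norm_vec_sq vgrad_def vlaplacian_def wint_sum sum.distrib sum_distrib_left)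
qed

text \<open>The term \<open>S h\<close> is absorbed by the \<open>\<lambda>\<^sup>3\<close> term of the Carleman estimate once \<open>\<lambda>\<close> is large.\<close>

lemma carleman_perturbed:
  fixes h :: "'a \<Rightarrow> real ^ 'N::finite" and S :: "real ^ 'N ^ 'N"
  assumes carl: "lam * wint \<Omega> x0 b lam \<beta> (\<lambda>x. (norm (vgrad h x))\<^sup>2)
        + lam ^ 3 * wint \<Omega> x0 b lam \<beta> (\<lambda>x. (norm (h x))\<^sup>2)
      \<le> wint \<Omega> x0 b lam \<beta> (\<lambda>x. (norm (vlaplacian h x))\<^sup>2)"
    and S: "\<And>v. (norm (S *v v))\<^sup>2 \<le> \<sigma> * (norm v)\<^sup>2" and "0 \<le> \<sigma>" "1 + 2 * \<sigma> \<le> lam"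
    and h: "C2v \<Omega> h"
  shows "lam * wH1 \<Omega> x0 b lam \<beta> h \<le> 2 * wint \<Omega> x0 b lam \<beta> (\<lambda>x. (norm (vlaplacian h x - S *v h x))\<^sup>2)"
proof -
  let ?w = "wint \<Omega> x0 b lam \<beta>"
  have lam: "1 \<le> lam" using assms by simp
  note bc = C2v_bcont[OF bounded_domain h]
  have bcL: "bcont_on \<Omega> (\<lambda>x. vlaplacian h x - S *v h x)"
    by (intro bcont_on_diff bc bcont_on_bounded_linear[OF matrix_vector_mul_bounded_linear])
  have pt: "(norm (vlaplacian h x))\<^sup>2 \<le> 2 * (norm (vlaplacian h x - S *v h x))\<^sup>2 + (2 * \<sigma>) * (norm (h x))\<^sup>2" for x
    using norm_add_sq_le[of "vlaplacian h x - S *v h x" "S *v h x"] S[of "h x"] by simp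
  have "?w (\<lambda>x. (norm (vlaplacian h x))\<^sup>2) \<le>
      ?w (\<lambda>x. 2 * (norm (vlaplacian h x - S *v h x))\<^sup>2 + (2 * \<sigma>) * (norm (h x))\<^sup>2)"
    using lam by (intro wint_mono pt bcont_on_add bcont_on_cmult bcont_on_norm_sq bc bcL) auto
  also have "\<dots> = 2 * ?w (\<lambda>x. (norm (vlaplacian h x - S *v h x))\<^sup>2) + (2 * \<sigma>) * ?w (\<lambda>x. (norm (h x))\<^sup>2)"
    using lam by (subst wint_add) (auto simp: wint_cmult intro!: bcont_on_cmult bcont_on_norm_sq bc bcL)
  finally have 1: "?w (\<lambda>x. (norm (vlaplacian h x))\<^sup>2) \<le> \<dots>" .
  \<comment> \<open>The product equals \<lambda>^3 - 2 \<lambda> + 1, so \<lambda>^3 \<ge> \<lambda>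
    + (\<lambda> - 1) \<ge> \<lambda> + 2 \<sigma>. The part 2 \<sigma> pays for S h; the remaining
    \<lambda> matches the coefficient of the gradient term.\<close>
  have "0 \<le> (lam - 1) * (lam\<^sup>2 + lam - 1)"
    using lam one_le_power[OF lam, of 2] by (intro mult_nonneg_nonneg) linarith+
  then have "lam + 2 * \<sigma> \<le> lam ^ 3"
    using \<open>1 + 2 * \<sigma> \<le> lam\<close> by (simp add: algebra_simps power2_eq_square power3_eq_cube)
  then have "(lam + 2 * \<sigma>) * ?w (\<lambda>x. (norm (h x))\<^sup>2) \<le> lam ^ 3 * ?w (\<lambda>x. (norm (h x))\<^sup>2)"
    by (intro mult_right_mono wint_nonneg) auto
  then show ?thesis
    using carl 1 lam by (simp add: wH1_eq[OF h] algebra_simps)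
qed

text \<open>For \<open>\<lambda>\<close> below the absorption threshold \<open>\<Lambda>\<close> the estimate at \<open>\<Lambda>\<close> is transferred: the weights
  for \<open>\<lambda>\<close> and \<open>\<Lambda>\<close> are comparable up to the factor \<open>exp (2 \<Lambda>)\<close>.\<close>

lemma carleman_perturbed_uniform:
  fixes S :: "real ^ 'N::finite ^ 'N"
  assumes carl: "\<And>lam h. l0 \<le> lam \<Longrightarrow> zero_cauchy \<Omega> \<nu> (h :: 'a \<Rightarrow> real ^ 'N) \<Longrightarrow>
      lam * wint \<Omega> x0 b lam \<beta> (\<lambda>x. (norm (vgrad h x))\<^sup>2)
        + lam ^ 3 * wint \<Omega> x0 b lam \<beta> (\<lambda>x. (norm (h x))\<^sup>2)
      \<le> wint \<Omega> x0 b lam \<beta> (\<lambda>x. (norm (vlaplacian h x))\<^sup>2)"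
    and S: "\<And>v. (norm (S *v v))\<^sup>2 \<le> \<sigma> * (norm v)\<^sup>2" and "0 \<le> \<sigma>" "1 < l0"
  shows "\<exists>K>0. \<forall>lam>l0. \<forall>h. zero_cauchy \<Omega> \<nu> h \<longrightarrow>
    wH1 \<Omega> x0 b lam \<beta> h \<le> K / lam * wint \<Omega> x0 b lam \<beta> (\<lambda>x. (norm (vlaplacian h x - S *v h x))\<^sup>2)"
proof -
  define \<Lambda> where "\<Lambda> = max l0 (1 + 2 * \<sigma>)"
  \<comment> \<open>The 2 comes from \<open>carleman_perturbed\<close>, the exponential from
    returning from the weight at \<Lambda> to that at a smaller \<lambda>.\<close>
  define K where "K = 2 * exp (2 * \<Lambda>)"
  have \<Lambda>: "1 < \<Lambda>" "l0 \<le> \<Lambda>" "1 + 2 * \<sigma> \<le> \<Lambda>" using \<open>1 < l0\<close> by (auto simp: \<Lambda>_def)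
  have K: "2 \<le> K" using \<Lambda> by (simp add: K_def)
  have "wH1 \<Omega> x0 b lam \<beta> h \<le> K / lam * wint \<Omega> x0 b lam \<beta> (\<lambda>x. (norm (vlaplacian h x - S *v h x))\<^sup>2)"
    if lam: "l0 < lam" and h: "zero_cauchy \<Omega> \<nu> h" for lam and h :: "'a \<Rightarrow> real ^ 'N"
  proof -
    let ?X = "\<lambda>lam. wint \<Omega> x0 b lam \<beta> (\<lambda>x. (norm (vlaplacian h x - S *v h x))\<^sup>2)"
    have C: "C2v \<Omega> h" using h by (simp add: zero_cauchy_def)
    have X0: "0 \<le> ?X lam" for lam by (intro wint_nonneg) simp
    have large: "wH1 \<Omega> x0 b l \<beta> h \<le> 2 / l * ?X l" if "\<Lambda> \<le> l" for l
      using carleman_perturbed[OF carl[OF _ h] S \<open>0 \<le> \<sigma>\<close> _ C, of l] that \<Lambda> by (simp add: field_simps)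
    show ?thesis
    proof (cases "\<Lambda> \<le> lam")
      case True
      have "2 / lam * ?X lam \<le> K / lam * ?X lam"
        using K True \<Lambda> by (intro mult_right_mono X0 divide_right_mono) auto
      with large[OF True] show ?thesis by simp
    next
      case False
      have bcL: "bcont_on \<Omega> (\<lambda>x. (norm (vlaplacian h x - S *v h x))\<^sup>2)"
        by (intro bcont_on_norm_sq bcont_on_diff C2v_bcont bounded_domain C
            bcont_on_bounded_linear[OF matrix_vector_mul_bounded_linear])
      \<comment> \<open>The weight increases with \<lambda>, so the left side moves up to \<Lambda>
        for free; only the return on the right side costs a factor. At the end 1 / \<Lambda> \<le> 1
        / \<lambda> restores the required form.\<close>
      have "wH1 \<Omega> x0 b lam \<beta> h \<le> wH1 \<Omega> x0 b \<Lambda> \<beta> h"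
        unfolding wH1_def using lam False \<open>1 < l0\<close>
        by (intro wint_weight_mono bcont_on_wH1_integrand C) auto
      also have "\<dots> \<le> 2 / \<Lambda> * ?X \<Lambda>" by (rule large) simp
      also have "\<dots> \<le> 2 / \<Lambda> * (exp (2 * \<Lambda>) * ?X lam)"
        using lam False \<open>1 < l0\<close> \<Lambda> by (intro mult_left_mono wint_weight_mono bcL) auto
      also have "\<dots> = K / \<Lambda> * ?X lam" by (simp add: K_def)
      also have "\<dots> \<le> K / lam * ?X lam"
        using lam False \<open>1 < l0\<close> K by (intro mult_right_mono X0 divide_left_mono) auto
      finally show ?thesis .
    qed
  qed
  then show ?thesis using K by (intro exI[of _ K]) auto
qed

text \<open>\<open>U\<close> is the new iterate, \<open>V\<close> the previous one,
  \<open>U'\<close> the true solution; \<open>fV\<close> and \<open>fU'\<close> are the nonlinear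
  term at \<open>V\<close> and \<open>U'\<close>; \<open>nU\<close>, \<open>nw\<close>,
  \<open>nU'\<close>, \<open>ne\<close> stand for squared Sobolev norms, with \<open>nw\<close> that
  of \<open>U' + e\<close>. Norms and nonlinearity enter only as numbers and through pointwise
  relations and regularity, which leaves a computation with weighted integrals.\<close>

lemma contraction_step:
  fixes U U' V e :: "'a \<Rightarrow> real ^ 'N::finite" and S :: "real ^ 'N ^ 'N" and fV fU' :: "'a \<Rightarrow> real ^ 'N"
  assumes C: "C2v \<Omega> U" "C2v \<Omega> U'" "C2v \<Omega> V" "C2v \<Omega> e"
    and lam: "0 < lam" and K: "0 < K"
    and carl: "wH1 \<Omega> x0 b lam \<beta> (\<lambda>x. U x - (U' x + e x)) \<le> K / lam * wint \<Omega> x0 b lam \<beta>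
      (\<lambda>x. (norm (vlaplacian (\<lambda>x. U x - (U' x + e x)) x - S *v (U x - (U' x + e x))))\<^sup>2)"
    and S: "\<And>v. (norm (S *v v))\<^sup>2 \<le> \<sigma> * (norm v)\<^sup>2" and \<sigma>: "0 \<le> \<sigma>"
    and min: "wint \<Omega> x0 b lam \<beta> (\<lambda>x. (norm (vlaplacian U x - S *v U x + fV x))\<^sup>2) + \<epsilon> * nU \<le>
      wint \<Omega> x0 b lam \<beta> (\<lambda>x. (norm (vlaplacian (\<lambda>x. U' x + e x) x - S *v (U' x + e x) + fV x))\<^sup>2) + \<epsilon> * nw"
    and n: "0 \<le> nU" "nw \<le> 2 * nU' + 2 * ne" "0 \<le> nU'" "0 \<le> ne" and \<epsilon>: "0 < \<epsilon>"
    and f: "bcont_on \<Omega> fV"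
    and sol: "\<And>x. x \<in> \<Omega> \<Longrightarrow> vlaplacian U' x - S *v U' x + fU' x = 0"
    and Lip: "\<And>x. x \<in> \<Omega> \<Longrightarrow> (norm (fV x - fU' x))\<^sup>2 \<le>
      B\<^sup>2 * ((norm (V x - U' x))\<^sup>2 + (norm (vgrad V x - vgrad U' x))\<^sup>2)"
    and Const: "Const = K * (40 + 32 * \<sigma> + 16 * B\<^sup>2)"
  shows "wH1 \<Omega> x0 b lam \<beta> (\<lambda>x. U x - U' x) \<le> Const / lam * wH1 \<Omega> x0 b lam \<beta> (\<lambda>x. V x - U' x)
    + (2 + Const / lam) * wH2 \<Omega> x0 b lam \<beta> e + Const / lam * \<epsilon> * (ne + nU')"
proof -
  let ?w = "wint \<Omega> x0 b lam \<beta>"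
  define w where "w x = U' x + e x" for x
  define h where "h x = U x - w x" for x
  define L where "L W x = vlaplacian W x - S *v W x" for W :: "'a \<Rightarrow> real ^ 'N" and x
  define E1 where "E1 x = (norm (V x - U' x))\<^sup>2 + (norm (vgrad (\<lambda>x. V x - U' x) x))\<^sup>2" for x
  define E2 where "E2 x = (norm (e x))\<^sup>2 + (norm (vgrad e x))\<^sup>2 + (norm (vlaplacian e x))\<^sup>2" for x
  have lam0: "0 \<le> lam" using lam by simp
  note op = open_domain
  have Cw: "C2v \<Omega> w" unfolding w_def[abs_def] by (rule C2v_add(1)[OF op C(2,4)])
  have Ch: "C2v \<Omega> h" unfolding h_def[abs_def] by (rule C2v_diff(1)[OF op C(1) Cw])
  have bcL: "bcont_on \<Omega> (L W)" if "C2v \<Omega> W" for W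
    unfolding L_def[abs_def] using that
    by (intro bcont_on_diff C2v_bcont bounded_domain
        bcont_on_bounded_linear[OF matrix_vector_mul_bounded_linear])
  have bcE: "bcont_on \<Omega> E1" "bcont_on \<Omega> E2"
    unfolding E1_def[abs_def] E2_def[abs_def]
    by (intro bcont_on_wH1_integrand C2v_diff(1) op C)+
  \<comment> \<open>Adding \<open>fV\<close> to both terms changes nothing in the difference but
    turns them into the two residuals that minimality compares.\<close>
  have Lh: "L h x = (L U x + fV x) - (L w x + fV x)" if "x \<in> \<Omega>" for x
    using C2v_diff(3)[OF op C(1) Cw that]
    by (simp add: L_def h_def[abs_def] matrix_vector_mult_diff_distrib)
  \<comment> \<open>The equation for \<open>U'\<close> replaces L U' by - \<open>fU'\<close>, so
    only e and a difference of nonlinear terms remain.\<close>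
  have Lw: "L w x + fV x = L e x + (fV x - fU' x)" if "x \<in> \<Omega>" for x
    using C2v_add(3)[OF op C(2,4) that] sol[OF that]
    by (simp add: L_def w_def[abs_def] matrix_vector_right_distrib) (simp add: algebra_simps)
  have Le: "(norm (L e x))\<^sup>2 \<le> (2 + 2 * \<sigma>) * E2 x" for x
  proof -
    have "(norm (L e x))\<^sup>2 \<le> 2 * (norm (vlaplacian e x))\<^sup>2 + 2 * (\<sigma> * (norm (e x))\<^sup>2)"
      unfolding L_def using norm_diff_sq_le[of "vlaplacian e x" "S *v e x"] S[of "e x"] by linarith
    also have "\<dots> \<le> (2 + 2 * \<sigma>) * E2 x"
      using \<sigma> by (simp add: E2_def algebra_simps)
    finally show ?thesis .
  qed
  have G: "(norm (L w x + fV x))\<^sup>2 \<le> (4 + 4 * \<sigma>) * E2 x + (2 * B\<^sup>2) * E1 x" if "x \<in> \<Omega>" for x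
  proof -
    have "(norm (L w x + fV x))\<^sup>2 \<le> 2 * (norm (L e x))\<^sup>2 + 2 * (norm (fV x - fU' x))\<^sup>2"
      unfolding Lw[OF that] by (rule norm_add_sq_le)
    also have "\<dots> \<le> 2 * ((2 + 2 * \<sigma>) * E2 x) + 2 * (B\<^sup>2 * E1 x)"
      using Le[of x] Lip[OF that] C2v_diff(2)[OF op C(3,2) that] by (simp add: E1_def)
    finally show ?thesis by (simp add: algebra_simps)
  qed
  have wE1: "?w E1 = wH1 \<Omega> x0 b lam \<beta> (\<lambda>x. V x - U' x)" by (simp add: wH1_def E1_def[abs_def])
  have wE2: "?w E2 = wH2 \<Omega> x0 b lam \<beta> e" by (simp add: wH2_def E2_def[abs_def])
  have bcG: "bcont_on \<Omega> (\<lambda>x. (norm (L W x + fV x))\<^sup>2)" if "C2v \<Omega> W" for W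
    using that by (intro bcont_on_norm_sq bcont_on_add bcL f)
  have "?w (\<lambda>x. (norm (L w x + fV x))\<^sup>2) \<le> ?w (\<lambda>x. (4 + 4 * \<sigma>) * E2 x + (2 * B\<^sup>2) * E1 x)"
    by (intro wint_mono bcG Cw bcont_on_add bcont_on_cmult bcE lam0 G)
  also have "\<dots> = (4 + 4 * \<sigma>) * ?w E2 + (2 * B\<^sup>2) * ?w E1"
    by (subst wint_add) (auto simp: wint_cmult lam0 intro!: bcont_on_cmult bcE)
  finally have Y: "?w (\<lambda>x. (norm (L w x + fV x))\<^sup>2) \<le> (4 + 4 * \<sigma>) * ?w E2 + (2 * B\<^sup>2) * ?w E1" .
  have "?w (\<lambda>x. (norm (L h x))\<^sup>2) \<le> ?w (\<lambda>x. 2 * (norm (L U x + fV x))\<^sup>2 + 2 * (norm (L w x + fV x))\<^sup>2)"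
    by (intro wint_mono bcont_on_add bcont_on_cmult bcont_on_norm_sq[OF bcL] bcG C Ch Cw lam0)
      (simp only: Lh norm_diff_sq_le)
  also have "\<dots> = 2 * ?w (\<lambda>x. (norm (L U x + fV x))\<^sup>2) + 2 * ?w (\<lambda>x. (norm (L w x + fV x))\<^sup>2)"
    by (subst wint_add) (auto simp: wint_cmult lam0 intro!: bcont_on_cmult bcG C Cw)
  \<comment> \<open>The residual of \<open>w\<close> counts twice by itself and twice more as the
    bound for the residual of \<open>U\<close>.\<close>
  also have "\<dots> \<le> 4 * ?w (\<lambda>x. (norm (L w x + fV x))\<^sup>2) + 2 * (\<epsilon> * nw)"
  proof -
    have "?w (\<lambda>x. (norm (L U x + fV x))\<^sup>2) + \<epsilon> * nU \<le> ?w (\<lambda>x. (norm (L w x + fV x))\<^sup>2) + \<epsilon> * nw"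
      using min by (simp add: L_def w_def[abs_def])
    moreover have "0 \<le> \<epsilon> * nU" using \<epsilon> n by simp
    ultimately show ?thesis by linarith
  qed
  also have "\<dots> \<le> 4 * ((4 + 4 * \<sigma>) * ?w E2 + (2 * B\<^sup>2) * ?w E1) + 2 * (\<epsilon> * (2 * nU' + 2 * ne))"
    using Y n \<epsilon> by (intro add_mono mult_left_mono) auto
  finally have X: "?w (\<lambda>x. (norm (L h x))\<^sup>2) \<le> \<dots>" .
  have Uh: "U x - U' x = h x + e x" for x by (simp add: h_def w_def)
  \<comment> \<open>\<open>E2\<close> contains a Laplacian term absent on the left; including it
    lets all contributions of e be collected in one integral.\<close>
  have "(norm (U x - U' x))\<^sup>2 + (norm (vgrad (\<lambda>x. U x - U' x) x))\<^sup>2 \<le>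
      2 * ((norm (h x))\<^sup>2 + (norm (vgrad h x))\<^sup>2) + 2 * E2 x" if "x \<in> \<Omega>" for x
    unfolding Uh C2v_add(2)[OF op Ch C(4) that]
    using norm_add_sq_le[of "h x" "e x"] norm_add_sq_le[of "vgrad h x" "vgrad e x"]
      zero_le_power2[of "norm (vlaplacian e x)"] unfolding E2_def by argo
  then have "wH1 \<Omega> x0 b lam \<beta> (\<lambda>x. U x - U' x) \<le>
      ?w (\<lambda>x. 2 * ((norm (h x))\<^sup>2 + (norm (vgrad h x))\<^sup>2) + 2 * E2 x)"
    unfolding wH1_def
    by (intro wint_mono lam0 bcont_on_add[OF bcont_on_cmult bcont_on_cmult] bcE
        bcont_on_wH1_integrand C2v_diff(1) op C Ch)
  also have "\<dots> = 2 * wH1 \<Omega> x0 b lam \<beta> h + 2 * ?w E2"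
    unfolding wH1_def
    by (subst wint_add[OF bcont_on_cmult[OF bcont_on_wH1_integrand(1)[OF Ch]] bcont_on_cmult[OF bcE(2)] lam0])
      (simp only: wint_cmult)
  also have "wH1 \<Omega> x0 b lam \<beta> h \<le> K / lam * ?w (\<lambda>x. (norm (L h x))\<^sup>2)"
    using carl by (simp add: L_def h_def[abs_def] w_def[abs_def])
  also have "\<dots> \<le> K / lam * (4 * ((4 + 4 * \<sigma>) * ?w E2 + (2 * B\<^sup>2) * ?w E1) + 2 * (\<epsilon> * (2 * nU' + 2 * ne)))"
    using K lam by (intro mult_left_mono X) auto
  finally have main: "wH1 \<Omega> x0 b lam \<beta> (\<lambda>x. U x - U' x) \<le>
    2 * (K / lam * (4 * ((4 + 4 * \<sigma>) * ?w E2 + (2 * B\<^sup>2) * ?w E1) + 2 * (\<epsilon> * (2 * nU' + 2 * ne)))) + 2 * ?w E2"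
    by simp
  \<comment> \<open>The factors are 16 = 2 * 4 * 2, 32 = 2 * 4 * 4 and 8 = 2 * 2 * 2.
    \<open>Const\<close> is K times the sum of 16 B^2, 32 + 32 \<sigma> and 8, so it dominates all
    three coefficients.\<close>
  also have "\<dots> = (K * (16 * B\<^sup>2)) / lam * ?w E1 + (2 + (K * (32 + 32 * \<sigma>)) / lam) * ?w E2
      + (K * 8) / lam * (\<epsilon> * (ne + nU'))"
    using lam by (simp add: field_simps)
  also have "\<dots> \<le> Const / lam * ?w E1 + (2 + Const / lam) * ?w E2 + Const / lam * (\<epsilon> * (ne + nU'))"
  proof -
    have "0 \<le> ?w E1" "0 \<le> ?w E2" by (intro wint_nonneg; simp add: E1_def E2_def)+
    moreover have "0 \<le> \<epsilon> * (ne + nU')" using n \<epsilon> by simp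
    moreover have "K * (16 * B\<^sup>2) \<le> Const" "K * (32 + 32 * \<sigma>) \<le> Const" "K * 8 \<le> Const"
      unfolding Const using \<sigma> K by (intro mult_left_mono; simp)+
    ultimately show ?thesis
      using lam by (intro add_mono mult_right_mono divide_right_mono order_refl) auto
  qed
  finally show ?thesis by (simp add: wE1 wE2 mult.assoc)
qed

end

section \<open>Iterating the one-step estimate\<close>

lemma contraction_iteration:
  fixes a :: "nat \<Rightarrow> real"
  assumes step: "\<And>k. k \<ge> 1 \<Longrightarrow> a k \<le> \<theta> * a (k - 1) + (2 + \<theta>) * p + \<theta> * q"
    and \<theta>: "0 < \<theta>" "\<theta> < 1" and p: "0 \<le> p"
  shows "a k \<le> \<theta> ^ k * a 0 + 3 * (1 - \<theta> ^ (k + 1)) / (1 - \<theta>) * p + \<theta> * (1 - \<theta> ^ k) / (1 - \<theta>) * q"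
proof -
  \<comment> \<open>The geometric sum of k terms. The p-term carries s (k + 1), one summand more
    than the recursion produces; at k = 0 the surplus is 3 p \<ge> 0.\<close>
  define s where "s k = (1 - \<theta> ^ k) / (1 - \<theta>)" for k :: nat
  have s0: "s 0 = 0" and sSuc: "s (Suc k) = 1 + \<theta> * s k" for k
    using \<theta> by (auto simp: s_def field_simps)
  have "a k \<le> \<theta> ^ k * a 0 + 3 * s (k + 1) * p + \<theta> * s k * q"
  proof (induction k)
    case 0
    then show ?case using p by (simp add: s0 sSuc)
  next
    case (Suc k)
    have "a (Suc k) \<le> \<theta> * a k + (2 + \<theta>) * p + \<theta> * q" using step[of "Suc k"] by simp
    \<comment> \<open>Here 2 + \<theta> is rounded up to 3, the origin of the 3 in the iterated
      bound.\<close>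
    also have "\<dots> \<le> \<theta> * (\<theta> ^ k * a 0 + 3 * s (k + 1) * p + \<theta> * s k * q) + 3 * p + \<theta> * q"
      using \<theta> p by (intro add_mono mult_left_mono mult_right_mono Suc.IH) auto
    also have "\<dots> = \<theta> ^ Suc k * a 0 + 3 * s (Suc k + 1) * p + \<theta> * s (Suc k) * q"
      using sSuc[of "Suc k"] sSuc[of k] by (simp add: algebra_simps)
    finally show ?case .
  qed
  then show ?thesis by (simp add: s_def)
qed

text \<open>Continuity follows from differentiability of G over \<Omega>; boundedness comes from the
  uniform bound on G, which the C^1 norm supplies in the application.\<close>

lemma bcont_on_nonlinearity:
  fixes V :: "'a::euclidean_space \<Rightarrow> real ^ 'N::finite"
  assumes diff: "\<And>x u P. x \<in> \<Omega> \<Longrightarrow> G differentiable (at (x, u, P))"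
    and bound: "\<And>x u P. x \<in> \<Omega> \<Longrightarrow> norm (G (x, u, P)) \<le> B"
    and \<Omega>: "bounded \<Omega>" and V: "C2v \<Omega> V"
  shows "bcont_on \<Omega> (\<lambda>x. G (x, V x, vgrad V x) :: real ^ 'N)"
  unfolding bcont_on_def
proof
  have "continuous_on (\<Omega> \<times> UNIV \<times> UNIV) G"
    using diff by (intro continuous_at_imp_continuous_on)
      (auto simp: differentiable_imp_continuous_within)
  moreover have "continuous_on \<Omega> (\<lambda>x. (x, V x, vgrad V x))"
    using C2v_bcont[OF \<Omega> V] by (auto simp: bcont_on_def intro!: continuous_intros)
  ultimately show "continuous_on \<Omega> (\<lambda>x. G (x, V x, vgrad V x))"
    by (rule continuous_on_compose2) auto
  show "bounded ((\<lambda>x. G (x, V x, vgrad V x)) ` \<Omega>)"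
    using bound by (auto simp: bounded_iff)
qed

theorem theorem3p1:
  fixes \<Omega> :: "'a::euclidean_space set" and \<nu> :: "'a \<Rightarrow> 'a" and x0 :: 'a and b T \<beta>0 :: real
    and lam0 C1 :: "real \<Rightarrow> real" and \<Psi> :: "nat \<Rightarrow> real \<Rightarrow> real" and \<iota> :: "'N::finite \<Rightarrow> nat"
    and M :: ennreal
  assumes "DIM('a) \<ge> 2" and "T > 0"
    and "smooth_domain \<Omega>" and "outer_normal \<Omega> \<nu>"
    and "orthonormal_basis_L2 T \<Psi>" and "\<forall>n\<ge>1. C2_time T (\<Psi> n)"
    and "bij_betw \<iota> UNIV {1..CARD('N)}"
    and "x0 \<notin> \<Omega>" and "\<forall>x\<in>closure \<Omega>. norm (x - x0) < b"
    and "carleman_constants \<Omega> \<nu> x0 b \<beta>0 lam0 C1"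
    and "M < \<infinity>"
  shows "\<exists>C>0. \<forall>(F :: 'a \<times> real \<times> real \<times> 'a \<Rightarrow> real) (p :: 'a \<Rightarrow> real) (s :: real)
      (f :: 'a \<Rightarrow> real \<Rightarrow> real) (g :: 'a \<Rightarrow> real \<Rightarrow> real)
      (f' :: 'a \<Rightarrow> real \<Rightarrow> real) (g' :: 'a \<Rightarrow> real \<Rightarrow> real)
      (\<epsilon> :: real) (\<delta> :: real) (U' :: 'a \<Rightarrow> real ^ 'N) (e :: 'a \<Rightarrow> real ^ 'N).
      (let \<psi> = (\<lambda>n. \<Psi> (\<iota> n));
           fv = time_coeffs T \<psi> f; gv = time_coeffs T \<psi> g;
           fv' = time_coeffs T \<psi> f'; gv' = time_coeffs T \<psi> g';
           H = Hs_cauchy s \<Omega> \<nu> fv gv;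
           E = Hs_cauchy s \<Omega> \<nu> (\<lambda>x. fv x - fv' x) (\<lambda>x. gv x - gv' x)
       in smooth_on UNIV F \<and> smooth_on UNIV p \<and>
          (\<forall>x\<in>closure \<Omega>. F (x, p x, 0, grad p x) \<noteq> 0) \<and>
          C1_norm (closure \<Omega> \<times> UNIV \<times> UNIV) (calF T \<psi> F p) = M \<and>
          s > of_int \<lceil>real DIM('a) / 2\<rceil> + 2 \<and>
          H \<noteq> {} \<and>
          reduced_solution s \<Omega> \<nu> T \<psi> F p fv' gv' U' \<and>
          (\<forall>V. reduced_solution s \<Omega> \<nu> T \<psi> F p fv' gv' V \<longrightarrow> (\<forall>x\<in>\<Omega>. V x = U' x)) \<and>
          \<delta> > 0 \<and> (INF h\<in>E. ereal (Hs_norm s \<Omega> h)) < ereal \<delta> \<and>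
          e \<in> E \<and> Hs_norm s \<Omega> e < 2 * \<delta> \<and>
          \<epsilon> > 0
          \<longrightarrow>
          (\<forall>lam>lam0 \<beta>0. \<forall>U :: nat \<Rightarrow> 'a \<Rightarrow> real ^ 'N.
             U 0 \<in> H \<and>
             (\<forall>k\<ge>1. U k \<in> carleman_map s \<Omega> T \<psi> F p x0 b \<epsilon> lam \<beta>0 H (U (k - 1)))
             \<longrightarrow>
             (\<forall>k\<ge>1. wH1 \<Omega> x0 b lam \<beta>0 (\<lambda>x. U k x - U' x)
                \<le> C / lam * wH1 \<Omega> x0 b lam \<beta>0 (\<lambda>x. U (k - 1) x - U' x)
                  + (2 + C / lam) * wH2 \<Omega> x0 b lam \<beta>0 e
                  + C / lam * \<epsilon> * ((Hs_norm s \<Omega> e)\<^sup>2 + (Hs_norm s \<Omega> U')\<^sup>2)) \<and>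
             (\<forall>\<theta>. \<theta> = C / lam \<and> 0 < \<theta> \<and> \<theta> < 1 \<and> lam ^ 3 - C > lam \<longrightarrow>
               (\<forall>k\<ge>1. wH1 \<Omega> x0 b lam \<beta>0 (\<lambda>x. U k x - U' x)
                  \<le> \<theta> ^ k * wH1 \<Omega> x0 b lam \<beta>0 (\<lambda>x. U 0 x - U' x)
                    + 3 * (1 - \<theta> ^ (k + 1)) / (1 - \<theta>) * wH2 \<Omega> x0 b lam \<beta>0 e
                    + \<theta> * \<epsilon> * (1 - \<theta> ^ k) / (1 - \<theta>) *
                      ((Hs_norm s \<Omega> e)\<^sup>2 + (Hs_norm s \<Omega> U')\<^sup>2)))))"
proof -
  define \<psi> where "\<psi> = (\<lambda>n. \<Psi> (\<iota> n))"
  define S where "S = Smat T \<psi>"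
  \<comment> \<open>The operator norm of S is squared because all later pointwise bounds compare
    squares.\<close>
  define \<sigma> where "\<sigma> = (onorm ((*v) S))\<^sup>2"
  define B where "B = enn2real M"
  have \<Omega>: "open \<Omega>" "bounded \<Omega>" "\<Omega> \<noteq> {}"
    using assms(3) by (auto simp: smooth_domain_def)
  have in_ball: "norm (x - x0) < b" if "x \<in> \<Omega>" for x
    using assms(9) that closure_subset by blast
  have b: "b > 0"
  proof -
    obtain x where "x \<in> \<Omega>" using \<Omega>(3) by blast
    from in_ball[OF this] show ?thesis using norm_ge_zero[of "x - x0"] by linarith
  qed
  have \<beta>: "\<beta>0 > 0" and l0: "lam0 \<beta>0 > 1" and c1: "C1 \<beta>0 > 1"
    using assms(10) by (auto simp: carleman_constants_def)
  interpret weighted_domain \<Omega> x0 b \<beta>0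
    by unfold_locales (use \<Omega> in_ball b \<beta> in auto)
  have S: "(norm (S *v v))\<^sup>2 \<le> \<sigma> * (norm v)\<^sup>2" for v
    using power_mono[OF onorm[OF matrix_vector_mul_bounded_linear[of S], of v] norm_ge_zero, of 2]
    by (simp add: \<sigma>_def power_mult_distrib)
  have \<sigma>: "0 \<le> \<sigma>" by (simp add: \<sigma>_def)
  have carl: "lam * wint \<Omega> x0 b lam \<beta>0 (\<lambda>x. (norm (vgrad h x))\<^sup>2)
        + lam ^ 3 * wint \<Omega> x0 b lam \<beta>0 (\<lambda>x. (norm (h x))\<^sup>2)
      \<le> wint \<Omega> x0 b lam \<beta>0 (\<lambda>x. (norm (vlaplacian h x))\<^sup>2)"
    if "lam0 \<beta>0 \<le> lam" "zero_cauchy \<Omega> \<nu> h" for lam and h :: "'a \<Rightarrow> real ^ 'N"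
  proof (rule carleman_vector[where c = "C1 \<beta>0" and \<nu> = \<nu>])
    fix h :: "'a \<Rightarrow> real"
    assume "C2_closure \<Omega> h" "\<forall>x\<in>frontier \<Omega>. bdry_value \<Omega> h x = 0 \<and> normal_deriv \<Omega> \<nu> h x = 0"
    then show "C1 \<beta>0 * lam * wint \<Omega> x0 b lam \<beta>0 (\<lambda>x. (norm (grad h x))\<^sup>2) +
        C1 \<beta>0 * lam ^ 3 * wint \<Omega> x0 b lam \<beta>0 (\<lambda>x. (h x)\<^sup>2)
      \<le> wint \<Omega> x0 b lam \<beta>0 (\<lambda>x. (laplacian h x)\<^sup>2)"
      using assms(10) that(1) unfolding carleman_constants_def by blast
  qed (use that l0 c1 in auto)
  obtain K where K: "K > 0" and Kbound: "\<And>lam h. lam0 \<beta>0 < lam \<Longrightarrow> zero_cauchy \<Omega> \<nu> (h :: 'a \<Rightarrow> real ^ 'N) \<Longrightarrow>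
      wH1 \<Omega> x0 b lam \<beta>0 h \<le> K / lam * wint \<Omega> x0 b lam \<beta>0 (\<lambda>x. (norm (vlaplacian h x - S *v h x))\<^sup>2)"
    using carleman_perturbed_uniform[OF carl S \<sigma> l0] by blast
  \<comment> \<open>No F, p, s, data, \<epsilon> or \<lambda> has been introduced yet: \<sigma>
    comes from T and the basis, K from S and the Carleman estimate, and B from the prescribed finite
    value M of the C^1 norm.\<close>
  define C where "C = K * (40 + 32 * \<sigma> + 16 * B\<^sup>2)"
  have "C > 0"
    unfolding C_def using K \<sigma> by (intro mult_pos_pos add_pos_nonneg) auto
  have \<psi>: "C2_time T (\<psi> n)" for n
  proof -
    have "\<iota> n \<in> {1..CARD('N)}" using assms(7) by (auto simp: bij_betw_def)
    then show ?thesis using assms(6) by (simp add: \<psi>_def)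
  qed
  \<comment> \<open>The boundary data enter as arbitrary functions and the iterates as an arbitrary
    pair, so this one fact serves both conclusions.\<close>
  have step: "wH1 \<Omega> x0 b lam \<beta>0 (\<lambda>x. U1 x - U' x)
      \<le> C / lam * wH1 \<Omega> x0 b lam \<beta>0 (\<lambda>x. U0 x - U' x)
        + (2 + C / lam) * wH2 \<Omega> x0 b lam \<beta>0 e
        + C / lam * \<epsilon> * ((Hs_norm s \<Omega> e)\<^sup>2 + (Hs_norm s \<Omega> U')\<^sup>2)"
    if F: "smooth_on UNIV F" and p: "smooth_on UNIV p" and nz: "\<forall>x\<in>closure \<Omega>. F (x, p x, 0, grad p x) \<noteq> 0"
      and M: "C1_norm (closure \<Omega> \<times> UNIV \<times> UNIV) (calF T \<psi> F p) = M"
      and U': "reduced_solution s \<Omega> \<nu> T \<psi> F p fv' gv' U'"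
      and e: "e \<in> Hs_cauchy s \<Omega> \<nu> (\<lambda>x. fv x - fv' x) (\<lambda>x. gv x - gv' x)"
      and \<epsilon>: "\<epsilon> > 0" and lam: "lam > lam0 \<beta>0"
      and U0: "U0 \<in> Hs_cauchy s \<Omega> \<nu> fv gv"
      and U1: "U1 \<in> carleman_map s \<Omega> T \<psi> F p x0 b \<epsilon> lam \<beta>0 (Hs_cauchy s \<Omega> \<nu> fv gv) U0"
    for F :: "'a \<times> real \<times> real \<times> 'a \<Rightarrow> real" and p s fv gv fv' gv' \<epsilon> U' e lam U0 U1
  proof -
    let ?F = "calF T \<psi> F p"
    have diff: "?F differentiable (at (x, u, P))" if "x \<in> closure \<Omega>" for x u P
      using nz that by (intro calF_differentiable F p \<psi>) auto
    have U'H: "U' \<in> Hs_cauchy s \<Omega> \<nu> fv' gv'"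
      and sol: "\<And>x. x \<in> \<Omega> \<Longrightarrow> vlaplacian U' x - S *v U' x + ?F (x, U' x, vgrad U' x) = 0"
      using U' by (auto simp: reduced_solution_def S_def)
    have wH: "(\<lambda>x. U' x + e x) \<in> Hs_cauchy s \<Omega> \<nu> fv gv"
      using Hs_cauchy_add[OF \<Omega>(1,2) U'H e] by simp
    have U1H: "U1 \<in> Hs_cauchy s \<Omega> \<nu> fv gv"
      and min: "\<And>W. W \<in> Hs_cauchy s \<Omega> \<nu> fv gv \<Longrightarrow>
        carleman_functional s \<Omega> T \<psi> F p x0 b \<epsilon> lam \<beta>0 U0 U1 \<le>
        carleman_functional s \<Omega> T \<psi> F p x0 b \<epsilon> lam \<beta>0 U0 W"
      using U1 by (auto simp: carleman_map_def is_arg_min_linorder)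
    have Hs: "U' \<in> Hs s \<Omega>" "e \<in> Hs s \<Omega>" "U0 \<in> Hs s \<Omega>" "U1 \<in> Hs s \<Omega>"
      using U'H e U0 U1H by (auto simp: Hs_cauchy_def)
    note C2 = Hs[THEN Hs_C2v]
    show ?thesis
    proof (rule contraction_step[where K = K and \<sigma> = \<sigma> and S = S and B = B
          and fV = "\<lambda>x. ?F (x, U0 x, vgrad U0 x)" and fU' = "\<lambda>x. ?F (x, U' x, vgrad U' x)"
          and nU = "(Hs_norm s \<Omega> U1)\<^sup>2" and nw = "(Hs_norm s \<Omega> (\<lambda>x. U' x + e x))\<^sup>2"])
      show "wH1 \<Omega> x0 b lam \<beta>0 (\<lambda>x. U1 x - (U' x + e x)) \<le> K / lam * wint \<Omega> x0 b lam \<beta>0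
        (\<lambda>x. (norm (vlaplacian (\<lambda>x. U1 x - (U' x + e x)) x - S *v (U1 x - (U' x + e x))))\<^sup>2)"
        by (rule Kbound[OF lam zero_cauchy_diff[OF \<Omega>(1) U1H wH]])
      show "wint \<Omega> x0 b lam \<beta>0 (\<lambda>x. (norm (vlaplacian U1 x - S *v U1 x + ?F (x, U0 x, vgrad U0 x)))\<^sup>2)
          + \<epsilon> * (Hs_norm s \<Omega> U1)\<^sup>2 \<le>
        wint \<Omega> x0 b lam \<beta>0 (\<lambda>x. (norm (vlaplacian (\<lambda>x. U' x + e x) x - S *v (U' x + e x)
          + ?F (x, U0 x, vgrad U0 x)))\<^sup>2) + \<epsilon> * (Hs_norm s \<Omega> (\<lambda>x. U' x + e x))\<^sup>2"
        using min[OF wH] by (simp add: carleman_functional_def S_def)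
      show "(Hs_norm s \<Omega> (\<lambda>x. U' x + e x))\<^sup>2 \<le> 2 * (Hs_norm s \<Omega> U')\<^sup>2 + 2 * (Hs_norm s \<Omega> e)\<^sup>2"
        by (rule Hs_norm_add_sq_le[OF \<Omega>(1,2) Hs(1,2)])
      show "bcont_on \<Omega> (\<lambda>x. ?F (x, U0 x, vgrad U0 x))"
      proof (rule bcont_on_nonlinearity[OF _ _ \<Omega>(2) C2(3)])
        fix x u P assume "x \<in> \<Omega>"
        then have x: "x \<in> closure \<Omega>" using closure_subset by blast
        then show "?F differentiable (at (x, u, P))" by (rule diff)
        show "norm (?F (x, u, P)) \<le> enn2real M"
          by (rule C1_norm_boundD(1)[OF M assms(11)]) (use x in auto)
      qed
      show "(norm (?F (x, U0 x, vgrad U0 x) - ?F (x, U' x, vgrad U' x)))\<^sup>2 \<le>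
        B\<^sup>2 * ((norm (U0 x - U' x))\<^sup>2 + (norm (vgrad U0 x - vgrad U' x))\<^sup>2)" if "x \<in> \<Omega>" for x
      proof -
        have x: "x \<in> closure \<Omega>" using that closure_subset by blast
        show ?thesis unfolding B_def by (rule C1_norm_Lipschitz[OF diff[OF x] M assms(11) x])
      qed
    qed (use C2 lam l0 K S \<sigma> \<epsilon> sol in \<open>auto simp: C_def\<close>)
  qed
  show ?thesis
    unfolding Let_def \<psi>_def[symmetric]
  proof (intro exI[of _ C] conjI allI impI, goal_cases)
    case 1
    show ?case by fact
  next
    case (2 F p s f g f' g' \<epsilon> \<delta> U' e lam U k)
    note A = 2(1) and lam = 2(2) and it = 2(3) and k = 2(4)
    \<comment> \<open>The initial function lies in H by assumption, every later iterate as a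
      minimizer over H.\<close>
    have "U j \<in> Hs_cauchy s \<Omega> \<nu> (time_coeffs T \<psi> f) (time_coeffs T \<psi> g)" for j
      using it by (cases j) (auto simp: carleman_map_def is_arg_min_def)
    then show ?case
      using A lam it k by (intro step) auto
  next
    case (3 F p s f g f' g' \<epsilon> \<delta> U' e lam U \<theta> k)
    note A = 3(1) and lam = 3(2) and it = 3(3) and \<theta> = 3(4) and k = 3(5)
    have H: "U j \<in> Hs_cauchy s \<Omega> \<nu> (time_coeffs T \<psi> f) (time_coeffs T \<psi> g)" for j
      using it by (cases j) (auto simp: carleman_map_def is_arg_min_def)
    \<comment> \<open>Including \<epsilon> in \<open>?q\<close> gives the inequality the shape of
      the abstract recursion, with \<theta> as its only coefficient on this term.\<close>
    let ?q = "\<epsilon> * ((Hs_norm s \<Omega> e)\<^sup>2 + (Hs_norm s \<Omega> U')\<^sup>2)"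
    have "wH1 \<Omega> x0 b lam \<beta>0 (\<lambda>x. U j x - U' x) \<le> \<theta> * wH1 \<Omega> x0 b lam \<beta>0 (\<lambda>x. U (j - 1) x - U' x)
        + (2 + \<theta>) * wH2 \<Omega> x0 b lam \<beta>0 e + \<theta> * ?q" if j: "j \<ge> 1" for j
    proof -
      have "wH1 \<Omega> x0 b lam \<beta>0 (\<lambda>x. U j x - U' x)
        \<le> C / lam * wH1 \<Omega> x0 b lam \<beta>0 (\<lambda>x. U (j - 1) x - U' x)
          + (2 + C / lam) * wH2 \<Omega> x0 b lam \<beta>0 e
          + C / lam * \<epsilon> * ((Hs_norm s \<Omega> e)\<^sup>2 + (Hs_norm s \<Omega> U')\<^sup>2)"
        using A lam it j H by (intro step) auto
      then show ?thesis using \<theta> by (simp add: mult.assoc)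
    qed
    moreover have "0 \<le> wH2 \<Omega> x0 b lam \<beta>0 e"
      unfolding wH2_def by (intro wint_nonneg) simp
    ultimately have "wH1 \<Omega> x0 b lam \<beta>0 (\<lambda>x. U k x - U' x) \<le> \<theta> ^ k * wH1 \<Omega> x0 b lam \<beta>0 (\<lambda>x. U 0 x - U' x)
        + 3 * (1 - \<theta> ^ (k + 1)) / (1 - \<theta>) * wH2 \<Omega> x0 b lam \<beta>0 e + \<theta> * (1 - \<theta> ^ k) / (1 - \<theta>) * ?q"
      using \<theta> by (intro contraction_iteration[where a = "\<lambda>k. wH1 \<Omega> x0 b lam \<beta>0 (\<lambda>x. U k x - U' x)"]) auto
    then show ?case by (simp add: mult_ac)
  qed
qed

end
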